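(* Let $(X,r)$ be a finite bijective left non-degenerate solution of the Yang--Baxter equation. Then $A=A(X,r)$ is a central-by-finite monoid, i.e., $A=\bigcup_{f\in F}Cf$ for a central submonoid $C\subseteq A$ and a finite subset $F\subseteq A$. In particular, if $K$ is a field then $K[A]$ is a finite module over a central affine subalgebra of $K[A]$. Hence $K[A]$ is a Noetherian PI-algebra satisfying $$\operatorname{clKdim}K[A]=\operatorname{GKdim}K[A]=\operatorname{rk}A\le|X|,$$ and the equality $\operatorname{rk}A=|X|$ holds if and only if the solution $(X,r)$ is involutive.
   Context: Let $X$ be a non-empty set. A (set-theoretic) solution of the Yang--Baxter equation is a pair $(X,r)$ with $r\colon X\times X\to X\times X$, written $r(x,y)=(\lambda_x(y),\rho_y(x))$, such that $(r\times\mathrm{id})(\mathrm{id}\times r)(r\times\mathrm{id})=(\mathrm{id}\times r)(r\times\mathrm{id})(\mathrm{id}\times r)$. It is finite if $X$ is finite, bijective if $r$ is bijective, left non-degenerate if every $\lambda_x\colon X\to X$ is bijective, and involutive if $r^2=\mathrm{id}$. For a left non-degenerate solution put $\sigma_z(x)=\lambda_z(\rho_{\lambda_x^{-1}(z)}(x))$ for $x,z\in X$; the derived structure monoid is $A(X,r)=\langle X\mid xz=z\sigma_z(x)\text{ for all }x,z\in X\rangle$. (If $(X,r)$ is bijective then each $\sigma_z\in\operatorname{Sym}(X)$.) $K[A]$ is the monoid algebra. "Affine" means finitely generated as a $K$-algebra; $\operatorname{clKdim}$ is the classical Krull dimension (supremum of lengths of chains of prime ideals), $\operatorname{GKdim}$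 the Gelfand--Kirillov dimension, and the rank $\operatorname{rk}$ of a monoid is the largest possible rank of a free abelian submonoid. *)

theory Defs
  imports "HOL-Algebra.Algebra" "HOL-Library.Extended_Real" "HOL-Library.Poly_Mapping"
begin

section \<open>Set-theoretic solutions of the Yang--Baxter equation\<close>

text \<open>The set \<open>X\<close> of a solution is the universe of the type \<^typ>\<open>'x\<close>.\<close>

definition apply12 :: "('x \<times> 'x \<Rightarrow> 'x \<times> 'x) \<Rightarrow> 'x \<times> 'x \<times> 'x \<Rightarrow> 'x \<times> 'x \<times> 'x" where
  "apply12 r = (\<lambda>(x, y, z). let (u, v) = r (x, y) in (u, v, z))"

definition apply23 :: "('x \<times> 'x \<Rightarrow> 'x \<times> 'x) \<Rightarrow> 'x \<times> 'x \<times> 'x \<Rightarrow> 'x \<times> 'x \<times> 'x" where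
  "apply23 r = (\<lambda>(x, y, z). (x, r (y, z)))"

definition ybe_solution :: "('x \<times> 'x \<Rightarrow> 'x \<times> 'x) \<Rightarrow> bool" where
  "ybe_solution r \<longleftrightarrow>
     apply12 r \<circ> apply23 r \<circ> apply12 r = apply23 r \<circ> apply12 r \<circ> apply23 r"

text \<open>The two components: \<open>r (x, y) = (lam r x y, rho r y x)\<close>.\<close>

definition lam :: "('x \<times> 'x \<Rightarrow> 'x \<times> 'x) \<Rightarrow> 'x \<Rightarrow> 'x \<Rightarrow> 'x" where
  "lam r x y = fst (r (x, y))"

definition rho :: "('x \<times> 'x \<Rightarrow> 'x \<times> 'x) \<Rightarrow> 'x \<Rightarrow> 'x \<Rightarrow> 'x" where
  "rho r y x = snd (r (x, y))"

definition left_nondegenerate :: "('x \<times> 'x \<Rightarrow> 'x \<times> 'x) \<Rightarrow> bool" where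
  "left_nondegenerate r \<longleftrightarrow> (\<forall>x. bij (lam r x))"

definition involutive :: "('x \<times> 'x \<Rightarrow> 'x \<times> 'x) \<Rightarrow> bool" where
  "involutive r \<longleftrightarrow> r \<circ> r = id"

definition sigma :: "('x \<times> 'x \<Rightarrow> 'x \<times> 'x) \<Rightarrow> 'x \<Rightarrow> 'x \<Rightarrow> 'x" where
  "sigma r z x = lam r z (rho r (inv_into UNIV (lam r x) z) x)"


section \<open>Monoid presentations and the derived structure monoid\<close>

inductive pres_cong :: "('x list \<times> 'x list) set \<Rightarrow> 'x list \<Rightarrow> 'x list \<Rightarrow> bool"
  for S where
    rel: "(u, v) \<in> S \<Longrightarrow> pres_cong S (p @ u @ q) (p @ v @ q)"
  | refl: "pres_cong S u u"
  | sym: "pres_cong S u v \<Longrightarrow> pres_cong S v u"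
  | trans: "pres_cong S u v \<Longrightarrow> pres_cong S v w \<Longrightarrow> pres_cong S u w"

definition pres_class :: "('x list \<times> 'x list) set \<Rightarrow> 'x list \<Rightarrow> 'x list set" where
  "pres_class S u = {v. pres_cong S u v}"

text \<open>The monoid generated by all elements of the type \<^typ>\<open>'x\<close> with defining relations \<open>S\<close>;
  its elements are the congruence classes of words.\<close>

definition presented_monoid :: "('x list \<times> 'x list) set \<Rightarrow> 'x list set monoid" where
  "presented_monoid S =
     \<lparr>carrier = range (pres_class S),
      monoid.mult = (\<lambda>C D. \<Union>u\<in>C. \<Union>v\<in>D. pres_class S (u @ v)),
      one = pres_class S []\<rparr>"

definition derived_structure_monoid :: "('x \<times> 'x \<Rightarrow> 'x \<times> 'x) \<Rightarrow> 'x list set monoid" where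
  "derived_structure_monoid r = presented_monoid {([x, z], [z, sigma r z x]) | x z. True}"


section \<open>Monoids\<close>

text \<open>Also used for rings, whose records extend those of monoids.\<close>

definition mult_center :: "('a, 'm) monoid_scheme \<Rightarrow> 'a set" where
  "mult_center M = {z \<in> carrier M. \<forall>a \<in> carrier M. z \<otimes>\<^bsub>M\<^esub> a = a \<otimes>\<^bsub>M\<^esub> z}"

definition central_by_finite :: "('a, 'm) monoid_scheme \<Rightarrow> bool" where
  "central_by_finite M \<longleftrightarrow>
     (\<exists>C F. submonoid C M \<and> C \<subseteq> mult_center M \<and> finite F \<and> F \<subseteq> carrier M \<and>
        carrier M = (\<Union>f\<in>F. C #>\<^bsub>M\<^esub> f))"

definition free_abelian_monoid :: "nat \<Rightarrow> (nat \<Rightarrow>\<^sub>0 nat) monoid" where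
  "free_abelian_monoid n =
     \<lparr>carrier = {c. Poly_Mapping.keys c \<subseteq> {..<n}}, monoid.mult = (+), one = 0\<rparr>"

definition monoid_rank :: "('a, 'm) monoid_scheme \<Rightarrow> enat" where
  "monoid_rank M =
     Sup {enat n | n. \<exists>N. submonoid N M \<and> M\<lparr>carrier := N\<rparr> \<cong> free_abelian_monoid n}"


section \<open>Monoid algebras\<close>

text \<open>Elements are the finitely supported functions from the monoid to \<open>K\<close>, extended by zero to
  the whole type; multiplication is convolution.\<close>

definition monoid_algebra ::
    "('k, 'm) ring_scheme \<Rightarrow> ('a, 'n) monoid_scheme \<Rightarrow> ('a \<Rightarrow> 'k) ring" where
  "monoid_algebra K M =
     \<lparr>carrier = {f. (\<forall>a. f a \<in> carrier K) \<and> finite {a. f a \<noteq> \<zero>\<^bsub>K\<^esub>} \<and>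
                    {a. f a \<noteq> \<zero>\<^bsub>K\<^esub>} \<subseteq> carrier M},
      monoid.mult = (\<lambda>f g c. \<Oplus>\<^bsub>K\<^esub>p\<in>{(a, b). f a \<noteq> \<zero>\<^bsub>K\<^esub> \<and> g b \<noteq> \<zero>\<^bsub>K\<^esub> \<and> a \<otimes>\<^bsub>M\<^esub> b = c}.
                        f (fst p) \<otimes>\<^bsub>K\<^esub> g (snd p)),
      one = (\<lambda>a. if a = \<one>\<^bsub>M\<^esub> then \<one>\<^bsub>K\<^esub> else \<zero>\<^bsub>K\<^esub>),
      ring.zero = (\<lambda>a. \<zero>\<^bsub>K\<^esub>),
      ring.add = (\<lambda>f g a. f a \<oplus>\<^bsub>K\<^esub> g a)\<rparr>"

definition scalars :: "('k, 'm) ring_scheme \<Rightarrow> ('a, 'n) monoid_scheme \<Rightarrow> ('a \<Rightarrow> 'k) set" where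
  "scalars K M = (\<lambda>c a. if a = \<one>\<^bsub>M\<^esub> then c else \<zero>\<^bsub>K\<^esub>) ` carrier K"


section \<open>Algebras over an embedded field\<close>

text \<open>As in \<^theory>\<open>HOL-Algebra.Embedded_Algebras\<close>, an algebra is a ring \<open>R\<close> together with a subfield
  \<open>k\<close>, here intended to be central. The library locale \<^locale>\<open>subalgebra\<close> describes the
  \<open>k\<close>-subspaces of \<open>R\<close>; closure under multiplication is not part of it.\<close>

definition unital_subalgebra :: "'a set \<Rightarrow> 'a set \<Rightarrow> ('a, 'm) ring_scheme \<Rightarrow> bool" where
  "unital_subalgebra k B R \<longleftrightarrow> subring B R \<and> k \<subseteq> B"

definition affine_subalgebra :: "'a set \<Rightarrow> 'a set \<Rightarrow> ('a, 'm) ring_scheme \<Rightarrow> bool" where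
  "affine_subalgebra k B R \<longleftrightarrow>
     unital_subalgebra k B R \<and> (\<exists>S. finite S \<and> S \<subseteq> B \<and> B = generate_ring R (k \<union> S))"

definition finite_module_over :: "'a set \<Rightarrow> ('a, 'm) ring_scheme \<Rightarrow> bool" where
  "finite_module_over B R \<longleftrightarrow>
     (\<exists>G. finite G \<and> G \<subseteq> carrier R \<and>
        carrier R = {\<Oplus>\<^bsub>R\<^esub>g\<in>G. b g \<otimes>\<^bsub>R\<^esub> g | b. b \<in> G \<rightarrow> B})"

text \<open>A polynomial in the free algebra on countably many variables is given by its coefficients
  on words over \<^typ>\<open>nat\<close>.\<close>

definition pi_algebra :: "'a set \<Rightarrow> ('a, 'm) ring_scheme \<Rightarrow> bool" where
  "pi_algebra k R \<longleftrightarrow>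
     (\<exists>p :: nat list \<Rightarrow> 'a.
        (\<forall>w. p w \<in> k) \<and> finite {w. p w \<noteq> \<zero>\<^bsub>R\<^esub>} \<and> (\<exists>w. p w \<noteq> \<zero>\<^bsub>R\<^esub>) \<and>
        (\<forall>a. (\<forall>i. a i \<in> carrier R) \<longrightarrow>
           (\<Oplus>\<^bsub>R\<^esub>w\<in>{w. p w \<noteq> \<zero>\<^bsub>R\<^esub>}. p w \<otimes>\<^bsub>R\<^esub> foldr (\<otimes>\<^bsub>R\<^esub>) (map a w) \<one>\<^bsub>R\<^esub>) = \<zero>\<^bsub>R\<^esub>))"


section \<open>Noncommutative Noetherian rings and Krull dimension\<close>

text \<open>The library notions \<^locale>\<open>noetherian_ring\<close> (stated for two-sided ideals) and
  \<^locale>\<open>primeideal\<close> (which includes commutativity) do not apply to noncommutative rings.\<close>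

definition left_ideal :: "'a set \<Rightarrow> ('a, 'm) ring_scheme \<Rightarrow> bool" where
  "left_ideal I R \<longleftrightarrow> additive_subgroup I R \<and> (\<forall>x\<in>carrier R. \<forall>a\<in>I. x \<otimes>\<^bsub>R\<^esub> a \<in> I)"

definition right_ideal :: "'a set \<Rightarrow> ('a, 'm) ring_scheme \<Rightarrow> bool" where
  "right_ideal I R \<longleftrightarrow> additive_subgroup I R \<and> (\<forall>x\<in>carrier R. \<forall>a\<in>I. a \<otimes>\<^bsub>R\<^esub> x \<in> I)"

definition acc_on :: "('a set \<Rightarrow> bool) \<Rightarrow> bool" where
  "acc_on P \<longleftrightarrow>
     (\<forall>I :: nat \<Rightarrow> 'a set. (\<forall>n. P (I n)) \<and> (\<forall>n. I n \<subseteq> I (Suc n)) \<longrightarrow>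
        (\<exists>N. \<forall>n\<ge>N. I n = I N))"

definition left_right_noetherian :: "('a, 'm) ring_scheme \<Rightarrow> bool" where
  "left_right_noetherian R \<longleftrightarrow>
     ring R \<and> acc_on (\<lambda>I. left_ideal I R) \<and> acc_on (\<lambda>I. right_ideal I R)"

definition nc_prime_ideal :: "'a set \<Rightarrow> ('a, 'm) ring_scheme \<Rightarrow> bool" where
  "nc_prime_ideal P R \<longleftrightarrow>
     ideal P R \<and> P \<noteq> carrier R \<and>
     (\<forall>I J. ideal I R \<and> ideal J R \<and> I \<cdot>\<^bsub>R\<^esub> J \<subseteq> P \<longrightarrow> I \<subseteq> P \<or> J \<subseteq> P)"

definition clKdim :: "('a, 'm) ring_scheme \<Rightarrow> enat" where
  "clKdim R =
     Sup {enat n | n. \<exists>P :: nat \<Rightarrow> 'a set.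
            (\<forall>i\<le>n. nc_prime_ideal (P i) R) \<and> (\<forall>i<n. P i \<subset> P (Suc i))}"


section \<open>Gelfand--Kirillov dimension\<close>

text \<open>The subspace \<open>k + V + V\<^sup>2 + \<dots> + V\<^sup>n\<close>, as the least subspace containing all products of at
  most \<open>n\<close> elements of \<open>V\<close>.\<close>

definition growth_space :: "'a set \<Rightarrow> ('a, 'm) ring_scheme \<Rightarrow> 'a set \<Rightarrow> nat \<Rightarrow> 'a set" where
  "growth_space k R V n =
     \<Inter>{W. subalgebra k W R \<and>
          {foldr (\<otimes>\<^bsub>R\<^esub>) vs \<one>\<^bsub>R\<^esub> | vs. set vs \<subseteq> V \<and> length vs \<le> n} \<subseteq> W}"

text \<open>The values at \<open>n = 0, 1\<close>, where \<^term>\<open>ln (real n)\<close> is not positive, do not affect the limes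
  superior.\<close>

definition GKdim :: "'a set \<Rightarrow> ('a, 'm) ring_scheme \<Rightarrow> ereal" where
  "GKdim k R =
     (SUP V \<in> {V. subalgebra k V R \<and> ring.finite_dimension R k V}.
        limsup (\<lambda>n. ereal (ln (real (ring.dim R k (growth_space k R V n))) / ln (real n))))"

end

theory Submission
  imports Defs
begin

text \<open>
  Conjugating \<open>r\<close> by \<open>(x, y) \<mapsto> (x, \<lambda>\<^sub>x(y))\<close> shows that \<open>\<sigma>\<close> is a finite rack operation on \<open>X\<close>, so for
  some \<open>d\<close> every \<open>z\<^sup>d\<close> is central in \<open>A\<close>; since every word can be sorted, \<open>A\<close> is finite over
  the submonoid \<open>C\<close> generated by these powers. In \<open>C\<close> one has \<open>y\<^sup>d z\<^sup>d = y\<^sup>d \<sigma>\<^sub>y(z)\<^sup>d\<close>, so up to boundedly many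
  choices an element of \<open>C\<close> with support \<open>S\<close> is determined by one exponent for each orbit meeting \<open>S\<close>
  of the group generated by the \<open>\<sigma>\<^sub>y\<close>, \<open>y \<in> S\<close>. Conversely, the numbers of letters in these orbits are
  invariants of the words over their union. So \<open>A\<close> grows like a polynomial whose degree \<open>\<rho>\<close> is the largest
  number of such orbits, which yields the rank, the Gelfand--Kirillov dimension, and the bound
  \<open>\<rho> \<le> |X|\<close> with equality iff \<open>\<sigma>\<close> is trivial, i.e. iff \<open>r\<close> is involutive.

  For the Krull dimension, a chain of \<open>\<rho>\<close> strict inclusions is given by the kernels of the maps from \<open>K[A]\<close>
  to a polynomial ring which count letters per orbit and kill more and more orbits. In the other direction,
  whenever \<open>P \<subset> Q\<close> are primes of a ring finite over a central subring, that subring contains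
  an element of \<open>Q\<close> outside \<open>P\<close>. Such elements along a chain of length \<open>n\<close> are algebraically independent, which
  forces growth of degree at least \<open>n\<close>.

  The Noetherian property follows from Dickson's lemma applied to leading exponents of sorted words, and
  the standard identity holds because \<open>K[A]\<close> is a finite module over a central subalgebra.
\<close>

section \<open>The derived rack of a solution\<close>

text \<open>The obstacle is that \<open>A\<close> need not be cancellative. The identity replacing
  z^d by the d-th power of \<open>sigma r y z\<close> holds only in the presence of a letter y, so
  the identifications available to an element depend on its support S. A smaller support has fewer
  letters, but it may also split orbits; hence the degree is a maximum over all S and not the number
  of orbits on X. For the same reason \<open>A\<close> cannot simply be embedded into a group, and
  upper bounds are obtained by counting instead. A free abelian submonoid of rank n provides (m+1)^n
  elements, and a chain of n strict inclusions of primes provides (m+1)^n linearly independent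
  elements of K[A], all of them supported on words of length at most a fixed multiple of m. Words of
  that length represent only O((m+1)^\<rho>) elements of \<open>A\<close>, so n is at most \<rho>.
  The exponent d is a common exponent of all permutations \<open>sigma r y\<close>, which makes the
  powers z^d act trivially.\<close>

lemma ybe_lam_lam:
  assumes "ybe_solution r"
  shows "lam r x (lam r y z) = lam r (lam r x y) (lam r (rho r y x) z)"
proof -
  have "(apply12 r \<circ> apply23 r \<circ> apply12 r) (x, y, z) = (apply23 r \<circ> apply12 r \<circ> apply23 r) (x, y, z)"
    using assms by (simp add: ybe_solution_def)
  then show ?thesis
    by (simp add: apply12_def apply23_def lam_def rho_def split_beta Let_def prod_eq_iff)
qed

lemma ybe_rho_lam:
  assumes "ybe_solution r"
  shows "rho r (lam r (rho r y x) z) (lam r x y) = lam r (rho r (lam r y z) x) (rho r z y)"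
proof -
  have "(apply12 r \<circ> apply23 r \<circ> apply12 r) (x, y, z) = (apply23 r \<circ> apply12 r \<circ> apply23 r) (x, y, z)"
    using assms by (simp add: ybe_solution_def)
  then show ?thesis
    by (simp add: apply12_def apply23_def lam_def rho_def split_beta Let_def prod_eq_iff)
qed

lemma ybe_rho_rho:
  assumes "ybe_solution r"
  shows "rho r (rho r z y) (rho r (lam r y z) x) = rho r z (rho r y x)"
proof -
  have "(apply12 r \<circ> apply23 r \<circ> apply12 r) (x, y, z) = (apply23 r \<circ> apply12 r \<circ> apply23 r) (x, y, z)"
    using assms by (simp add: ybe_solution_def)
  then show ?thesis
    by (simp add: apply12_def apply23_def lam_def rho_def split_beta Let_def prod_eq_iff)
qed

text \<open>Writing the first argument as \<open>lam r x y\<close> cancels the inverse in the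
  definition of \<open>sigma\<close>. Since every \<open>lam r x\<close> is onto, all later
  computations can start from this form.\<close>

lemma sigma_lam:
  assumes "left_nondegenerate r"
  shows "sigma r (lam r x y) x = lam r (lam r x y) (rho r y x)"
  using assms by (simp add: sigma_def left_nondegenerate_def bij_def inv_f_f)

lemma lam_surjD:
  assumes "left_nondegenerate r"
  obtains y where "z = lam r x y"
  using assms unfolding left_nondegenerate_def by (meson bij_pointE)

text \<open>With w = \<open>lam r y z\<close>, the first two components of the braid equation for x,
  y, z turn one side into the other. In effect each \<open>lam r x\<close> is an automorphism of the
  operation \<open>sigma\<close>.\<close>

lemma lam_sigma:
  assumes "ybe_solution r" "left_nondegenerate r"
  shows "lam r x (sigma r w y) = sigma r (lam r x w) (lam r x y)"
proof -
  obtain z where w: "w = lam r y z" by (rule lam_surjD[OF assms(2)])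
  have "sigma r (lam r x w) (lam r x y) = lam r (lam r (lam r x y) (lam r (rho r y x) z)) (rho r (lam r (rho r y x) z) (lam r x y))"
    unfolding w ybe_lam_lam[OF assms(1), of x y z] by (rule sigma_lam[OF assms(2)])
  also have "\<dots> = lam r (lam r x w) (lam r (rho r w x) (rho r z y))"
    by (simp add: w ybe_lam_lam[OF assms(1), of x y z] ybe_rho_lam[OF assms(1)])
  also have "\<dots> = lam r x (lam r w (rho r z y))"
    by (simp add: ybe_lam_lam[OF assms(1), of x w])
  also have "lam r w (rho r z y) = sigma r w y"
    by (simp add: w sigma_lam[OF assms(2)])
  finally show ?thesis by simp
qed

text \<open>The derived solution \<open>(x, z) \<mapsto> (z, \<sigma>\<^sub>z(x))\<close> is conjugate to \<open>r\<close> under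
  \<open>(x, y) \<mapsto> (x, \<lambda>\<^sub>x(y))\<close>; the last YBE component then says that \<open>\<sigma>\<close> is self-distributive.\<close>

lemma sigma_sigma:
  assumes "ybe_solution r" "left_nondegenerate r"
  shows "sigma r (sigma r z y) (sigma r z x) = sigma r z (sigma r y x)"
proof -
  \<comment> \<open>The triple (x, y, z) is pulled back along the conjugating bijection: y =
    \<open>lam r x b\<close> and z = \<open>lam r x (lam r b c)\<close>. Each \<open>sigma\<close>
    can then be brought to the form of \<open>sigma_lam\<close>.\<close>
  obtain b where y: "y = lam r x b" by (rule lam_surjD[OF assms(2)])
  obtain c' where z: "z = lam r x c'" by (rule lam_surjD[OF assms(2)])
  obtain c where c: "c' = lam r b c" by (rule lam_surjD[OF assms(2)])
  let ?p = "rho r c' x"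
  have zy: "sigma r z y = lam r z (lam r ?p (rho r c b))"
  proof -
    have "sigma r z y = lam r x (sigma r c' b)"
      using lam_sigma[OF assms] y z by simp
    also have "\<dots> = lam r x (lam r c' (rho r c b))"
      by (simp add: c sigma_lam[OF assms(2)])
    finally show ?thesis by (simp add: z ybe_lam_lam[OF assms(1), of x c'])
  qed
  have zx: "sigma r z x = lam r z ?p" by (simp add: z sigma_lam[OF assms(2)])
  have "sigma r (sigma r z y) (sigma r z x) = lam r z (sigma r (lam r ?p (rho r c b)) ?p)"
    by (simp add: zy zx lam_sigma[OF assms])
  also have "\<dots> = lam r z (lam r (lam r ?p (rho r c b)) (rho r (rho r c b) ?p))"
    by (simp add: sigma_lam[OF assms(2)])
  finally have L: "sigma r (sigma r z y) (sigma r z x)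
      = lam r z (lam r (lam r ?p (rho r c b)) (rho r (rho r c b) ?p))" .
  have yx: "sigma r y x = lam r y (rho r b x)" by (simp add: y sigma_lam[OF assms(2)])
  have z': "z = lam r y (lam r (rho r b x) c)"
    by (simp add: z c y ybe_lam_lam[OF assms(1), of x b])
  have "sigma r z (sigma r y x) = lam r y (sigma r (lam r (rho r b x) c) (rho r b x))"
    by (simp add: yx lam_sigma[OF assms] flip: z')
  also have "\<dots> = lam r y (lam r (lam r (rho r b x) c) (rho r c (rho r b x)))"
    by (simp add: sigma_lam[OF assms(2)])
  also have "\<dots> = lam r z (lam r (rho r (lam r (rho r b x) c) y) (rho r c (rho r b x)))"
    using ybe_lam_lam[OF assms(1), of y "lam r (rho r b x) c" "rho r c (rho r b x)"] by (simp only: flip: z')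
  also have "\<dots> = lam r z (lam r (lam r ?p (rho r c b)) (rho r (rho r c b) ?p))"
    using ybe_rho_lam[OF assms(1), of b x c] ybe_rho_rho[OF assms(1), of c b x]
    by (simp add: c y)
  finally show ?thesis using L by simp
qed

text \<open>For surjectivity, write the target y as \<open>lam r z v\<close> and choose (x, u) with
  \<open>r (x, u) = (z, v)\<close>; \<open>sigma_lam\<close> then reads
  \<open>sigma r z x = y\<close>. Finiteness gives injectivity.\<close>

lemma bij_sigma:
  fixes r :: "'x::finite \<times> 'x \<Rightarrow> 'x \<times> 'x"
  assumes "bij r" "left_nondegenerate r"
  shows "bij (sigma r z)"
proof -
  have "surj (sigma r z)"
  proof (rule surjI)
    fix y
    show "sigma r z (SOME x. sigma r z x = y) = y"
    proof (rule someI_ex)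
      obtain v where v: "y = lam r z v" by (rule lam_surjD[OF assms(2)])
      obtain x u where xu: "r (x, u) = (z, v)"
        using assms(1) by (metis bij_pointE surj_pair)
      then have "lam r x u = z" "rho r u x = v"
        by (simp_all add: lam_def rho_def)
      then show "\<exists>x. sigma r z x = y"
        using sigma_lam[OF assms(2), of x u] v by auto
    qed
  qed
  then show ?thesis by (simp add: finite_UNIV_surj_inj bij_def)
qed

text \<open>By \<open>sigma_lam\<close>, triviality of \<open>sigma\<close> says that the first
  component of \<open>r (r (x, y))\<close> is x. The second component is then forced, because
  \<open>lam r x\<close> is injective.\<close>

lemma involutive_iff_sigma:
  assumes "left_nondegenerate r"
  shows "involutive r \<longleftrightarrow> (\<forall>z x. sigma r z x = x)"
proof
  assume *: "involutive r"
  show "\<forall>z x. sigma r z x = x"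
  proof (intro allI)
    fix z x
    obtain y where y: "z = lam r x y" by (rule lam_surjD[OF assms])
    have "r (r (x, y)) = (x, y)" using * by (metis comp_apply id_apply involutive_def)
    moreover have "r (x, y) = (z, rho r y x)" by (simp add: y lam_def rho_def)
    ultimately have "lam r z (rho r y x) = x" by (simp add: lam_def)
    then show "sigma r z x = x" using y sigma_lam[OF assms] by simp
  qed
next
  assume *: "\<forall>z x. sigma r z x = x"
  have "r (r (x, y)) = (x, y)" for x y
  proof -
    define u v where "u = lam r x y" and "v = rho r y x"
    have r1: "r (x, y) = (u, v)" by (simp add: u_def v_def lam_def rho_def)
    have x: "lam r u v = x"
      using * sigma_lam[OF assms, of x y] by (simp add: u_def v_def)
    have "lam r x (rho r v u) = u"
      using * sigma_lam[OF assms, of u v] by (simp add: x)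
    then have "rho r v u = y"
      using assms by (metis bij_def injD left_nondegenerate_def u_def)
    moreover have "r (u, v) = (lam r u v, rho r v u)" by (simp add: lam_def rho_def)
    ultimately show ?thesis using x r1 by simp
  qed
  then show "involutive r" by (auto simp: involutive_def)
qed

section \<open>Words in a finite rack\<close>

lemma pres_cong_context:
  "pres_cong S u v \<Longrightarrow> pres_cong S (p @ u @ q) (p @ v @ q)"
proof (induction rule: pres_cong.induct)
  case (rel u v p' q')
  then show ?case using pres_cong.rel[OF rel, of "p @ p'" "q' @ q"] by simp
qed (auto intro: pres_cong.intros)

lemma pres_cong_append:
  assumes "pres_cong S u u'" "pres_cong S v v'"
  shows "pres_cong S (u @ v) (u' @ v')"
  using pres_cong_context[OF assms(1), of "[]" v] pres_cong_context[OF assms(2), of u' "[]"]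
  by (auto intro: pres_cong.trans)

lemma pres_class_eq_iff: "pres_class S u = pres_class S v \<longleftrightarrow> pres_cong S u v"
  unfolding pres_class_def by (auto intro: pres_cong.intros)

lemma presented_monoid_mult:
  "pres_class S u \<otimes>\<^bsub>presented_monoid S\<^esub> pres_class S v = pres_class S (u @ v)"
proof -
  have "pres_class S (u' @ v') = pres_class S (u @ v)"
    if "u' \<in> pres_class S u" "v' \<in> pres_class S v" for u' v'
    using that pres_cong_append[of S u u' v v']
    by (simp add: pres_class_eq_iff) (simp add: pres_class_def pres_cong.sym)
  then have "(\<Union>u'\<in>pres_class S u. \<Union>v'\<in>pres_class S v. pres_class S (u' @ v')) =
      (\<Union>u'\<in>pres_class S u. \<Union>v'\<in>pres_class S v. pres_class S (u @ v))"
    by (auto intro!: SUP_cong)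
  moreover have "pres_class S u \<noteq> {}" "pres_class S v \<noteq> {}"
    using pres_cong.refl[of S] by (auto simp: pres_class_def)
  ultimately show ?thesis by (simp add: presented_monoid_def)
qed

lemma presented_monoid_carrier: "carrier (presented_monoid S) = range (pres_class S)"
  by (simp add: presented_monoid_def)

lemma presented_monoid_one: "\<one>\<^bsub>presented_monoid S\<^esub> = pres_class S []"
  by (simp add: presented_monoid_def)

lemma monoid_presented_monoid: "monoid (presented_monoid S)"
  by (rule monoidI)
     (auto simp: presented_monoid_carrier presented_monoid_one presented_monoid_mult)

lemma funpow_id_of_bij:
  fixes f :: "'a::finite \<Rightarrow> 'a"
  assumes "bij f"
  shows "\<exists>n>0. f ^^ n = id"
proof -
  have "\<not> inj (\<lambda>n. f ^^ n)"
    using finite[of "range (\<lambda>n. f ^^ n)"] finite_imageD infinite_UNIV_nat by blast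
  then obtain i j where ij: "i < j" "f ^^ i = f ^^ j"
    by (metis injI linorder_neqE_nat)
  have "f ^^ (j - i) = id"
  proof
    fix x
    have "(f ^^ i) ((f ^^ (j - i)) x) = (f ^^ i) x"
    proof -
      have "(f ^^ i) ((f ^^ (j - i)) x) = (f ^^ (i + (j - i))) x" by (simp only: funpow_add comp_apply)
      also have "\<dots> = (f ^^ i) x" using ij by simp
      finally show ?thesis .
    qed
    then show "(f ^^ (j - i)) x = id x"
      using inj_fn[OF bij_is_inj[OF assms], of i] by (simp add: injD)
  qed
  with ij show ?thesis by (intro exI[of _ "j - i"]) simp
qed

text \<open>In the notation x^z for \<open>s z x\<close>, the second law is that of conjugation,
  (x^y)^z = (x^z)^(y^z). The word monoid is studied from these two laws alone.\<close>

locale finite_rack =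
  fixes s :: "'x::finite \<Rightarrow> 'x \<Rightarrow> 'x"
  assumes bij: "bij (s z)"
    and self_dist: "s (s z y) (s z x) = s z (s y x)"
begin

definition rels where "rels = {([x, z], [z, s z x]) | x z. True}"

abbreviation eqv (infix "\<leftrightarrow>" 50) where "u \<leftrightarrow> v \<equiv> pres_cong rels u v"

definition expo :: nat where "expo = (SOME d. d > 0 \<and> (\<forall>z. s z ^^ d = id))"

lemma expo: "expo > 0" "s z ^^ expo = id"
proof -
  obtain n where n: "n z > 0" "s z ^^ n z = id" for z
    using funpow_id_of_bij[OF bij] by metis
  have "s z ^^ (\<Prod>z\<in>UNIV. n z) = id" for z
  proof -
    have "(\<Prod>z\<in>UNIV. n z) = n z * (\<Prod>z\<in>UNIV - {z}. n z)" by (simp add: prod.remove)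
    then have "s z ^^ (\<Prod>z\<in>UNIV. n z) = (s z ^^ n z) ^^ (\<Prod>z\<in>UNIV - {z}. n z)"
      by (simp only: funpow_mult)
    also have "\<dots> = id" by (simp add: n(2) id_funpow)
    finally show ?thesis .
  qed
  moreover have "(\<Prod>z\<in>UNIV. n z) > 0" using n(1) by (simp add: prod_pos)
  ultimately have "\<exists>d. d > 0 \<and> (\<forall>z. s z ^^ d = id)" by blast
  from someI_ex[OF this] show "expo > 0" "s z ^^ expo = id" by (auto simp: expo_def)
qed

lemmas eqv_refl = pres_cong.refl[of rels]
  and eqv_sym = pres_cong.sym[of rels]
  and eqv_trans [trans] = pres_cong.trans[of rels]
  and eqv_append = pres_cong_append[of rels]

lemma eqv_swap: "[x, z] \<leftrightarrow> [z, s z x]"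
  using pres_cong.rel[of "[x, z]" "[z, s z x]" rels "[]" "[]"] by (auto simp: rels_def)

lemma eqv_move: "w @ [z] \<leftrightarrow> [z] @ map (s z) w"
proof (induction w)
  case (Cons x w)
  have "[x] @ w @ [z] \<leftrightarrow> [x] @ [z] @ map (s z) w" by (rule eqv_append[OF eqv_refl Cons.IH])
  also have "\<dots> \<leftrightarrow> [z, s z x] @ map (s z) w"
    using eqv_append[OF eqv_swap eqv_refl] by simp
  finally show ?case by simp
qed (simp add: eqv_refl)

lemma eqv_move_power: "w @ replicate k z \<leftrightarrow> replicate k z @ map (s z ^^ k) w"
proof (induction k arbitrary: w)
  case (Suc k)
  have "(w @ [z]) @ replicate k z \<leftrightarrow> ([z] @ map (s z) w) @ replicate k z"
    by (rule eqv_append[OF eqv_move eqv_refl])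
  also have "\<dots> = [z] @ (map (s z) w @ replicate k z)" by simp
  also have "\<dots> \<leftrightarrow> [z] @ (replicate k z @ map (s z ^^ k) (map (s z) w))"
    by (rule eqv_append[OF eqv_refl Suc])
  finally show ?case by (simp add: funpow_Suc_right comp_def del: funpow.simps)
qed (simp add: eqv_refl)

text \<open>The word of a product of central powers. A list stands for a multiset here: the order
  matters only up to congruence, by \<open>eqv_central_word_mset\<close>.\<close>

definition central_word :: "'x list \<Rightarrow> 'x list" where "central_word ms = concat (map (replicate expo) ms)"

lemma central_word_simps [simp]: "central_word [] = []" "central_word (z # ms) = replicate expo z @ central_word ms"
  "central_word (ms @ ms') = central_word ms @ central_word ms'"
  by (simp_all add: central_word_def)

lemma length_central_word [simp]: "length (central_word ms) = expo * length ms"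
  by (induction ms) (simp_all)

lemma set_central_word [simp]: "set (central_word ms) = set ms"
  using expo(1) by (induction ms) auto

lemma eqv_central1: "w @ replicate expo z \<leftrightarrow> replicate expo z @ w"
  using eqv_move_power[of w expo z] by (simp add: expo(2))

lemma eqv_central: "w @ central_word ms \<leftrightarrow> central_word ms @ w"
proof (induction ms arbitrary: w)
  case (Cons z ms)
  have "(w @ replicate expo z) @ central_word ms \<leftrightarrow> (replicate expo z @ w) @ central_word ms"
    by (rule eqv_append[OF eqv_central1 eqv_refl])
  also have "\<dots> = replicate expo z @ (w @ central_word ms)" by simp
  also have "\<dots> \<leftrightarrow> replicate expo z @ (central_word ms @ w)"
    by (rule eqv_append[OF eqv_refl Cons])
  finally show ?case by simp
qed (simp add: eqv_refl)

lemma eqv_central_word_mset: "mset ms = mset ms' \<Longrightarrow> central_word ms \<leftrightarrow> central_word ms'"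
proof (induction ms arbitrary: ms')
  case (Cons z ms)
  then have "z \<in> set ms'" by (metis list.set_intros(1) mset_eq_setD)
  then obtain p q where ms': "ms' = p @ z # q" by (meson split_list)
  then have "mset ms = mset (p @ q)" using Cons.prems by simp
  then have "central_word [z] @ central_word ms \<leftrightarrow> central_word [z] @ central_word (p @ q)" by (intro eqv_append eqv_refl Cons.IH)
  also have "\<dots> = (central_word [z] @ central_word p) @ central_word q" by simp
  also have "\<dots> \<leftrightarrow> (central_word p @ central_word [z]) @ central_word q" by (intro eqv_append eqv_refl eqv_central)
  finally show ?case by (simp add: ms')
qed (simp add: eqv_refl)

text \<open>Moving y to the front of z^expo in two ways gives both sides: the power is central and
  passes unchanged, while letter by letter each z becomes \<open>s y z\<close>.\<close>

lemma eqv_conj1: "[y] @ replicate expo z \<leftrightarrow> [y] @ replicate expo (s y z)"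
proof -
  have "replicate expo z @ [y] \<leftrightarrow> [y] @ replicate expo (s y z)"
    using eqv_move[of "replicate expo z" y] by (simp add: map_replicate_const)
  with eqv_central1[of "[y]" z] show ?thesis by (rule eqv_trans)
qed

text \<open>A single letter y is split off its block of length \<open>expo\<close> and
  \<open>eqv_conj1\<close> is applied to it. The whole block would act as the identity, so the other
  \<open>expo - 1\<close> letters are kept aside.\<close>

lemma eqv_conj: "y \<in> set ms \<Longrightarrow> central_word (z # ms) \<leftrightarrow> central_word (s y z # ms)"
proof -
  assume "y \<in> set ms"
  then obtain p q where ms: "ms = p @ y # q" by (meson split_list)
  obtain k where k: "expo = Suc k" using expo(1) by (cases expo) auto
  have y: "replicate expo y = replicate k y @ [y]" by (simp add: k replicate_append_same)
  have move: "central_word (z # ms) \<leftrightarrow> replicate k y @ ([y] @ replicate expo z) @ central_word (p @ q)" for z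
  proof -
    have "central_word (z # ms) \<leftrightarrow> central_word (y # z # p @ q)" by (rule eqv_central_word_mset) (simp add: ms)
    then show ?thesis by (simp add: y)
  qed
  have "central_word (z # ms) \<leftrightarrow> replicate k y @ ([y] @ replicate expo z) @ central_word (p @ q)" by (rule move)
  also have "\<dots> \<leftrightarrow> replicate k y @ ([y] @ replicate expo (s y z)) @ central_word (p @ q)"
    by (intro eqv_append eqv_refl eqv_conj1)
  also have "\<dots> \<leftrightarrow> central_word (s y z # ms)" by (rule eqv_sym[OF move])
  finally show ?thesis .
qed

definition orb :: "'x set \<Rightarrow> ('x \<times> 'x) set" where "orb S = {(z, s y z) | y z. y \<in> S}\<^sup>*"

lemma orb_step: "y \<in> S \<Longrightarrow> (z, s y z) \<in> orb S"
  unfolding orb_def by (rule r_into_rtrancl) blast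

lemma orb_refl [simp]: "(z, z) \<in> orb S" by (simp add: orb_def)

lemma orb_trans: "(x, y) \<in> orb S \<Longrightarrow> (y, z) \<in> orb S \<Longrightarrow> (x, z) \<in> orb S"
  unfolding orb_def by (rule rtrancl_trans)

text \<open>The inverse of \<open>s t\<close> is its power with exponent \<open>expo - 1\<close>, so
  a forward step is undone by further forward steps. Hence \<open>orb S\<close>, generated by
  forward steps only, is the orbit relation of the group generated by the \<open>s y\<close> with y
  in S.\<close>

lemma orb_sym: "(x, y) \<in> orb S \<Longrightarrow> (y, x) \<in> orb S"
  unfolding orb_def
proof (induction rule: rtrancl_induct)
  case (step y z)
  then obtain t where t: "t \<in> S" "z = s t y" by blast
  have "(z, (s t ^^ k) z) \<in> orb S" for k
    by (induction k) (use t in \<open>auto intro: orb_trans[OF _ orb_step]\<close>)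
  moreover have "(s t ^^ (expo - 1)) z = y"
  proof -
    have "(s t ^^ (expo - 1)) (s t y) = (s t ^^ (Suc (expo - 1))) y" by (simp add: funpow_swap1)
    also have "Suc (expo - 1) = expo" using expo(1) by simp
    finally show ?thesis by (simp add: t expo(2))
  qed
  ultimately have "(z, y) \<in> orb S" by metis
  then show ?case using step.IH by (auto simp: orb_def)
qed simp

text \<open>By self-distributivity, \<open>s (s t y)\<close> is the conjugate of \<open>s y\<close>
  by \<open>s t\<close>. So enlarging S by all letters in its orbits creates no new
  identifications.\<close>

lemma orb_in_orb: "y \<in> orb S `` S \<Longrightarrow> (z, s y z) \<in> orb S"
proof -
  assume "y \<in> orb S `` S"
  then obtain t where "t \<in> S" "(t, y) \<in> {(z, s y z) | y z. y \<in> S}\<^sup>*" by (auto simp: orb_def)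
  from this(2,1) show ?thesis
  proof (induction arbitrary: z rule: rtrancl_induct)
    case base
    then show ?case by (rule orb_step)
  next
    case (step y y')
    then obtain t where t: "t \<in> S" "y' = s t y" by blast
    obtain z' where z': "z = s t z'" using bij[of t] by (metis bij_pointE)
    have "(z, z') \<in> orb S" unfolding z' by (rule orb_sym[OF orb_step[OF t(1)]])
    moreover have "(z', s y z') \<in> orb S" by (rule step.IH) fact
    moreover have "(s y z', s t (s y z')) \<in> orb S" by (rule orb_step[OF t(1)])
    ultimately have "(z, s t (s y z')) \<in> orb S" by (blast intro: orb_trans)
    then show ?case by (simp add: t z' self_dist)
  qed
qed

lemma eqv_orb: "(z, z') \<in> orb (set ms) \<Longrightarrow> central_word (z # ms) \<leftrightarrow> central_word (z' # ms)"
  unfolding orb_def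
proof (induction rule: rtrancl_induct)
  case (step y z)
  then show ?case using eqv_conj eqv_trans by blast
qed (simp add: eqv_refl)

end

section \<open>Normal forms and growth of the rack monoid\<close>

lemma count_concat_replicate:
  "count (mset (concat (map (\<lambda>i. replicate (c i) i) [0..<n]))) j = (if j < n then c j else 0)"
  by (induction n) auto

lemma sorted_concat_replicate: "sorted (concat (map (\<lambda>i. replicate (c i) i) [0..<n]))"
  by (induction n) (auto simp: sorted_append)

lemma count_mset_card: "count (mset xs) y = card {k. k < length xs \<and> xs ! k = y}"
  unfolding count_mset count_list_eq_length_filter length_filter_conv_card by (rule arg_cong[where f = card]) auto

context finite_rack
begin

definition letter :: "nat \<Rightarrow> 'x" where "letter = (SOME e. bij_betw e {0..<card (UNIV :: 'x set)} UNIV)"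

lemma bij_letter: "bij_betw letter {..<card (UNIV :: 'x set)} UNIV"
  unfolding letter_def using someI_ex[OF ex_bij_betw_nat_finite[OF finite, of UNIV]]
  by (simp add: atLeast0LessThan)

lemma letter_cases: obtains i where "i < card (UNIV :: 'x set)" "x = letter i"
  using bij_letter by (metis UNIV_I bij_betw_def imageE lessThan_iff)

lemma letter_eq_iff: "i < card (UNIV :: 'x set) \<Longrightarrow> j < card (UNIV :: 'x set) \<Longrightarrow> letter i = letter j \<longleftrightarrow> i = j"
  using bij_letter by (metis bij_betw_def inj_onD lessThan_iff)

text \<open>An exponent vector is a function on \<open>nat\<close> of which only the values below
  \<open>card UNIV\<close> are read, along the enumeration \<open>letter\<close>. Every element has
  such a word, but different vectors may name the same element.\<close>

definition sorted_word :: "(nat \<Rightarrow> nat) \<Rightarrow> 'x list" where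
  "sorted_word f = concat (map (\<lambda>i. replicate (f i) (letter i)) [0..<card (UNIV :: 'x set)])"

lemma sorted_word_eq: "sorted_word f = map letter (concat (map (\<lambda>i. replicate (f i) i) [0..<card (UNIV :: 'x set)]))"
  by (simp add: sorted_word_def map_concat comp_def)

lemma count_sorted_word: "count (mset (sorted_word f)) (letter i) = f i" if "i < card (UNIV :: 'x set)"
proof -
  let ?ks = "concat (map (\<lambda>i. replicate (f i) i) [0..<card (UNIV :: 'x set)])"
  have "count (mset (sorted_word f)) (letter i) = card {k. k < length ?ks \<and> letter (?ks ! k) = letter i}"
    unfolding sorted_word_eq count_mset_card by (simp cong: conj_cong)
  also have "{k. k < length ?ks \<and> letter (?ks ! k) = letter i} = {k. k < length ?ks \<and> ?ks ! k = i}"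
  proof -
    have "?ks ! k < card (UNIV :: 'x set)" if "k < length ?ks" for k
      using nth_mem[OF that] by auto
    then show ?thesis using letter_eq_iff[OF _ that] by blast
  qed
  also have "card \<dots> = count (mset ?ks) i"
    by (simp only: count_mset_card)
  also have "\<dots> = f i" using that by (simp only: count_concat_replicate if_True)
  finally show ?thesis .
qed

lemma mset_sorted_word_eqI: "(\<And>i. i < card (UNIV :: 'x set) \<Longrightarrow> f i = count M (letter i)) \<Longrightarrow> mset (sorted_word f) = M"
proof (rule multiset_eqI)
  fix x assume *: "\<And>i. i < card (UNIV :: 'x set) \<Longrightarrow> f i = count M (letter i)"
  obtain i where "i < card (UNIV :: 'x set)" "x = letter i" by (rule letter_cases)
  with * show "count (mset (sorted_word f)) x = count M x" by (simp add: count_sorted_word)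
qed

definition letter_index :: "'x \<Rightarrow> nat" where "letter_index = the_inv_into {..<card (UNIV :: 'x set)} letter"

lemma letter_letter_index [simp]: "letter (letter_index x) = x"
  unfolding letter_index_def using bij_letter by (simp add: bij_betw_def f_the_inv_into_f)

lemma letter_index_letter: "i < card (UNIV :: 'x set) \<Longrightarrow> letter_index (letter i) = i"
  unfolding letter_index_def using bij_letter by (simp add: bij_betw_def the_inv_into_f_f)

text \<open>Rewriting an adjacent inversion x z to z, \<open>s z x\<close> puts a smaller letter
  first. The letter \<open>s z x\<close> is uncontrolled, but the lexicographic order on words of
  equal length still decreases, and it is well-founded.\<close>

lemma eqv_sorted: "\<exists>w'. sorted (map letter_index w') \<and> length w' = length w \<and> w \<leftrightarrow> w'"
proof (induction w rule: wf_induct_rule[OF wf_inv_image[OF wf_lex[OF wf_less_than], of "map letter_index"]])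
  case (1 w)
  show ?case
  proof (cases "sorted (map letter_index w)")
    case True
    then show ?thesis using eqv_refl by blast
  next
    case False
    then obtain i where i: "Suc i < length w" "letter_index (w ! Suc i) < letter_index (w ! i)"
      by (auto simp: sorted_iff_nth_Suc)
    define x z p q where "x = w ! i" and "z = w ! Suc i" and "p = take i w" and "q = drop (Suc (Suc i)) w"
    have w: "w = p @ [x, z] @ q"
      using i by (simp add: x_def z_def p_def q_def Cons_nth_drop_Suc)
    let ?w' = "p @ [z, s z x] @ q"
    have "(?w', w) \<in> inv_image (lex less_than) (map letter_index)"
      using i(2) by (subst w) (auto simp: x_def z_def intro!: lex_append_leftI)
    from 1[OF this] obtain w' where "sorted (map letter_index w')" "length w' = length ?w'" "?w' \<leftrightarrow> w'"
      by blast
    moreover have "w \<leftrightarrow> ?w'" unfolding w by (intro eqv_append eqv_refl eqv_swap)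
    ultimately show ?thesis by (auto simp: w intro!: exI[of _ w'] intro: eqv_trans)
  qed
qed

lemma eqv_sorted_word: "\<exists>f. length (sorted_word f) = length w \<and> w \<leftrightarrow> sorted_word f"
proof -
  obtain w' where w': "sorted (map letter_index w')" "length w' = length w" "w \<leftrightarrow> w'"
    using eqv_sorted by blast
  define f where "f i = count (mset w') (letter i)" for i
  have mset: "mset (sorted_word f) = mset w'" by (rule mset_sorted_word_eqI) (simp add: f_def)
  have "map letter_index (sorted_word f) = concat (map (\<lambda>i. replicate (f i) i) [0..<card (UNIV :: 'x set)])"
    unfolding sorted_word_eq map_map by (rule map_idI) (auto simp: letter_index_letter)
  then have "sorted (map letter_index (sorted_word f))" using sorted_concat_replicate by simp
  then have "map letter_index (sorted_word f) = map letter_index w'"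
    using w'(1) mset by (metis mset_map properties_for_sort sorted_sort_id)
  then have "sorted_word f = w'"
    by (rule map_injective) (metis letter_letter_index injI)
  with w' show ?thesis by auto
qed

lemma central_word_replicate: "central_word (replicate k x) = replicate (expo * k) x"
  by (induction k) (simp_all add: replicate_add)

text \<open>Central blocks commute with everything, so each can be merged with the letters of its
  own kind. This gives both the quotient-remainder step in \<open>eqv_decomp\<close> and the
  exponent shift of the Noetherian argument.\<close>

lemma eqv_sorted_word_add: "central_word (sorted_word q) @ sorted_word f \<leftrightarrow> sorted_word (\<lambda>i. f i + expo * q i)"
proof -
  have "central_word (concat (map (\<lambda>i. replicate (q i) (letter i)) js)) @ concat (map (\<lambda>i. replicate (f i) (letter i)) js)
    \<leftrightarrow> concat (map (\<lambda>i. replicate (f i + expo * q i) (letter i)) js)" for js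
  proof (induction js)
    case (Cons j js)
    let ?C = "\<lambda>f. concat (map (\<lambda>i. replicate (f i) (letter i)) js)"
    let ?j = "replicate (f j) (letter j)"
    have "central_word (replicate (q j) (letter j)) @ (central_word (?C q) @ ?j) @ ?C f
      \<leftrightarrow> central_word (replicate (q j) (letter j)) @ (?j @ central_word (?C q)) @ ?C f"
      by (intro eqv_append eqv_refl eqv_sym[OF eqv_central])
    also have "\<dots> = replicate (f j + expo * q j) (letter j) @ (central_word (?C q) @ ?C f)"
      by (simp add: central_word_replicate add.commute[of "f j"] flip: replicate_add append_assoc)
    also have "\<dots> \<leftrightarrow> replicate (f j + expo * q j) (letter j) @ ?C (\<lambda>i. f i + expo * q i)"
      by (rule eqv_append[OF eqv_refl Cons])
    finally show ?case by simp
  qed (simp add: eqv_refl)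
  then show ?thesis by (simp only: sorted_word_def)
qed

lemma sorted_word_cong: "(\<And>i. i < card (UNIV :: 'x set) \<Longrightarrow> f i = g i) \<Longrightarrow> sorted_word f = sorted_word g"
  unfolding sorted_word_def by (intro arg_cong[where f = concat] map_cong) auto

text \<open>Divide every exponent of a sorted word by \<open>expo\<close>: the quotients form the
  central factor, the remainders the sorted word. The length equation keeps the number of central
  factors bounded by the length of w.\<close>

lemma eqv_decomp:
  "\<exists>ms t. w \<leftrightarrow> central_word ms @ sorted_word t \<and> (\<forall>i. t i < expo) \<and> length w = expo * length ms + length (sorted_word t)"
proof -
  obtain f where f: "length (sorted_word f) = length w" "w \<leftrightarrow> sorted_word f" using eqv_sorted_word by blast
  have "central_word (sorted_word (\<lambda>i. f i div expo)) @ sorted_word (\<lambda>i. f i mod expo) \<leftrightarrow> sorted_word f"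
    using eqv_sorted_word_add[of "\<lambda>i. f i div expo" "\<lambda>i. f i mod expo"] by simp
  moreover have "length (sorted_word f) = expo * length (sorted_word (\<lambda>i. f i div expo)) + length (sorted_word (\<lambda>i. f i mod expo))"
    by (simp add: sorted_word_def length_concat comp_def flip: sum_list_const_mult sum_list_addf)
  ultimately show ?thesis
    using f expo(1) by (intro exI[of _ "sorted_word (\<lambda>i. f i div expo)"] exI[of _ "\<lambda>i. f i mod expo"])
      (auto intro: eqv_trans eqv_sym)
qed

section \<open>Orbits, representatives and the upper growth bound\<close>

definition orbits :: "'x set \<Rightarrow> 'x set set" where "orbits S = (\<lambda>x. orb S `` {x}) ` S"

text \<open>The maximum runs over all supports S: a smaller S has fewer letters but also fewer maps
  \<open>s y\<close> to merge them. In \<open>orbits S\<close> an orbit counts as soon as it meets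
  S, and it may contain letters outside S.\<close>

definition rk :: nat where "rk = Max (range (\<lambda>S. card (orbits S)))"

lemma card_orbits_le_rk: "card (orbits S) \<le> rk"
  unfolding rk_def by (rule Max_ge) auto

lemma rk_witness: obtains S where "card (orbits S) = rk"
proof -
  have "rk \<in> range (\<lambda>S. card (orbits S))" unfolding rk_def by (rule Max_in) auto
  then show ?thesis using that by auto
qed

definition rep :: "'x set \<Rightarrow> 'x \<Rightarrow> 'x" where "rep S x = (SOME y. y \<in> S \<inter> orb S `` {x})"

lemma rep: "x \<in> S \<Longrightarrow> rep S x \<in> S \<and> (x, rep S x) \<in> orb S"
  using someI[of "\<lambda>y. y \<in> S \<inter> orb S `` {x}" x] by (auto simp: rep_def)

lemma card_rep_le: "card (rep S ` S) \<le> rk"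
proof -
  \<comment> \<open>\<open>rep S x\<close> is chosen from the set of elements of S in the orbit of
    x, so it depends on that orbit alone.\<close>
  have "rep S ` S = (\<lambda>C. SOME y. y \<in> S \<inter> C) ` orbits S"
    by (simp add: rep_def[abs_def] orbits_def image_image)
  then have "card (rep S ` S) \<le> card (orbits S)"
    by (simp add: card_image_le)
  with card_orbits_le_rk show ?thesis using le_trans by blast
qed

text \<open>The tail bs contains every letter of S, so the letters to the right of the one being
  replaced always form exactly the set S, and \<open>eqv_orb\<close> applies.\<close>

lemma eqv_rep:
  assumes "set bs = S" "set ts \<subseteq> S"
  shows "central_word (ts @ bs) \<leftrightarrow> central_word (map (rep S) ts @ bs)"
  using assms(2)
proof (induction ts)
  case (Cons z ts)
  have "set (ts @ bs) = S" using assms(1) Cons.prems by auto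
  with Cons.prems have "central_word (z # ts @ bs) \<leftrightarrow> central_word (rep S z # ts @ bs)"
    by (intro eqv_orb) (use rep in auto)
  also have "\<dots> = central_word [rep S z] @ central_word (ts @ bs)" by simp
  also have "\<dots> \<leftrightarrow> central_word [rep S z] @ central_word (map (rep S) ts @ bs)"
    by (rule eqv_append[OF eqv_refl Cons.IH]) (use Cons.prems in auto)
  finally show ?case by simp
qed (simp add: eqv_refl)

definition filt :: "nat \<Rightarrow> 'x list set set" where
  "filt n = pres_class rels ` {w. length w \<le> n}"

lemma finite_filt: "finite (filt n)"
  unfolding filt_def using finite_lists_length_le[of "UNIV :: 'x set" n] by simp

text \<open>A product of central powers in which every element of \<open>S\<close> occurs can be rewritten so that,
  apart from one copy of each element of \<open>S\<close>, only orbit representatives occur.\<close>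

lemma card_filt_le: "card (filt n) \<le> 2 ^ card (UNIV :: 'x set) * expo ^ card (UNIV :: 'x set) * (n + 1) ^ rk"
proof -
  define bs :: "'x set \<Rightarrow> 'x list" where "bs S = (SOME l. set l = S \<and> distinct l)" for S
  have bs: "set (bs S) = S" "distinct (bs S)" for S
    using someI_ex[OF finite_distinct_list[OF finite, of S]] by (auto simp: bs_def)
  \<comment> \<open>Parameters of an element: the support S of its central part, the remainders t of
    the exponents modulo \<open>expo\<close>, and the multiplicities g of the orbit representatives.
    The three factors of the bound count these in turn.\<close>
  define T where "T = (SIGMA S:UNIV. ({..<card (UNIV :: 'x set)} \<rightarrow>\<^sub>E {..<expo}) \<times> (rep S ` S \<rightarrow>\<^sub>E {..n}))"
  define \<Psi> where "\<Psi> = (\<lambda>(S, t, g).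
    pres_class rels (central_word (sorted_word (\<lambda>i. if letter i \<in> rep S ` S then g (letter i) else 0) @ bs S) @ sorted_word t))"
  have finT: "finite T" unfolding T_def by (intro finite_SigmaI finite_PiE) simp_all
  have "filt n \<subseteq> \<Psi> ` T"
  proof
    fix a assume "a \<in> filt n"
    then obtain w where w: "length w \<le> n" "a = pres_class rels w" by (auto simp: filt_def)
    obtain ms t where mt: "w \<leftrightarrow> central_word ms @ sorted_word t" "\<And>i. t i < expo"
        "length w = expo * length ms + length (sorted_word t)"
      using eqv_decomp by blast
    define S where "S = set ms"
    \<comment> \<open>One copy of every letter of S is set aside as \<open>bs S\<close>; it licenses
      the replacement of the remaining letters ts by representatives.\<close>
    have "mset (bs S) = mset_set S" using bs(2)[of S] by (simp add: bs(1) flip: mset_set_set)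
    then have "mset (bs S) \<subseteq># mset ms"
      using mset_set_set_mset_msubset[of "mset ms"] by (simp add: S_def)
    then obtain ts where ts: "mset ms = mset ts + mset (bs S)"
      by (metis ex_mset subset_mset.le_iff_add union_commute)
    have setts: "set ts \<subseteq> S" using ts by (metis S_def set_mset_mset set_mset_union sup_ge1)
    have "length ts \<le> length ms" using arg_cong[OF ts, of size] by simp
    also have "\<dots> \<le> expo * length ms" using expo(1) by simp
    also have "\<dots> \<le> n" using w(1) mt(3) by simp
    finally have len: "length ts \<le> n" .
    define g where "g = restrict (\<lambda>y. count (mset (map (rep S) ts)) y) (rep S ` S)"
    have "count (mset (map (rep S) ts)) y \<le> n" for y
      by (rule order_trans[OF count_le_size]) (simp add: len)
    then have g: "g \<in> rep S ` S \<rightarrow>\<^sub>E {..n}" by (auto simp: g_def)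
    have "count (mset (map (rep S) ts)) y = 0" if "y \<notin> rep S ` S" for y
      using that setts by (subst count_eq_zero_iff) auto
    then have "mset (sorted_word (\<lambda>i. if letter i \<in> rep S ` S then g (letter i) else 0)) = mset (map (rep S) ts)"
      by (intro mset_sorted_word_eqI) (auto simp: g_def)
    then have m: "mset (map (rep S) ts @ bs S)
        = mset (sorted_word (\<lambda>i. if letter i \<in> rep S ` S then g (letter i) else 0) @ bs S)"
      by simp
    have "central_word ms \<leftrightarrow> central_word (ts @ bs S)" by (rule eqv_central_word_mset) (simp add: ts)
    also have "\<dots> \<leftrightarrow> central_word (map (rep S) ts @ bs S)" by (rule eqv_rep[OF bs(1) setts])
    also have "\<dots> \<leftrightarrow> central_word (sorted_word (\<lambda>i. if letter i \<in> rep S ` S then g (letter i) else 0) @ bs S)"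
      by (rule eqv_central_word_mset[OF m])
    finally have "central_word ms @ sorted_word t \<leftrightarrow> central_word (sorted_word (\<lambda>i. if letter i \<in> rep S ` S then g (letter i) else 0) @ bs S) @ sorted_word t"
      by (rule eqv_append[OF _ eqv_refl])
    with mt(1) have "w \<leftrightarrow> central_word (sorted_word (\<lambda>i. if letter i \<in> rep S ` S then g (letter i) else 0) @ bs S) @ sorted_word t"
      by (rule eqv_trans)
    \<comment> \<open>Extensional functions are counted, so t is cut off outside the range that
      \<open>sorted_word\<close> reads.\<close>
    also have "sorted_word t = sorted_word (restrict t {..<card (UNIV :: 'x set)})" by (rule sorted_word_cong) simp
    finally have "a = \<Psi> (S, restrict t {..<card (UNIV :: 'x set)}, g)"
      by (simp add: w(2) \<Psi>_def pres_class_eq_iff)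
    moreover have "(S, restrict t {..<card (UNIV :: 'x set)}, g) \<in> T" using g mt(2) by (auto simp: T_def)
    ultimately show "a \<in> \<Psi> ` T" by blast
  qed
  then have "card (filt n) \<le> card (\<Psi> ` T)" by (rule card_mono[OF finite_imageI[OF finT]])
  also have "\<dots> \<le> card T" by (rule card_image_le[OF finT])
  also have "card T = (\<Sum>S\<in>UNIV. card (({..<card (UNIV :: 'x set)} \<rightarrow>\<^sub>E {..<expo}) \<times> (rep S ` S \<rightarrow>\<^sub>E {..n})))"
    unfolding T_def by (rule card_SigmaI) (simp, intro ballI finite_SigmaI finite_PiE, simp_all)
  also have "\<dots> = (\<Sum>S\<in>UNIV. expo ^ card (UNIV :: 'x set) * (n + 1) ^ card (rep S ` S))"
    by (simp add: card_cartesian_product card_PiE)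
  also have "\<dots> \<le> (\<Sum>S\<in>(UNIV :: 'x set set). expo ^ card (UNIV :: 'x set) * (n + 1) ^ rk)"
    by (intro sum_mono mult_left_mono power_increasing card_rep_le) auto
  also have "\<dots> = 2 ^ card (UNIV :: 'x set) * expo ^ card (UNIV :: 'x set) * (n + 1) ^ rk"
    using card_Pow[of "UNIV :: 'x set"] by simp
  finally show ?thesis .
qed

section \<open>Invariants of words over a union of orbits\<close>

text \<open>In a relation x z = z \<open>s z x\<close> with z in Z, the letters x and
  \<open>s z x\<close> lie in one orbit, so both or none are in Z; if z is outside Z, neither side
  is a word over Z. Thus the words over a union of orbits form a face.\<close>

lemma eqv_set_subset:
  assumes "u \<leftrightarrow> v" "Z \<subseteq> orb S `` S" "orb S `` Z \<subseteq> Z"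
  shows "set u \<subseteq> Z \<longleftrightarrow> set v \<subseteq> Z"
  using assms(1)
proof (induction rule: pres_cong.induct)
  case (rel u v p q)
  then obtain x z where [simp]: "u = [x, z]" "v = [z, s z x]" by (auto simp: rels_def)
  have "x \<in> Z \<longleftrightarrow> s z x \<in> Z" if "z \<in> Z"
  proof -
    have "(x, s z x) \<in> orb S" using that assms(2) by (intro orb_in_orb) auto
    then show ?thesis using assms(3) orb_sym by blast
  qed
  then show ?case by auto
qed auto

text \<open>Each relation keeps z and moves x within its orbit, so letter counts on unions of orbits
  are unchanged. The hypothesis restricts the letters of u; \<open>eqv_set_subset\<close> carries it
  through symmetric and transitive steps.\<close>

lemma eqv_orbit_count:
  assumes "u \<leftrightarrow> v" "set u \<subseteq> orb S `` S" "orb S `` Z \<subseteq> Z"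
  shows "length (filter (\<lambda>x. x \<in> Z) u) = length (filter (\<lambda>x. x \<in> Z) v)"
  using assms(1,2)
proof (induction rule: pres_cong.induct)
  case (rel u v p q)
  then obtain x z where [simp]: "u = [x, z]" "v = [z, s z x]" by (auto simp: rels_def)
  have "z \<in> orb S `` S" using rel by simp
  then have "(x, s z x) \<in> orb S" by (rule orb_in_orb)
  then have "x \<in> Z \<longleftrightarrow> s z x \<in> Z" using assms(3) orb_sym by blast
  then show ?case by auto
next
  case (sym u v)
  moreover have "orb S `` (orb S `` S) \<subseteq> orb S `` S" using orb_trans by blast
  ultimately show ?case using eqv_set_subset[of u v "orb S `` S" S] by simp
next
  case (trans u v w)
  moreover have "orb S `` (orb S `` S) \<subseteq> orb S `` S" using orb_trans by blast
  ultimately show ?case using eqv_set_subset[of u v "orb S `` S" S] by simp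
qed auto

lemma rk_le: "rk \<le> card (UNIV :: 'x set)"
proof -
  obtain S where S: "card (orbits S) = rk" by (rule rk_witness)
  have "card (orbits S) \<le> card S" unfolding orbits_def by (rule card_image_le) simp
  also have "\<dots> \<le> card (UNIV :: 'x set)" by (rule card_mono) auto
  finally show ?thesis using S by simp
qed

text \<open>The chain \<open>card (orbits S) \<le> card S \<le> card UNIV\<close> is tight exactly
  when S is everything and every orbit is a single point, that is, when no \<open>s z\<close> moves
  a letter.\<close>

lemma rk_eq_iff: "rk = card (UNIV :: 'x set) \<longleftrightarrow> (\<forall>z x. s z x = x)"
proof
  assume *: "rk = card (UNIV :: 'x set)"
  obtain S where S: "card (orbits S) = rk" by (rule rk_witness)
  have 1: "card (orbits S) \<le> card S" unfolding orbits_def by (rule card_image_le) simp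
  have "card S \<le> card (UNIV :: 'x set)" by (rule card_mono) auto
  with 1 S * have "card S = card (UNIV :: 'x set)" by simp
  then have "S = UNIV" by (simp add: card_eq_UNIV_imp_eq_UNIV)
  with S * have "card ((\<lambda>x. orb UNIV `` {x}) ` UNIV) = card (UNIV :: 'x set)" by (simp add: orbits_def)
  then have "inj (\<lambda>x. orb UNIV `` {x})" by (simp add: eq_card_imp_inj_on)
  moreover have "orb UNIV `` {s z x} = orb UNIV `` {x}" for z x
    using orb_step[of z UNIV x] orb_trans orb_sym by blast
  ultimately show "\<forall>z x. s z x = x" by (metis injD)
next
  assume *: "\<forall>z x. s z x = x"
  have "x = y" if "(x, y) \<in> orb UNIV" for x y
    using that unfolding orb_def by (induction rule: rtrancl_induct) (use * in auto)
  then have "orb UNIV = Id" by auto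
  then have "orbits UNIV = (\<lambda>x. {x}) ` UNIV" by (simp add: orbits_def)
  then have "card (orbits UNIV) = card (UNIV :: 'x set)" by (simp add: card_image)
  with card_orbits_le_rk[of UNIV] rk_le show "rk = card (UNIV :: 'x set)" by simp
qed

end

section \<open>Monoid algebras over a field\<close>

locale monoid_alg = K: field K + M: monoid M
  for K :: "('k, 'm) ring_scheme" and M :: "('a, 'n) monoid_scheme"
begin

abbreviation R :: "('a \<Rightarrow> 'k) ring" where "R \<equiv> monoid_algebra K M"

definition supp :: "('a \<Rightarrow> 'k) \<Rightarrow> 'a set" where "supp f = {a. f a \<noteq> \<zero>\<^bsub>K\<^esub>}"

definition mon :: "'k \<Rightarrow> 'a \<Rightarrow> 'a \<Rightarrow> 'k" where "mon c a = (\<lambda>b. if b = a then c else \<zero>\<^bsub>K\<^esub>)"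

lemma carrier_iff:
  "f \<in> carrier R \<longleftrightarrow> (\<forall>a. f a \<in> carrier K) \<and> finite (supp f) \<and> supp f \<subseteq> carrier M"
  by (simp add: monoid_algebra_def supp_def)

lemma carrier_val [intro, simp]: "f \<in> carrier R \<Longrightarrow> f a \<in> carrier K"
  by (simp add: carrier_iff)

lemma add_apply: "(f \<oplus>\<^bsub>R\<^esub> g) a = f a \<oplus>\<^bsub>K\<^esub> g a" by (simp only: monoid_algebra_def ring_record_simps)

lemma zero_eq: "\<zero>\<^bsub>R\<^esub> = (\<lambda>a. \<zero>\<^bsub>K\<^esub>)" by (simp only: monoid_algebra_def ring_record_simps)

lemma one_eq: "\<one>\<^bsub>R\<^esub> = mon \<one>\<^bsub>K\<^esub> \<one>\<^bsub>M\<^esub>" by (simp only: monoid_algebra_def ring_record_simps mon_def)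

lemma supp_add: "supp (f \<oplus>\<^bsub>R\<^esub> g) \<subseteq> supp f \<union> supp g"
  by (auto simp: supp_def add_apply)

lemma supp_mon: "supp (mon c a) \<subseteq> {a}" by (auto simp: supp_def mon_def)

lemma mon_closed [intro, simp]: "c \<in> carrier K \<Longrightarrow> a \<in> carrier M \<Longrightarrow> mon c a \<in> carrier R"
  using finite_subset[OF supp_mon[of c a]] supp_mon[of c a] by (auto simp: carrier_iff mon_def)

text \<open>Any finite index rectangle containing the supports may be used in the convolution. This
  gives the sums in the distributive laws a common index set.\<close>

lemma mult_apply:
  assumes "f \<in> carrier R" "g \<in> carrier R" "finite U" "finite V" "supp f \<subseteq> U" "supp g \<subseteq> V"
  shows "(f \<otimes>\<^bsub>R\<^esub> g) c =
    (\<Oplus>\<^bsub>K\<^esub>p\<in>{p \<in> U \<times> V. fst p \<otimes>\<^bsub>M\<^esub> snd p = c}. f (fst p) \<otimes>\<^bsub>K\<^esub> g (snd p))"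
proof -
  have "(f \<otimes>\<^bsub>R\<^esub> g) c =
    (\<Oplus>\<^bsub>K\<^esub>p\<in>{(a, b). f a \<noteq> \<zero>\<^bsub>K\<^esub> \<and> g b \<noteq> \<zero>\<^bsub>K\<^esub> \<and> a \<otimes>\<^bsub>M\<^esub> b = c}. f (fst p) \<otimes>\<^bsub>K\<^esub> g (snd p))"
    by (simp only: monoid_algebra_def ring_record_simps)
  also have "\<dots> = (\<Oplus>\<^bsub>K\<^esub>p\<in>{p \<in> U \<times> V. fst p \<otimes>\<^bsub>M\<^esub> snd p = c}. f (fst p) \<otimes>\<^bsub>K\<^esub> g (snd p))"
  proof (rule K.add.finprod_mono_neutral_cong_left)
    show "finite {p \<in> U \<times> V. fst p \<otimes>\<^bsub>M\<^esub> snd p = c}" using assms(3,4) by simp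
    show "f (fst p) \<otimes>\<^bsub>K\<^esub> g (snd p) = \<zero>\<^bsub>K\<^esub>"
      if "p \<in> {p \<in> U \<times> V. fst p \<otimes>\<^bsub>M\<^esub> snd p = c} -
        {(a, b). f a \<noteq> \<zero>\<^bsub>K\<^esub> \<and> g b \<noteq> \<zero>\<^bsub>K\<^esub> \<and> a \<otimes>\<^bsub>M\<^esub> b = c}" for p
    proof -
      have "f (fst p) = \<zero>\<^bsub>K\<^esub> \<or> g (snd p) = \<zero>\<^bsub>K\<^esub>" using that by (cases p) auto
      then show ?thesis using assms(1,2) by auto
    qed
  qed (use assms in \<open>auto simp: supp_def\<close>)
  finally show ?thesis .
qed

lemma add_closed: "f \<in> carrier R \<Longrightarrow> g \<in> carrier R \<Longrightarrow> f \<oplus>\<^bsub>R\<^esub> g \<in> carrier R"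
  using supp_add[of f g] by (auto simp: carrier_iff add_apply intro: finite_subset)

lemma supp_mult:
  assumes "f \<in> carrier R" "g \<in> carrier R"
  shows "supp (f \<otimes>\<^bsub>R\<^esub> g) \<subseteq> (\<lambda>(a, b). a \<otimes>\<^bsub>M\<^esub> b) ` (supp f \<times> supp g)"
proof
  fix c assume "c \<in> supp (f \<otimes>\<^bsub>R\<^esub> g)"
  then have "(f \<otimes>\<^bsub>R\<^esub> g) c \<noteq> \<zero>\<^bsub>K\<^esub>" by (simp add: supp_def)
  then have "(\<Oplus>\<^bsub>K\<^esub>p\<in>{p \<in> supp f \<times> supp g. fst p \<otimes>\<^bsub>M\<^esub> snd p = c}. f (fst p) \<otimes>\<^bsub>K\<^esub> g (snd p)) \<noteq> \<zero>\<^bsub>K\<^esub>"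
    using assms by (subst mult_apply[symmetric]) (auto simp: carrier_iff)
  then have "{p \<in> supp f \<times> supp g. fst p \<otimes>\<^bsub>M\<^esub> snd p = c} \<noteq> {}"
    by (metis K.finsum_empty)
  then show "c \<in> (\<lambda>(a, b). a \<otimes>\<^bsub>M\<^esub> b) ` (supp f \<times> supp g)" by auto
qed

lemma mult_closed: "f \<in> carrier R \<Longrightarrow> g \<in> carrier R \<Longrightarrow> f \<otimes>\<^bsub>R\<^esub> g \<in> carrier R"
proof -
  assume *: "f \<in> carrier R" "g \<in> carrier R"
  then have "(f \<otimes>\<^bsub>R\<^esub> g) c \<in> carrier K" for c
    by (subst mult_apply[where U = "supp f" and V = "supp g"]) (auto simp: carrier_iff intro!: K.finsum_closed)
  moreover have "finite ((\<lambda>(a, b). a \<otimes>\<^bsub>M\<^esub> b) ` (supp f \<times> supp g))"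
    using * by (simp add: carrier_iff)
  moreover have "(\<lambda>(a, b). a \<otimes>\<^bsub>M\<^esub> b) ` (supp f \<times> supp g) \<subseteq> carrier M"
    using * by (auto simp: carrier_iff)
  ultimately show ?thesis
    using supp_mult[OF *] by (auto simp: carrier_iff intro: finite_subset)
qed

lemma mult_l_distr:
  assumes f: "f \<in> carrier R" "g \<in> carrier R" "h \<in> carrier R"
  shows "(f \<oplus>\<^bsub>R\<^esub> g) \<otimes>\<^bsub>R\<^esub> h = f \<otimes>\<^bsub>R\<^esub> h \<oplus>\<^bsub>R\<^esub> g \<otimes>\<^bsub>R\<^esub> h"
proof
  fix c
  let ?U = "supp f \<union> supp g" and ?V = "supp h"
  let ?S = "{p \<in> ?U \<times> ?V. fst p \<otimes>\<^bsub>M\<^esub> snd p = c}"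
  have fin: "finite ?U" "finite ?V" using f by (auto simp: carrier_iff)
  have "((f \<oplus>\<^bsub>R\<^esub> g) \<otimes>\<^bsub>R\<^esub> h) c = (\<Oplus>\<^bsub>K\<^esub>p\<in>?S. (f \<oplus>\<^bsub>R\<^esub> g) (fst p) \<otimes>\<^bsub>K\<^esub> h (snd p))"
    by (rule mult_apply) (use f fin supp_add add_closed in auto)
  also have "\<dots> = (\<Oplus>\<^bsub>K\<^esub>p\<in>?S. f (fst p) \<otimes>\<^bsub>K\<^esub> h (snd p) \<oplus>\<^bsub>K\<^esub> g (fst p) \<otimes>\<^bsub>K\<^esub> h (snd p))"
    by (rule K.finsum_cong') (use f in \<open>auto simp: add_apply K.l_distr\<close>)
  also have "\<dots> = (\<Oplus>\<^bsub>K\<^esub>p\<in>?S. f (fst p) \<otimes>\<^bsub>K\<^esub> h (snd p)) \<oplus>\<^bsub>K\<^esub> (\<Oplus>\<^bsub>K\<^esub>p\<in>?S. g (fst p) \<otimes>\<^bsub>K\<^esub> h (snd p))"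
    by (rule K.finsum_addf) (use f in auto)
  also have "(\<Oplus>\<^bsub>K\<^esub>p\<in>?S. f (fst p) \<otimes>\<^bsub>K\<^esub> h (snd p)) = (f \<otimes>\<^bsub>R\<^esub> h) c"
    by (rule mult_apply[symmetric]) (use f fin in auto)
  also have "(\<Oplus>\<^bsub>K\<^esub>p\<in>?S. g (fst p) \<otimes>\<^bsub>K\<^esub> h (snd p)) = (g \<otimes>\<^bsub>R\<^esub> h) c"
    by (rule mult_apply[symmetric]) (use f fin in auto)
  finally show "((f \<oplus>\<^bsub>R\<^esub> g) \<otimes>\<^bsub>R\<^esub> h) c = (f \<otimes>\<^bsub>R\<^esub> h \<oplus>\<^bsub>R\<^esub> g \<otimes>\<^bsub>R\<^esub> h) c"
    unfolding add_apply[of "f \<otimes>\<^bsub>R\<^esub> h"] .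
qed

lemma mult_r_distr:
  assumes f: "f \<in> carrier R" "g \<in> carrier R" "h \<in> carrier R"
  shows "h \<otimes>\<^bsub>R\<^esub> (f \<oplus>\<^bsub>R\<^esub> g) = h \<otimes>\<^bsub>R\<^esub> f \<oplus>\<^bsub>R\<^esub> h \<otimes>\<^bsub>R\<^esub> g"
proof
  fix c
  let ?U = "supp f \<union> supp g" and ?V = "supp h"
  let ?S = "{p \<in> ?V \<times> ?U. fst p \<otimes>\<^bsub>M\<^esub> snd p = c}"
  have fin: "finite ?U" "finite ?V" using f by (auto simp: carrier_iff)
  have "(h \<otimes>\<^bsub>R\<^esub> (f \<oplus>\<^bsub>R\<^esub> g)) c = (\<Oplus>\<^bsub>K\<^esub>p\<in>?S. h (fst p) \<otimes>\<^bsub>K\<^esub> (f \<oplus>\<^bsub>R\<^esub> g) (snd p))"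
    by (rule mult_apply) (use f fin supp_add add_closed in auto)
  also have "\<dots> = (\<Oplus>\<^bsub>K\<^esub>p\<in>?S. h (fst p) \<otimes>\<^bsub>K\<^esub> f (snd p) \<oplus>\<^bsub>K\<^esub> h (fst p) \<otimes>\<^bsub>K\<^esub> g (snd p))"
    by (rule K.finsum_cong') (use f in \<open>auto simp: add_apply K.r_distr\<close>)
  also have "\<dots> = (\<Oplus>\<^bsub>K\<^esub>p\<in>?S. h (fst p) \<otimes>\<^bsub>K\<^esub> f (snd p)) \<oplus>\<^bsub>K\<^esub> (\<Oplus>\<^bsub>K\<^esub>p\<in>?S. h (fst p) \<otimes>\<^bsub>K\<^esub> g (snd p))"
    by (rule K.finsum_addf) (use f in auto)
  also have "(\<Oplus>\<^bsub>K\<^esub>p\<in>?S. h (fst p) \<otimes>\<^bsub>K\<^esub> f (snd p)) = (h \<otimes>\<^bsub>R\<^esub> f) c"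
    by (rule mult_apply[symmetric]) (use f fin in auto)
  also have "(\<Oplus>\<^bsub>K\<^esub>p\<in>?S. h (fst p) \<otimes>\<^bsub>K\<^esub> g (snd p)) = (h \<otimes>\<^bsub>R\<^esub> g) c"
    by (rule mult_apply[symmetric]) (use f fin in auto)
  finally show "(h \<otimes>\<^bsub>R\<^esub> (f \<oplus>\<^bsub>R\<^esub> g)) c = (h \<otimes>\<^bsub>R\<^esub> f \<oplus>\<^bsub>R\<^esub> h \<otimes>\<^bsub>R\<^esub> g) c"
    unfolding add_apply[of "h \<otimes>\<^bsub>R\<^esub> f"] .
qed

lemma mon_mult:
  assumes "c \<in> carrier K" "d \<in> carrier K" "a \<in> carrier M" "b \<in> carrier M"
  shows "mon c a \<otimes>\<^bsub>R\<^esub> mon d b = mon (c \<otimes>\<^bsub>K\<^esub> d) (a \<otimes>\<^bsub>M\<^esub> b)"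
proof
  fix e
  have "(mon c a \<otimes>\<^bsub>R\<^esub> mon d b) e =
    (\<Oplus>\<^bsub>K\<^esub>p\<in>{p \<in> {a} \<times> {b}. fst p \<otimes>\<^bsub>M\<^esub> snd p = e}. mon c a (fst p) \<otimes>\<^bsub>K\<^esub> mon d b (snd p))"
    by (rule mult_apply) (use assms supp_mon in auto)
  also have "\<dots> = mon (c \<otimes>\<^bsub>K\<^esub> d) (a \<otimes>\<^bsub>M\<^esub> b) e"
  proof (cases "e = a \<otimes>\<^bsub>M\<^esub> b")
    case True
    then have "{p \<in> {a} \<times> {b}. fst p \<otimes>\<^bsub>M\<^esub> snd p = e} = {(a, b)}" by auto
    then show ?thesis using assms True by (simp add: mon_def)
  next
    case False
    then have "{p \<in> {a} \<times> {b}. fst p \<otimes>\<^bsub>M\<^esub> snd p = e} = {}" by auto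
    then show ?thesis using False by (simp only: K.finsum_empty) (simp add: mon_def)
  qed
  finally show "(mon c a \<otimes>\<^bsub>R\<^esub> mon d b) e = mon (c \<otimes>\<^bsub>K\<^esub> d) (a \<otimes>\<^bsub>M\<^esub> b) e" .
qed

lemma mon_zero: "mon \<zero>\<^bsub>K\<^esub> a = \<zero>\<^bsub>R\<^esub>" by (auto simp: mon_def zero_eq)

lemma zero_closed: "\<zero>\<^bsub>R\<^esub> \<in> carrier R" by (simp add: carrier_iff zero_eq supp_def)

lemma restrict_supp:
  assumes "f \<in> carrier R"
  shows "(\<lambda>a. if a \<in> T then f a else \<zero>\<^bsub>K\<^esub>) \<in> carrier R"
  using assms by (auto simp: carrier_iff supp_def elim!: rev_finite_subset)

lemma split_mon:
  assumes "f \<in> carrier R"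
  shows "f = mon (f a) a \<oplus>\<^bsub>R\<^esub> (\<lambda>b. if b \<in> - {a} then f b else \<zero>\<^bsub>K\<^esub>)"
  using assms by (auto simp: add_apply mon_def)

text \<open>The monomial case retains that a lies in the support of f, so that the induction also
  proves facts about elements with restricted support.\<close>

lemma monoid_algebra_induct [consumes 1, case_names zero mon add]:
  assumes "f \<in> carrier R" and "P \<zero>\<^bsub>R\<^esub>"
    and "\<And>c a. c \<in> carrier K \<Longrightarrow> a \<in> supp f \<Longrightarrow> a \<in> carrier M \<Longrightarrow> P (mon c a)"
    and "\<And>f g. f \<in> carrier R \<Longrightarrow> g \<in> carrier R \<Longrightarrow> P f \<Longrightarrow> P g \<Longrightarrow> P (f \<oplus>\<^bsub>R\<^esub> g)"
  shows "P f"
proof -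
  have "P g" if "finite F" "F \<subseteq> supp f" "g \<in> carrier R" "supp g \<subseteq> F" for F g
    using that
  proof (induction F arbitrary: g rule: finite_induct)
    case empty
    then have "g = \<zero>\<^bsub>R\<^esub>" by (auto simp: supp_def zero_eq)
    with assms(2) show ?case by simp
  next
    case (insert a F)
    let ?g = "\<lambda>b. if b \<in> - {a} then g b else \<zero>\<^bsub>K\<^esub>"
    have g': "?g \<in> carrier R" by (rule restrict_supp) fact
    moreover have "supp ?g \<subseteq> F" using insert.prems by (auto simp: supp_def)
    ultimately have "P ?g" using insert by auto
    moreover have a: "a \<in> carrier M" "a \<in> supp f" using insert.prems assms(1) by (auto simp: carrier_iff)
    ultimately have "P (mon (g a) a \<oplus>\<^bsub>R\<^esub> ?g)"
      using insert.prems g' by (intro assms(4) assms(3) mon_closed) auto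
    then show ?case using split_mon[of g a] insert.prems by simp
  qed
  from this[of "supp f" f] show ?thesis using assms(1) by (simp add: carrier_iff)
qed

lemma abelian_group_R: "abelian_group R"
proof (rule abelian_groupI)
  fix x assume x: "x \<in> carrier R"
  then have "(\<lambda>a. \<ominus>\<^bsub>K\<^esub> x a) \<in> carrier R"
    by (auto simp: carrier_iff supp_def elim!: rev_finite_subset)
  then show "\<exists>y\<in>carrier R. y \<oplus>\<^bsub>R\<^esub> x = \<zero>\<^bsub>R\<^esub>"
    using x by (intro bexI[of _ "\<lambda>a. \<ominus>\<^bsub>K\<^esub> x a"]) (auto simp: add_apply zero_eq K.l_neg)
qed (auto simp: add_apply zero_eq K.a_ac fun_eq_iff intro: add_closed zero_closed[unfolded zero_eq])

lemma zero_mult: "f \<in> carrier R \<Longrightarrow> \<zero>\<^bsub>R\<^esub> \<otimes>\<^bsub>R\<^esub> f = \<zero>\<^bsub>R\<^esub>"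
  using supp_mult[of "\<zero>\<^bsub>R\<^esub>" f] zero_closed by (auto simp: supp_def zero_eq)

lemma mult_zero: "f \<in> carrier R \<Longrightarrow> f \<otimes>\<^bsub>R\<^esub> \<zero>\<^bsub>R\<^esub> = \<zero>\<^bsub>R\<^esub>"
  using supp_mult[of f "\<zero>\<^bsub>R\<^esub>"] zero_closed by (auto simp: supp_def zero_eq)

text \<open>Both sides are additive in each argument, which reduces the claim to three
  monomials.\<close>

lemma mult_assoc:
  assumes f: "f \<in> carrier R" and g: "g \<in> carrier R" and h: "h \<in> carrier R"
  shows "(f \<otimes>\<^bsub>R\<^esub> g) \<otimes>\<^bsub>R\<^esub> h = f \<otimes>\<^bsub>R\<^esub> (g \<otimes>\<^bsub>R\<^esub> h)"
  using f
proof (induction f rule: monoid_algebra_induct)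
  case zero
  show ?case using g h by (simp add: zero_mult mult_closed)
next
  case (add f1 f2)
  then show ?case using g h by (simp add: mult_l_distr mult_closed)
next
  case (mon c a)
  show ?case
    using g
  proof (induction g rule: monoid_algebra_induct)
    case zero
    show ?case using h mon by (simp add: zero_mult mult_zero mult_closed)
  next
    case (add f1 f2)
    then show ?case using h mon by (simp add: mult_l_distr mult_r_distr mult_closed)
  next
    case mon': (mon d b)
    show ?case
      using h
    proof (induction h rule: monoid_algebra_induct)
      case zero
      show ?case using mon mon' by (simp add: mult_zero mult_closed)
    next
      case (add f1 f2)
      then show ?case using mon mon' by (simp add: mult_r_distr mult_closed)
    next
      case mon'': (mon e x)
      then show ?case using mon mon' by (simp add: mon_mult K.m_assoc M.m_assoc)
    qed
  qed
qed

lemma ring_R: "ring R"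
proof (rule ringI)
  show "abelian_group R" by (rule abelian_group_R)
  have "\<one>\<^bsub>R\<^esub> \<otimes>\<^bsub>R\<^esub> f = f \<and> f \<otimes>\<^bsub>R\<^esub> \<one>\<^bsub>R\<^esub> = f" if "f \<in> carrier R" for f
    using that
    by (induction f rule: monoid_algebra_induct)
       (simp_all add: one_eq zero_mult mult_zero mon_mult mult_l_distr mult_r_distr)
  then show "monoid R"
    by (intro monoidI) (simp_all add: mult_closed mult_assoc one_eq)
qed (simp_all add: mult_l_distr mult_r_distr)

sublocale R: ring R by (rule ring_R)

lemma minus_apply: "f \<in> carrier R \<Longrightarrow> (\<ominus>\<^bsub>R\<^esub> f) a = \<ominus>\<^bsub>K\<^esub> f a"
proof -
  assume f: "f \<in> carrier R"
  then have "f a \<oplus>\<^bsub>K\<^esub> (\<ominus>\<^bsub>R\<^esub> f) a = \<zero>\<^bsub>K\<^esub>"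
    using R.r_neg[OF f] by (metis add_apply zero_eq)
  then show ?thesis using f by (metis K.add.inv_equality K.a_comm R.a_inv_closed carrier_val)
qed

lemma mon_add:
  assumes "c \<in> carrier K" "d \<in> carrier K"
  shows "mon (c \<oplus>\<^bsub>K\<^esub> d) a = mon c a \<oplus>\<^bsub>R\<^esub> mon d a"
  using assms by (auto simp: mon_def add_apply)

lemma scalars_eq: "scalars K M = (\<lambda>c. mon c \<one>\<^bsub>M\<^esub>) ` carrier K"
  by (simp add: scalars_def mon_def)

lemma scalar_mult:
  assumes "c \<in> carrier K" "f \<in> carrier R"
  shows "mon c \<one>\<^bsub>M\<^esub> \<otimes>\<^bsub>R\<^esub> f = (\<lambda>a. c \<otimes>\<^bsub>K\<^esub> f a)"
  using assms(2)
proof (induction f rule: monoid_algebra_induct)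
  case zero
  then show ?case using assms(1) by (simp add: mult_zero) (simp add: zero_eq)
next
  case (mon d a)
  then show ?case using assms(1) by (simp add: mon_mult) (auto simp: mon_def)
next
  case (add f g)
  then show ?case using assms(1) by (simp add: mult_r_distr) (auto simp: add_apply K.r_distr)
qed

lemma central_mon:
  assumes "c \<in> carrier K" "z \<in> mult_center M" "f \<in> carrier R"
  shows "mon c z \<otimes>\<^bsub>R\<^esub> f = f \<otimes>\<^bsub>R\<^esub> mon c z"
proof -
  have z: "z \<in> carrier M" using assms(2) by (simp add: mult_center_def)
  show ?thesis
    using assms(3)
  proof (induction f rule: monoid_algebra_induct)
    case zero
    then show ?case using z assms(1) by (simp add: zero_mult mult_zero)
  next
    case (mon d a)
    then show ?case using z assms(1,2) by (simp add: mon_mult K.m_comm mult_center_def)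
  next
    case (add f g)
    then show ?case using z assms(1) by (simp add: mult_l_distr mult_r_distr)
  qed
qed

lemma one_center: "\<one>\<^bsub>M\<^esub> \<in> mult_center M" by (simp add: mult_center_def)

lemma subfield_scalars: "subfield (scalars K M) R"
proof -
  have "(\<lambda>c. mon c \<one>\<^bsub>M\<^esub>) \<in> ring_hom K R"
    by (rule ring_hom_memI) (simp_all add: mon_mult mon_add one_eq)
  then interpret h: ring_hom_ring K R "\<lambda>c. mon c \<one>\<^bsub>M\<^esub>"
    by (intro ring_hom_ringI2 K.ring_axioms ring_R)
  have "\<one>\<^bsub>R\<^esub> \<noteq> \<zero>\<^bsub>R\<^esub>" by (metis K.one_not_zero mon_def one_eq zero_eq)
  then show ?thesis
    unfolding scalars_eq by (rule h.img_is_subfield(2)[OF K.carrier_is_subfield])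
qed

end

section \<open>Prime ideals of rings that are finite over a central subring\<close>

context ring
begin

lemma finsum_in_additive_subgroup:
  assumes "additive_subgroup N R" "\<And>i. i \<in> A \<Longrightarrow> f i \<in> N"
  shows "(\<Oplus>i\<in>A. f i) \<in> N"
proof -
  interpret additive_subgroup N R by fact
  show ?thesis
    using assms(2)
  proof (induction A rule: infinite_finite_induct)
    case (insert a A)
    then have "f \<in> A \<rightarrow> carrier R" "f a \<in> carrier R" using a_subset by auto
    with insert show ?case by (simp add: finsum_insert)
  qed (simp_all add: zero_closed)
qed

lemma finsum_swap:
  assumes "\<And>i j. i \<in> A \<Longrightarrow> j \<in> C \<Longrightarrow> f i j \<in> carrier R" "finite A" "finite C"
  shows "(\<Oplus>i\<in>A. \<Oplus>j\<in>C. f i j) = (\<Oplus>j\<in>C. \<Oplus>i\<in>A. f i j)"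
  using assms(2,1)
proof (induction A rule: finite_induct)
  case (insert a A)
  have "(\<Oplus>i\<in>insert a A. \<Oplus>j\<in>C. f i j) = (\<Oplus>j\<in>C. f a j) \<oplus> (\<Oplus>i\<in>A. \<Oplus>j\<in>C. f i j)"
    using insert by (intro finsum_insert) (auto intro!: finsum_closed)
  also have "\<dots> = (\<Oplus>j\<in>C. f a j) \<oplus> (\<Oplus>j\<in>C. \<Oplus>i\<in>A. f i j)" using insert by simp
  also have "\<dots> = (\<Oplus>j\<in>C. f a j \<oplus> (\<Oplus>i\<in>A. f i j))"
    using insert by (intro finsum_addf[symmetric]) (auto intro!: finsum_closed)
  also have "\<dots> = (\<Oplus>j\<in>C. \<Oplus>i\<in>insert a A. f i j)"
    using insert by (intro finsum_cong') (auto intro!: finsum_closed)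
  finally show ?case .
qed simp

lemma additive_subgroupI:
  assumes "N \<subseteq> carrier R" "\<zero> \<in> N" "\<And>a b. a \<in> N \<Longrightarrow> b \<in> N \<Longrightarrow> a \<oplus> b \<in> N"
    "\<And>a. a \<in> N \<Longrightarrow> \<ominus> a \<in> N"
  shows "additive_subgroup N R"
  by (rule additive_subgroup.intro, rule add.subgroupI) (use assms in \<open>auto simp: a_inv_def\<close>)

lemma left_idealD:
  assumes "left_ideal N R"
  shows "N \<subseteq> carrier R" "\<zero> \<in> N" "\<And>a b. a \<in> N \<Longrightarrow> b \<in> N \<Longrightarrow> a \<oplus> b \<in> N"
    "\<And>a. a \<in> N \<Longrightarrow> \<ominus> a \<in> N" "\<And>a b. a \<in> N \<Longrightarrow> b \<in> N \<Longrightarrow> a \<ominus> b \<in> N"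
    "\<And>x a. x \<in> carrier R \<Longrightarrow> a \<in> N \<Longrightarrow> x \<otimes> a \<in> N"
proof -
  interpret additive_subgroup N R using assms by (simp add: left_ideal_def)
  show "N \<subseteq> carrier R" "\<zero> \<in> N" "\<And>a b. a \<in> N \<Longrightarrow> b \<in> N \<Longrightarrow> a \<oplus> b \<in> N"
    "\<And>a. a \<in> N \<Longrightarrow> \<ominus> a \<in> N" "\<And>a b. a \<in> N \<Longrightarrow> b \<in> N \<Longrightarrow> a \<ominus> b \<in> N"
    using a_subset a_inv_closed by (auto simp: minus_eq)
  show "\<And>x a. x \<in> carrier R \<Longrightarrow> a \<in> N \<Longrightarrow> x \<otimes> a \<in> N"
    using assms by (simp add: left_ideal_def)
qed

lemma left_idealI:
  assumes "N \<subseteq> carrier R" "\<zero> \<in> N" "\<And>a b. a \<in> N \<Longrightarrow> b \<in> N \<Longrightarrow> a \<oplus> b \<in> N"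
    "\<And>x a. x \<in> carrier R \<Longrightarrow> a \<in> N \<Longrightarrow> x \<otimes> a \<in> N"
  shows "left_ideal N R"
proof -
  have "\<ominus> a \<in> N" if "a \<in> N" for a
    using assms(4)[of "\<ominus> \<one>" a] that assms(1) by (auto simp: l_minus)
  with assms show ?thesis by (auto simp: left_ideal_def intro: additive_subgroupI)
qed

lemma ideal_imp_left_ideal: "ideal N R \<Longrightarrow> left_ideal N R"
  by (auto simp: left_ideal_def ideal.axioms(1) ideal.I_l_closed)

lemma two_sided_idealI:
  assumes "left_ideal N R" "\<And>x a. x \<in> carrier R \<Longrightarrow> a \<in> N \<Longrightarrow> a \<otimes> x \<in> N"
  shows "ideal N R"
  using assms unfolding left_ideal_def by (auto intro!: ideal.intro ring_axioms simp: ideal_axioms_def)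

text \<open>J collects all right factors that x R sends into P, and I all left factors that do the
  same for every element of J. Both are two-sided ideals, x lies in I, y lies in J, and the product
  I J is inside P.\<close>

lemma nc_prime_idealD:
  assumes "nc_prime_ideal P R" "x \<in> carrier R" "y \<in> carrier R"
    and "\<And>r. r \<in> carrier R \<Longrightarrow> x \<otimes> r \<otimes> y \<in> P"
  shows "x \<in> P \<or> y \<in> P"
proof -
  interpret P: ideal P R using assms(1) by (simp add: nc_prime_ideal_def)
  define J where "J = {j \<in> carrier R. \<forall>r\<in>carrier R. x \<otimes> r \<otimes> j \<in> P}"
  define I where "I = {i \<in> carrier R. \<forall>j\<in>J. \<forall>r\<in>carrier R. i \<otimes> r \<otimes> j \<in> P}"
  have J: "ideal J R"
  proof (rule two_sided_idealI[OF left_idealI])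
    show "a \<otimes> s \<in> J" if "s \<in> carrier R" "a \<in> J" for s a
    proof -
      have "x \<otimes> r \<otimes> (a \<otimes> s) = x \<otimes> r \<otimes> a \<otimes> s" if "r \<in> carrier R" for r
        using that \<open>s \<in> carrier R\<close> \<open>a \<in> J\<close> assms(2) by (simp add: J_def m_assoc)
      then show ?thesis using that P.I_r_closed by (simp add: J_def)
    qed
    show "s \<otimes> a \<in> J" if "s \<in> carrier R" "a \<in> J" for s a
    proof -
      have "x \<otimes> r \<otimes> (s \<otimes> a) = x \<otimes> (r \<otimes> s) \<otimes> a" if "r \<in> carrier R" for r
        using that \<open>s \<in> carrier R\<close> \<open>a \<in> J\<close> assms(2) by (simp add: J_def m_assoc)
      then show ?thesis using that by (simp add: J_def)
    qed
  qed (use assms(2) in \<open>auto simp: J_def r_distr\<close>)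
  have Jc: "j \<in> carrier R" if "j \<in> J" for j using that by (simp add: J_def)
  have I: "ideal I R"
  proof (rule two_sided_idealI[OF left_idealI])
    show "s \<otimes> a \<in> I" if "s \<in> carrier R" "a \<in> I" for s a
    proof -
      have "s \<otimes> a \<otimes> r \<otimes> j = s \<otimes> (a \<otimes> r \<otimes> j)" if "r \<in> carrier R" "j \<in> J" for r j
        using that \<open>s \<in> carrier R\<close> \<open>a \<in> I\<close> Jc by (simp add: I_def m_assoc)
      then show ?thesis using that P.I_l_closed by (simp add: I_def)
    qed
    show "a \<otimes> s \<in> I" if "s \<in> carrier R" "a \<in> I" for s a
    proof -
      have "a \<otimes> s \<otimes> r \<otimes> j = a \<otimes> (s \<otimes> r) \<otimes> j" if "r \<in> carrier R" "j \<in> J" for r j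
        using that \<open>s \<in> carrier R\<close> \<open>a \<in> I\<close> Jc by (simp add: I_def m_assoc)
      then show ?thesis using that by (simp add: I_def)
    qed
  qed (use Jc in \<open>auto simp: I_def l_distr\<close>)
  have "s \<in> P" if "s \<in> I \<cdot> J" for s
    using that
  proof (induction s rule: ideal_prod.induct)
    case (prod i j)
    then have "i \<otimes> \<one> \<otimes> j \<in> P" unfolding I_def by blast
    then show ?case using prod by (simp add: I_def)
  qed auto
  then have "I \<cdot> J \<subseteq> P" by blast
  then have "I \<subseteq> P \<or> J \<subseteq> P"
    using assms(1) I J by (simp add: nc_prime_ideal_def)
  moreover have "x \<in> I" using assms(2) by (auto simp: I_def J_def)
  moreover have "y \<in> J" using assms by (auto simp: J_def)
  ultimately show ?thesis by blast
qed

text \<open>Fraction-free Gaussian elimination over the domain B modulo P, with more unknowns b i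
  than equations j. For P = 0 and B a field it is ordinary linear algebra, which is how
  \<open>card_indep_le\<close> uses it.\<close>

lemma linear_dependence_mod_prime:
  assumes "subring B R" and comm: "\<And>b c. b \<in> B \<Longrightarrow> c \<in> B \<Longrightarrow> b \<otimes> c = c \<otimes> b"
    and P: "ideal P R" "\<one> \<notin> P"
    and prime: "\<And>b c. b \<in> B \<Longrightarrow> c \<in> B \<Longrightarrow> b \<otimes> c \<in> P \<Longrightarrow> b \<in> P \<or> c \<in> P"
    and "finite J" "finite I" "card J < card I" "\<And>i j. i \<in> I \<Longrightarrow> j \<in> J \<Longrightarrow> c i j \<in> B"
  shows "\<exists>b. (\<forall>i\<in>I. b i \<in> B) \<and> (\<exists>i\<in>I. b i \<notin> P) \<and> (\<forall>j\<in>J. (\<Oplus>i\<in>I. b i \<otimes> c i j) \<in> P)"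
  using assms(6-)
proof (induction J arbitrary: I c rule: finite_induct)
  case empty
  then have "I \<noteq> {}" by auto
  then show ?case using P(2) subringE(3)[OF assms(1)] by (intro exI[of _ "\<lambda>_. \<one>"]) auto
next
  case (insert j0 J)
  interpret P: ideal P R by fact
  note B = subringE[OF assms(1)]
  have Bc: "x \<in> carrier R" if "x \<in> B" for x using B(1) that by blast
  note Ps = P.is_additive_subgroup
  show ?case
  proof (cases "\<forall>i\<in>I. c i j0 \<in> P")
    case True
    have "card J < card I" using insert by simp
    from insert.IH[OF insert.prems(1) this, of c] insert.prems(3)
    obtain b where b: "\<forall>i\<in>I. b i \<in> B" "\<exists>i\<in>I. b i \<notin> P" "\<forall>j\<in>J. (\<Oplus>i\<in>I. b i \<otimes> c i j) \<in> P"
      by auto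
    have "(\<Oplus>i\<in>I. b i \<otimes> c i j0) \<in> P"
      by (rule finsum_in_additive_subgroup[OF Ps]) (use True b(1) Bc P.I_l_closed in auto)
    with b show ?thesis by auto
  next
    case False
    then obtain i0 where i0: "i0 \<in> I" "c i0 j0 \<notin> P" by blast
    define p where "p = c i0 j0"
    have p: "p \<in> B" "p \<notin> P" using i0 insert.prems(3) by (auto simp: p_def)
    define I' where "I' = I - {i0}"
    have I': "I = insert i0 I'" "i0 \<notin> I'" "finite I'" using i0 insert.prems(1) by (auto simp: I'_def)
    have "card J < card I'" using insert I' by auto
    \<comment> \<open>Equation \<open>j0\<close> eliminates the unknown \<open>i0\<close>,
      multiplying by the pivot p in place of dividing by it.\<close>
    define c' where "c' i j = p \<otimes> c i j \<ominus> c i j0 \<otimes> c i0 j" for i j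
    have cB: "c i j \<in> B" if "i \<in> I" "j \<in> insert j0 J" for i j using insert.prems(3) that by blast
    have c'B: "c' i j \<in> B" if "i \<in> I'" "j \<in> J" for i j
      using that p(1) cB i0 B by (simp add: c'_def I' minus_eq)
    obtain b' where b': "\<And>i. i \<in> I' \<Longrightarrow> b' i \<in> B" "\<exists>i\<in>I'. b' i \<notin> P"
        "\<And>j. j \<in> J \<Longrightarrow> (\<Oplus>i\<in>I'. b' i \<otimes> c' i j) \<in> P"
      using insert.IH[of I' c'] I'(3) \<open>card J < card I'\<close> c'B by blast
    define S where "S = (\<Oplus>i\<in>I'. b' i \<otimes> c i j0)"
    have S: "S \<in> B"
      unfolding S_def using b'(1) cB I' B
      by (intro finsum_in_additive_subgroup additive_subgroupI) auto
    \<comment> \<open>Back substitution: scaling the other unknowns by p allows the value - S for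
      the eliminated one without division.\<close>
    define b where "b i = (if i = i0 then \<ominus> S else p \<otimes> b' i)" for i
    have bB: "b i \<in> B" if "i \<in> I" for i using that S p b'(1) B I' by (auto simp: b_def)
    have split: "(\<Oplus>i\<in>I. b i \<otimes> c i j) = \<ominus> S \<otimes> c i0 j \<oplus> (\<Oplus>i\<in>I'. p \<otimes> b' i \<otimes> c i j)"
      if j: "j \<in> insert j0 J" for j
    proof -
      have "(\<Oplus>i\<in>I. b i \<otimes> c i j) = b i0 \<otimes> c i0 j \<oplus> (\<Oplus>i\<in>I'. b i \<otimes> c i j)"
        unfolding I'(1) using I' bB cB j Bc by (intro finsum_insert) auto
      also have "(\<Oplus>i\<in>I'. b i \<otimes> c i j) = (\<Oplus>i\<in>I'. p \<otimes> b' i \<otimes> c i j)"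
        using I' p b'(1) cB j Bc by (intro finsum_cong') (auto simp: b_def)
      finally show ?thesis by (simp add: b_def)
    qed
    have "(\<Oplus>i\<in>I. b i \<otimes> c i j) \<in> P" if "j \<in> insert j0 J" for j
    proof (cases "j = j0")
      case True
      have "(\<Oplus>i\<in>I'. p \<otimes> b' i \<otimes> c i j0) = (\<Oplus>i\<in>I'. p \<otimes> (b' i \<otimes> c i j0))"
        using I' p b'(1) cB Bc by (intro finsum_cong') (auto simp: m_assoc)
      also have "\<dots> = p \<otimes> S"
        unfolding S_def using I' p b'(1) cB Bc by (intro finsum_rdistr[symmetric]) auto
      finally have "(\<Oplus>i\<in>I. b i \<otimes> c i j) = \<ominus> S \<otimes> p \<oplus> p \<otimes> S"
        using split[of j0] True by (simp add: p_def)
      also have "\<dots> = \<zero>" using comm[OF S p(1)] S p Bc by (simp add: l_minus l_neg)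
      finally show ?thesis by simp
    next
      case False
      then have j: "j \<in> J" using that by simp
      let ?T = "\<Oplus>i\<in>I'. b' i \<otimes> c' i j"
      have eq: "p \<otimes> b' i \<otimes> c i j = b' i \<otimes> c' i j \<oplus> b' i \<otimes> c i j0 \<otimes> c i0 j" if i: "i \<in> I'" for i
      proof -
        have car: "p \<in> carrier R" "b' i \<in> carrier R" "c i j \<in> carrier R" "c i j0 \<in> carrier R" "c i0 j \<in> carrier R"
          using i j I' p b'(1) cB Bc by auto
        have "b' i \<otimes> c' i j \<oplus> b' i \<otimes> c i j0 \<otimes> c i0 j
            = b' i \<otimes> (c' i j \<oplus> c i j0 \<otimes> c i0 j)"
          using car i j c'B Bc by (simp add: r_distr m_assoc)
        also have "c' i j \<oplus> c i j0 \<otimes> c i0 j = p \<otimes> c i j"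
          using car by (simp add: c'_def minus_eq a_assoc l_neg)
        also have "b' i \<otimes> (p \<otimes> c i j) = p \<otimes> b' i \<otimes> c i j"
          using car comm[OF b'(1)[OF i] p(1)] by (simp flip: m_assoc)
        finally show ?thesis by simp
      qed
      have "(\<Oplus>i\<in>I'. p \<otimes> b' i \<otimes> c i j) = (\<Oplus>i\<in>I'. b' i \<otimes> c' i j \<oplus> b' i \<otimes> c i j0 \<otimes> c i0 j)"
        using eq I' j b'(1) c'B cB Bc by (intro finsum_cong') auto
      also have "\<dots> = ?T \<oplus> (\<Oplus>i\<in>I'. b' i \<otimes> c i j0 \<otimes> c i0 j)"
        using I' j b'(1) c'B cB Bc by (intro finsum_addf) auto
      also have "(\<Oplus>i\<in>I'. b' i \<otimes> c i j0 \<otimes> c i0 j) = S \<otimes> c i0 j"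
        unfolding S_def using I' j b'(1) cB Bc by (intro finsum_ldistr[symmetric]) auto
      finally have "(\<Oplus>i\<in>I. b i \<otimes> c i j) = \<ominus> S \<otimes> c i0 j \<oplus> (?T \<oplus> S \<otimes> c i0 j)"
        using split[OF that] by simp
      also have "\<dots> = ?T"
      proof -
        have "S \<otimes> c i0 j \<in> carrier R" "?T \<in> carrier R" "S \<in> carrier R" "c i0 j \<in> carrier R"
          using S Bc cB i0 j b'(3) P.a_subset by auto
        then show ?thesis
          by (simp add: l_minus a_comm[of ?T] r_neg1 flip: a_assoc) (simp add: l_neg)
      qed
      finally show ?thesis using b'(3)[OF j] by simp
    qed
    moreover have "\<exists>i\<in>I. b i \<notin> P"
    proof -
      obtain i where "i \<in> I'" "b' i \<notin> P" using b'(2) by blast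
      moreover have "i \<noteq> i0" using calculation I' by auto
      ultimately show ?thesis using prime[OF p(1) b'(1)] p(2) I' by (auto simp: b_def)
    qed
    ultimately show ?thesis using bB by blast
  qed
qed

end

locale prime_over_center = ring R for R :: "('a, 'm) ring_scheme" (structure) +
  fixes B P
  assumes B: "subring B R"
    and central: "b \<in> B \<Longrightarrow> x \<in> carrier R \<Longrightarrow> b \<otimes> x = x \<otimes> b"
    and fin: "finite_module_over B R"
    and prime: "nc_prime_ideal P R"
begin

sublocale P: ideal P R using prime by (simp add: nc_prime_ideal_def)

lemma Bc: "b \<in> B \<Longrightarrow> b \<in> carrier R" using subringE(1)[OF B] by blast

lemma one_notin: "\<one> \<notin> P"
  using prime P.one_imp_carrier by (auto simp: nc_prime_ideal_def)

text \<open>For central b the product b r x equals r (b x), so b R x lies in P and primeness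
  applies: elements of B outside P are regular modulo P.\<close>

lemma cancel: "b \<in> B \<Longrightarrow> b \<notin> P \<Longrightarrow> x \<in> carrier R \<Longrightarrow> b \<otimes> x \<in> P \<Longrightarrow> x \<in> P"
proof -
  assume *: "b \<in> B" "b \<notin> P" "x \<in> carrier R" "b \<otimes> x \<in> P"
  have "b \<otimes> r \<otimes> x \<in> P" if "r \<in> carrier R" for r
    using P.I_l_closed[OF *(4) that] that * Bc central[of b r] by (simp add: m_assoc)
  with nc_prime_idealD[OF prime, of b x] * Bc show ?thesis by blast
qed

text \<open>Expand \<open>card G + 1\<close> elements in the generators G and solve the resulting
  system over B modulo P. This expresses that R modulo P has finite rank over the domain B modulo
  P.\<close>

lemma dependence:
  "\<exists>m::nat. \<forall>x. (\<forall>i\<le>m. x i \<in> carrier R) \<longrightarrow>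
    (\<exists>b. (\<forall>i\<le>m. b i \<in> B) \<and> (\<exists>i\<le>m. b i \<notin> P) \<and> (\<Oplus>i\<in>{..m}. b i \<otimes> x i) \<in> P)"
proof -
  obtain G where G: "finite G" "G \<subseteq> carrier R"
    "carrier R = {\<Oplus>g\<in>G. b g \<otimes> g | b. b \<in> G \<rightarrow> B}"
    using fin by (auto simp: finite_module_over_def)
  let ?m = "card G"
  have "\<exists>b. (\<forall>i\<le>?m. b i \<in> B) \<and> (\<exists>i\<le>?m. b i \<notin> P) \<and> (\<Oplus>i\<in>{..?m}. b i \<otimes> x i) \<in> P"
    if x: "\<And>i. i \<le> ?m \<Longrightarrow> x i \<in> carrier R" for x :: "nat \<Rightarrow> 'a"
  proof -
    have "\<exists>c. c \<in> G \<rightarrow> B \<and> x i = (\<Oplus>g\<in>G. c g \<otimes> g)" if "i \<le> ?m" for i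
    proof -
      have "x i \<in> {\<Oplus>g\<in>G. b g \<otimes> g | b. b \<in> G \<rightarrow> B}" using x[OF that] by (simp only: flip: G(3))
      then show ?thesis by blast
    qed
    then obtain c where c: "\<And>i. i \<le> ?m \<Longrightarrow> c i \<in> G \<rightarrow> B \<and> x i = (\<Oplus>g\<in>G. c i g \<otimes> g)"
      by metis
    have cc: "c i g \<in> B" if "i \<le> ?m" "g \<in> G" for i g using c that by blast
    have "\<exists>b. (\<forall>i\<in>{..?m}. b i \<in> B) \<and> (\<exists>i\<in>{..?m}. b i \<notin> P) \<and>
        (\<forall>g\<in>G. (\<Oplus>i\<in>{..?m}. b i \<otimes> c i g) \<in> P)"
    proof (rule linear_dependence_mod_prime[OF B _ P.is_ideal one_notin])
      show "b \<otimes> c = c \<otimes> b" if "b \<in> B" "c \<in> B" for b c using that central Bc by blast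
      show "b \<in> P \<or> c \<in> P" if "b \<in> B" "c \<in> B" "b \<otimes> c \<in> P" for b c
        using that cancel Bc by blast
    qed (use G(1) cc in simp_all)
    then obtain b where b: "\<forall>i\<in>{..?m}. b i \<in> B" "\<exists>i\<in>{..?m}. b i \<notin> P"
        "\<forall>g\<in>G. (\<Oplus>i\<in>{..?m}. b i \<otimes> c i g) \<in> P" by blast
    have car: "\<And>i. i \<le> ?m \<Longrightarrow> b i \<in> carrier R" "\<And>i g. i \<le> ?m \<Longrightarrow> g \<in> G \<Longrightarrow> c i g \<in> carrier R"
        "\<And>g. g \<in> G \<Longrightarrow> g \<in> carrier R"
      using b(1) cc Bc G(2) by auto
    have "(\<Oplus>i\<in>{..?m}. b i \<otimes> x i) = (\<Oplus>i\<in>{..?m}. \<Oplus>g\<in>G. b i \<otimes> c i g \<otimes> g)"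
    proof (rule finsum_cong')
      fix i assume i: "i \<in> {..?m}"
      have "b i \<otimes> x i = (\<Oplus>g\<in>G. b i \<otimes> (c i g \<otimes> g))"
        using i c b(1) car Bc G(1) by (auto intro!: finsum_rdistr)
      also have "\<dots> = (\<Oplus>g\<in>G. b i \<otimes> c i g \<otimes> g)"
        using i b(1) Bc car by (intro finsum_cong') (auto simp: m_assoc)
      finally show "b i \<otimes> x i = (\<Oplus>g\<in>G. b i \<otimes> c i g \<otimes> g)" .
    qed (use car in \<open>auto intro!: finsum_closed\<close>)
    also have "\<dots> = (\<Oplus>g\<in>G. \<Oplus>i\<in>{..?m}. b i \<otimes> c i g \<otimes> g)"
      using car G(1) by (intro finsum_swap) auto
    also have "\<dots> = (\<Oplus>g\<in>G. (\<Oplus>i\<in>{..?m}. b i \<otimes> c i g) \<otimes> g)"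
      using car by (intro finsum_cong' finsum_ldistr[symmetric]) (auto intro!: finsum_closed)
    also have "\<dots> \<in> P"
      using b(3) car by (intro finsum_in_additive_subgroup P.is_additive_subgroup)
        (auto intro: P.I_r_closed)
    finally show ?thesis using b by auto
  qed
  then show ?thesis by blast
qed

text \<open>Saturated left ideals stand for the left ideals of the localization of R modulo P at B -
  P; working with them avoids building a ring of fractions.\<close>

definition sat where
  "sat N \<longleftrightarrow> left_ideal N R \<and> P \<subseteq> N \<and> (\<forall>b\<in>B - P. \<forall>x\<in>carrier R. b \<otimes> x \<in> N \<longrightarrow> x \<in> N)"

text \<open>Elements x i witnessing infinitely many strict inclusions would be dependent over B
  modulo P. The first coefficient outside P then forces its x k into the next member of the chain,
  by saturation.\<close>

lemma wf_sat: "wf {(N, N'). sat N \<and> sat N' \<and> N \<subset> N'}"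
  unfolding wf_iff_no_infinite_down_chain
proof
  assume "\<exists>f. \<forall>i. (f (Suc i), f i) \<in> {(N, N'). sat N \<and> sat N' \<and> N \<subset> N'}"
  then obtain f where f: "\<And>i. sat (f i)" "\<And>i. f (Suc i) \<subset> f i" by blast
  then have anti: "f j \<subseteq> f i" if "i \<le> j" for i j
    using that lift_Suc_antimono_le[of f i j] by blast
  have "\<exists>y. y \<in> f i \<and> y \<notin> f (Suc i)" for i using f(2)[of i] by blast
  then obtain x where x: "\<And>i. x i \<in> f i" "\<And>i. x i \<notin> f (Suc i)" by metis
  have L: "left_ideal (f i) R" for i using f(1) by (simp add: sat_def)
  have xc: "x i \<in> carrier R" for i using x(1) left_idealD(1)[OF L] by blast
  obtain m where "\<exists>b. (\<forall>i\<le>m. b i \<in> B) \<and> (\<exists>i\<le>m. b i \<notin> P) \<and> (\<Oplus>i\<in>{..m}. b i \<otimes> x i) \<in> P"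
    using dependence xc by blast
  then obtain b where b: "\<And>i. i \<le> m \<Longrightarrow> b i \<in> B" "\<exists>i\<le>m. b i \<notin> P"
      "(\<Oplus>i\<in>{..m}. b i \<otimes> x i) \<in> P" by blast
  \<comment> \<open>Terms before k have coefficients in P, and terms after k have x i in
    \<open>f (Suc k)\<close>; so only the term of index k is left.\<close>
  define k where "k = (LEAST i. i \<le> m \<and> b i \<notin> P)"
  have k: "k \<le> m" "b k \<notin> P" using LeastI_ex[OF b(2)] by (auto simp: k_def)
  have least: "b i \<in> P" if "i < k" for i
    using not_less_Least[OF that[unfolded k_def]] that k by auto
  have PN: "P \<subseteq> f (Suc k)" using f(1) by (simp add: sat_def)
  have car: "b i \<otimes> x i \<in> carrier R" if "i \<le> m" for i using that b(1) Bc xc by blast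
  let ?s = "\<Oplus>i\<in>{..m} - {k}. b i \<otimes> x i"
  have s: "?s \<in> f (Suc k)"
  proof (rule finsum_in_additive_subgroup)
    show "additive_subgroup (f (Suc k)) R" using L by (simp add: left_ideal_def)
    fix i assume i: "i \<in> {..m} - {k}"
    show "b i \<otimes> x i \<in> f (Suc k)"
    proof (cases "i < k")
      case True
      then show ?thesis using PN P.I_r_closed[OF least xc] by blast
    next
      case False
      then have "x i \<in> f (Suc k)" using i x(1)[of i] anti[of "Suc k" i] by auto
      then show ?thesis using left_idealD(6)[OF L] i b(1) Bc by auto
    qed
  qed
  have "{..m} = insert k ({..m} - {k})" using k by auto
  then have "(\<Oplus>i\<in>{..m}. b i \<otimes> x i) = b k \<otimes> x k \<oplus> ?s"
    using car k finsum_insert[of "{..m} - {k}" k "\<lambda>i. b i \<otimes> x i"] by auto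
  then have "b k \<otimes> x k = (\<Oplus>i\<in>{..m}. b i \<otimes> x i) \<ominus> ?s"
    using car[OF k(1)] s left_idealD(1)[OF L, of "Suc k"] by (simp add: minus_eq a_assoc r_neg subset_iff)
  also have "\<dots> \<in> f (Suc k)" using s b(3) PN by (intro left_idealD(5)[OF L]) auto
  finally have "x k \<in> f (Suc k)"
    using f(1)[of "Suc k"] b(1)[OF k(1)] k(2) xc by (auto simp: sat_def)
  with x(2) show False by blast
qed

lemma sat_minimal:
  assumes "\<exists>N. sat N \<and> \<Phi> N"
  obtains N where "sat N" "\<Phi> N" "\<And>N'. sat N' \<Longrightarrow> \<Phi> N' \<Longrightarrow> N' \<subseteq> N \<Longrightarrow> N' = N"
proof -
  obtain N0 where "N0 \<in> {N. sat N \<and> \<Phi> N}" using assms by blast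
  from wfE_min[OF wf_sat this] obtain N where "N \<in> {N. sat N \<and> \<Phi> N}"
    "\<And>N'. (N', N) \<in> {(N, N'). sat N \<and> sat N' \<and> N \<subset> N'} \<Longrightarrow> N' \<notin> {N. sat N \<and> \<Phi> N}" by blast
  then show ?thesis by (intro that[of N]) blast+
qed

definition ann where "ann Z = {x \<in> carrier R. \<forall>l\<in>Z. x \<otimes> l \<in> P}"

lemma sat_ann:
  assumes "Z \<subseteq> carrier R"
  shows "sat (ann Z)"
proof -
  have "left_ideal (ann Z) R"
    using assms by (intro left_idealI) (auto simp: ann_def l_distr m_assoc subset_iff intro: P.I_l_closed)
  moreover have "P \<subseteq> ann Z" using assms P.I_r_closed P.Icarr by (auto simp: ann_def)
  moreover have "x \<in> ann Z" if bx: "b \<in> B - P" "x \<in> carrier R" "b \<otimes> x \<in> ann Z" for b x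
  proof -
    have "x \<otimes> l \<in> P" if l: "l \<in> Z" for l
    proof -
      have lc: "l \<in> carrier R" using l assms by blast
      have "b \<otimes> x \<otimes> l \<in> P" using bx(3) l by (simp add: ann_def)
      then have "b \<otimes> (x \<otimes> l) \<in> P" using bx lc Bc by (simp add: m_assoc)
      then show ?thesis using cancel[of b "x \<otimes> l"] bx lc by simp
    qed
    then show ?thesis using bx(2) by (simp add: ann_def)
  qed
  ultimately show ?thesis by (simp add: sat_def)
qed

text \<open>Localised at \<open>B - P\<close> this is the statement that a prime ring which is a finite-dimensional
  algebra is simple: a minimal left ideal is faithful, so finitely many elements of it have zero
  annihilator, and an identity modulo \<open>Q\<close> is built up on these elements one at a time.\<close>

lemma central_element_outside_prime:
  assumes "ideal Q R" "P \<subset> Q"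
  shows "\<exists>z\<in>B. z \<in> Q \<and> z \<notin> P"
proof -
  interpret Q: ideal Q R by fact
  have PQ: "P \<subseteq> Q" using assms by blast
  obtain q where q: "q \<in> Q" "q \<notin> P" "q \<in> carrier R" using assms(2) Q.Icarr by blast
  have "sat (carrier R) \<and> carrier R \<noteq> P"
    using ideal_imp_left_ideal[OF oneideal] P.Icarr one_notin by (auto simp: sat_def)
  \<comment> \<open>L plays the role of a minimal nonzero left ideal modulo P.\<close>
  then obtain L where L: "sat L" "L \<noteq> P" and Lmin: "\<And>N. sat N \<Longrightarrow> N \<noteq> P \<Longrightarrow> N \<subseteq> L \<Longrightarrow> N = L"
    using sat_minimal[of "\<lambda>N. N \<noteq> P"] by blast
  have Ll: "left_ideal L R" and PL: "P \<subseteq> L"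
    and Lsat: "\<And>b x. b \<in> B \<Longrightarrow> b \<notin> P \<Longrightarrow> x \<in> carrier R \<Longrightarrow> b \<otimes> x \<in> L \<Longrightarrow> x \<in> L"
    using L(1) by (auto simp: sat_def)
  note LD = left_idealD[OF Ll]
  obtain l0 where l0: "l0 \<in> L" "l0 \<notin> P" using L(2) PL by blast
  \<comment> \<open>Among annihilators of finite subsets of L there is a minimal one, and it equals
    P: for x in it but outside P, primeness gives r with x r \<open>l0\<close> outside P, and adding
    r \<open>l0\<close> to the subset would shrink the annihilator.\<close>
  obtain Z where Z: "finite Z" "Z \<subseteq> L" "ann Z = P"
  proof -
    have "\<exists>N. sat N \<and> (\<exists>Z. finite Z \<and> Z \<subseteq> L \<and> N = ann Z)"
      using sat_ann[of "{}"] by (intro exI[of _ "ann {}"]) auto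
    then obtain N where N: "\<exists>Z. finite Z \<and> Z \<subseteq> L \<and> N = ann Z"
      and Nmin: "\<And>N'. sat N' \<Longrightarrow> \<exists>Z. finite Z \<and> Z \<subseteq> L \<and> N' = ann Z \<Longrightarrow> N' \<subseteq> N \<Longrightarrow> N' = N"
      by (rule sat_minimal) iprover
    then obtain Z where Z: "finite Z" "Z \<subseteq> L" "N = ann Z" by blast
    have min: "ann Z' = ann Z" if "finite Z'" "Z' \<subseteq> L" "ann Z' \<subseteq> ann Z" for Z'
      unfolding Z(3)[symmetric] using that Z(3) LD(1) by (intro Nmin sat_ann) auto
    have "x \<in> P" if x: "x \<in> ann Z" for x
    proof (rule ccontr)
      assume "x \<notin> P"
      have xc: "x \<in> carrier R" using x by (simp add: ann_def)
      then obtain r where r: "r \<in> carrier R" "x \<otimes> r \<otimes> l0 \<notin> P"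
        using nc_prime_idealD[OF prime, of x l0] \<open>x \<notin> P\<close> l0 LD(1) by blast
      have "ann (insert (r \<otimes> l0) Z) = ann Z"
        using Z LD(6)[OF r(1) l0(1)] by (intro min) (auto simp: ann_def)
      then have "x \<in> ann (insert (r \<otimes> l0) Z)" using x by simp
      then show False using r xc l0 LD(1) by (auto simp: ann_def m_assoc)
    qed
    moreover have "P \<subseteq> ann Z" using sat_ann[of Z] Z(2) LD(1) by (auto simp: sat_def)
    ultimately show ?thesis using that Z by blast
  qed
  \<comment> \<open>The pair b, n encodes the fraction n/b with n in Q, which acts on Z' as the
    identity modulo P.\<close>
  have ex: "\<exists>b n. b \<in> B \<and> b \<notin> P \<and> n \<in> Q \<and> (\<forall>l\<in>Z'. (b \<ominus> n) \<otimes> l \<in> P)" if "finite Z'" "Z' \<subseteq> L" for Z'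
    using that
  proof (induction Z' rule: finite_induct)
    case empty
    show ?case using one_notin subringE(3)[OF B] Q.zero_closed by blast
  next
    case (insert l Z')
    then obtain b n where b: "b \<in> B" "b \<notin> P" "n \<in> Q" "\<And>l. l \<in> Z' \<Longrightarrow> (b \<ominus> n) \<otimes> l \<in> P" by auto
    have lc: "l \<in> carrier R" "l \<in> L" and Zc: "Z' \<subseteq> carrier R" using insert.prems LD(1) by auto
    have bc: "b \<in> carrier R" "n \<in> carrier R" using b Bc Q.Icarr by auto
    have bn: "b \<ominus> n \<in> ann Z'" using b bc by (simp add: ann_def)
    show ?case
    proof (cases "\<forall>x\<in>ann Z'. x \<otimes> l \<in> P")
      case True
      then show ?thesis using b bn by auto
    next
      case False
      then obtain x where x: "x \<in> ann Z'" "x \<otimes> l \<notin> P" by blast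
      have A: "left_ideal (ann Z') R" using sat_ann[OF Zc] by (simp add: sat_def)
      have xc: "x \<in> carrier R" using x by (simp add: ann_def)
      obtain r where r: "r \<in> carrier R" "q \<otimes> r \<otimes> (x \<otimes> l) \<notin> P"
        using nc_prime_idealD[OF prime, of q "x \<otimes> l"] q x xc lc by blast
      \<comment> \<open>The element t lies in Q and kills Z' modulo P but does not kill l; it shows
        that N below is larger than P.\<close>
      define t where "t = q \<otimes> r \<otimes> x"
      have t: "t \<in> Q" "t \<in> ann Z'" "t \<otimes> l \<notin> P" "t \<in> carrier R"
        using q r xc x lc left_idealD(6)[OF A, of "q \<otimes> r" x]
        by (auto simp: t_def m_assoc intro: Q.I_r_closed)
      \<comment> \<open>N is the saturation of P + (Q \<inter> ann Z') l. It is contained in L and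
        differs from P, so minimality gives N = L.\<close>
      define N where "N = {y \<in> carrier R. \<exists>c n. c \<in> B \<and> c \<notin> P \<and> n \<in> Q \<and> n \<in> ann Z' \<and> c \<otimes> y \<ominus> n \<otimes> l \<in> P}"
      have annc: "\<And>y. y \<in> ann Z' \<Longrightarrow> y \<in> carrier R" by (simp add: ann_def)
      have Bm: "c \<otimes> d \<in> B \<and> c \<otimes> d \<notin> P" if "c \<in> B" "c \<notin> P" "d \<in> B" "d \<notin> P" for c d
        using that cancel[of c d] Bc subringE(6)[OF B] by blast
      have "left_ideal N R"
      proof (rule left_idealI)
        have "\<one> \<otimes> \<zero> \<ominus> \<zero> \<otimes> l \<in> P" using lc by (simp add: minus_eq)
        then show "\<zero> \<in> N" unfolding N_def
          using subringE(3)[OF B] one_notin left_idealD(2)[OF A] Q.zero_closed by blast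
        fix y y' assume "y \<in> N" "y' \<in> N"
        then obtain c n c' n' where *: "y \<in> carrier R" "y' \<in> carrier R" "c \<in> B" "c \<notin> P" "n \<in> Q" "n \<in> ann Z'"
            "c \<otimes> y \<ominus> n \<otimes> l \<in> P" "c' \<in> B" "c' \<notin> P" "n' \<in> Q" "n' \<in> ann Z'" "c' \<otimes> y' \<ominus> n' \<otimes> l \<in> P"
          unfolding N_def by blast
        have cc: "c \<in> carrier R" "c' \<in> carrier R" "n \<in> carrier R" "n' \<in> carrier R"
          using * Bc annc by auto
        have com: "c \<otimes> c' = c' \<otimes> c" using central * cc by blast
        have "c' \<otimes> (c \<otimes> y \<ominus> n \<otimes> l) \<oplus> c \<otimes> (c' \<otimes> y' \<ominus> n' \<otimes> l)
            = c' \<otimes> c \<otimes> (y \<oplus> y') \<ominus> (c' \<otimes> n \<oplus> c \<otimes> n') \<otimes> l"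
        proof -
          have 1: "c' \<otimes> (c \<otimes> y \<ominus> n \<otimes> l) = c' \<otimes> c \<otimes> y \<oplus> \<ominus> (c' \<otimes> n \<otimes> l)"
            using * cc lc by (simp add: minus_eq r_distr r_minus m_assoc)
          have 2: "c \<otimes> (c' \<otimes> y' \<ominus> n' \<otimes> l) = c' \<otimes> c \<otimes> y' \<oplus> \<ominus> (c \<otimes> n' \<otimes> l)"
            using * cc lc com by (simp add: minus_eq r_distr r_minus flip: m_assoc)
          show ?thesis unfolding 1 2
            using * cc lc by (simp add: minus_eq r_distr l_distr minus_add a_ac)
        qed
        moreover have "c' \<otimes> (c \<otimes> y \<ominus> n \<otimes> l) \<oplus> c \<otimes> (c' \<otimes> y' \<ominus> n' \<otimes> l) \<in> P"
          using * cc by (intro P.a_closed P.I_l_closed)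
        moreover have "c' \<otimes> n \<oplus> c \<otimes> n' \<in> Q" using * cc by (auto intro: Q.I_l_closed)
        moreover have "c' \<otimes> n \<oplus> c \<otimes> n' \<in> ann Z'" using * cc by (intro left_idealD(3)[OF A] left_idealD(6)[OF A])
        ultimately show "y \<oplus> y' \<in> N" using * Bm[of c' c] unfolding N_def
          by (intro CollectI conjI exI[of _ "c' \<otimes> c"] exI[of _ "c' \<otimes> n \<oplus> c \<otimes> n'"]) auto
      next
        fix a y assume "a \<in> carrier R" "y \<in> N"
        then obtain c n where *: "a \<in> carrier R" "y \<in> carrier R" "c \<in> B" "c \<notin> P" "n \<in> Q" "n \<in> ann Z'"
            "c \<otimes> y \<ominus> n \<otimes> l \<in> P"
          unfolding N_def by blast
        have cc: "c \<in> carrier R" "n \<in> carrier R" using * Bc annc by auto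
        have "a \<otimes> (c \<otimes> y \<ominus> n \<otimes> l) = c \<otimes> (a \<otimes> y) \<ominus> a \<otimes> n \<otimes> l"
          using * cc lc central[OF *(3,1)] by (simp add: minus_eq r_distr r_minus flip: m_assoc)
        with * P.I_l_closed[of "c \<otimes> y \<ominus> n \<otimes> l" a] have "c \<otimes> (a \<otimes> y) \<ominus> a \<otimes> n \<otimes> l \<in> P" by simp
        moreover have "a \<otimes> n \<in> Q" "a \<otimes> n \<in> ann Z'"
          using * Q.I_l_closed left_idealD(6)[OF A] by auto
        ultimately show "a \<otimes> y \<in> N" using * unfolding N_def by blast
      qed (auto simp: N_def)
      moreover have "P \<subseteq> N"
      proof
        fix y assume y: "y \<in> P"
        then have "\<one> \<otimes> y \<ominus> \<zero> \<otimes> l \<in> P" using P.Icarr lc by (simp add: minus_eq)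
        then show "y \<in> N" unfolding N_def
          using y P.Icarr subringE(3)[OF B] one_notin left_idealD(2)[OF A] Q.zero_closed by blast
      qed
      moreover have "y \<in> N" if dy: "d \<in> B - P" "y \<in> carrier R" "d \<otimes> y \<in> N" for d y
      proof -
        obtain c n where *: "c \<in> B" "c \<notin> P" "n \<in> Q" "n \<in> ann Z'" "c \<otimes> (d \<otimes> y) \<ominus> n \<otimes> l \<in> P"
          using dy(3) unfolding N_def by blast
        then have "c \<otimes> d \<otimes> y \<ominus> n \<otimes> l \<in> P" using dy Bc by (simp add: m_assoc)
        then show ?thesis using * Bm[of c d] dy unfolding N_def by blast
      qed
      ultimately have "sat N" by (simp add: sat_def)
      moreover have "t \<otimes> l \<in> N"
      proof -
        have "\<one> \<otimes> (t \<otimes> l) \<ominus> t \<otimes> l \<in> P" using t lc by (simp add: minus_eq r_neg)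
        then show ?thesis using t lc subringE(3)[OF B] one_notin unfolding N_def by blast
      qed
      moreover have "N \<subseteq> L"
      proof
        fix y assume "y \<in> N"
        then obtain c n where *: "y \<in> carrier R" "c \<in> B" "c \<notin> P" "n \<in> ann Z'" "c \<otimes> y \<ominus> n \<otimes> l \<in> P"
          unfolding N_def by blast
        have "n \<otimes> l \<in> L" using * annc lc LD(6) by blast
        then have "(c \<otimes> y \<ominus> n \<otimes> l) \<oplus> n \<otimes> l \<in> L" using * PL LD(3) by blast
        also have "(c \<otimes> y \<ominus> n \<otimes> l) \<oplus> n \<otimes> l = c \<otimes> y"
          using * annc lc Bc by (simp add: minus_eq a_assoc l_neg)
        finally show "y \<in> L" using Lsat * by blast
      qed
      ultimately have "N = L" using Lmin t(3) by blast
      \<comment> \<open>Since (b - n) l lies in L = N, some n' in Q that kills Z' corrects n at l;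
        after clearing the denominator c the new pair is c b, c n + n'.\<close>
      then have "(b \<ominus> n) \<otimes> l \<in> N" using LD(6) lc bc by simp
      then obtain c n' where c: "c \<in> B" "c \<notin> P" "n' \<in> Q" "n' \<in> ann Z'"
          "c \<otimes> ((b \<ominus> n) \<otimes> l) \<ominus> n' \<otimes> l \<in> P" unfolding N_def by blast
      have cc: "c \<in> carrier R" "n' \<in> carrier R" using c Bc annc by auto
      have eq: "(c \<otimes> b \<ominus> (c \<otimes> n \<oplus> n')) \<otimes> k = c \<otimes> ((b \<ominus> n) \<otimes> k) \<ominus> n' \<otimes> k" if "k \<in> carrier R" for k
      proof -
        have e1: "(c \<otimes> b \<ominus> (c \<otimes> n \<oplus> n')) \<otimes> k = c \<otimes> b \<otimes> k \<oplus> (\<ominus> (c \<otimes> n \<otimes> k) \<oplus> \<ominus> (n' \<otimes> k))"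
          using that cc bc by (simp add: minus_eq l_distr minus_add l_minus)
        have e2: "c \<otimes> ((b \<ominus> n) \<otimes> k) = c \<otimes> b \<otimes> k \<oplus> \<ominus> (c \<otimes> n \<otimes> k)"
          using that cc bc by (simp add: minus_eq l_distr r_distr l_minus r_minus m_assoc)
        show ?thesis unfolding e1 e2 minus_eq[of "c \<otimes> b \<otimes> k \<oplus> \<ominus> (c \<otimes> n \<otimes> k)"]
          using that cc bc by (intro a_assoc[symmetric]) auto
      qed
      have "(c \<otimes> b \<ominus> (c \<otimes> n \<oplus> n')) \<otimes> k \<in> P" if "k \<in> insert l Z'" for k
      proof (cases "k = l")
        case True
        then show ?thesis using eq[of l] lc c by simp
      next
        case False
        then have k: "k \<in> Z'" "k \<in> carrier R" using that Zc by auto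
        have "n' \<otimes> k \<in> P" using c k by (simp add: ann_def)
        moreover have "c \<otimes> ((b \<ominus> n) \<otimes> k) \<in> P" using b(4)[OF k(1)] cc by (simp add: P.I_l_closed)
        ultimately show ?thesis
          unfolding eq[OF k(2)] by (intro left_idealD(5)[OF ideal_imp_left_ideal[OF P.is_ideal]])
      qed
      moreover have "c \<otimes> n \<oplus> n' \<in> Q" using c b cc by (auto intro: Q.I_l_closed)
      moreover have "c \<otimes> b \<in> B \<and> c \<otimes> b \<notin> P" using Bm c b by blast
      ultimately show ?thesis by blast
    qed
  qed
  from ex[OF Z(1,2)] obtain b n
    where b: "b \<in> B" "b \<notin> P" "n \<in> Q" "\<forall>l\<in>Z. (b \<ominus> n) \<otimes> l \<in> P" by iprover
  have bc: "b \<in> carrier R" "n \<in> carrier R" using b Bc Q.Icarr by auto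
  \<comment> \<open>Now b - n kills Z modulo P, hence lies in P and so in Q; therefore the central
    element b itself lies in Q.\<close>
  then have "b \<ominus> n \<in> ann Z" using b by (simp add: ann_def)
  then have "b \<ominus> n \<in> Q" using Z(3) PQ by blast
  then have "(b \<ominus> n) \<oplus> n \<in> Q" using b(3) by blast
  also have "(b \<ominus> n) \<oplus> n = b" using bc by (simp add: minus_eq a_assoc l_neg)
  finally show ?thesis using b by blast
qed

end

section \<open>Growth along chains of primes\<close>

text \<open>Polynomial growth of degree n cannot be bounded by growth of smaller degree q. The upper
  bounds for the rank and for the length of prime chains both end here.\<close>

lemma degree_le_of_power_bound:
  fixes n q c a :: nat
  assumes "\<And>m. (m + 1) ^ n \<le> c * (a * m + 1) ^ q"
  shows "n \<le> q"
proof (rule ccontr)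
  assume "\<not> n \<le> q"
  \<comment> \<open>With this m the estimate collapses to (m + 1) times a positive number being at
    most m times the same number.\<close>
  define m where "m = c * (a + 1) ^ q"
  have "(m + 1) * (m + 1) ^ q \<le> (m + 1) ^ n"
    using \<open>\<not> n \<le> q\<close> by (simp flip: power_Suc add: power_increasing del: power_Suc)
  also have "\<dots> \<le> c * (a * m + 1) ^ q" by (rule assms)
  also have "\<dots> \<le> c * ((a + 1) * (m + 1)) ^ q"
    by (intro mult_left_mono power_mono) (auto simp: algebra_simps)
  also have "\<dots> = c * (a + 1) ^ q * (m + 1) ^ q" by (simp only: power_mult_distrib mult.assoc)
  also have "\<dots> = m * (m + 1) ^ q" by (simp only: m_def[symmetric])
  finally show False by simp
qed

text \<open>E n is to be thought of as the ball of radius n for word length. The last assumption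
  makes the span of E 1 a generating space whose growth is exactly that of the balls.\<close>

locale filtered_monoid_alg = monoid_alg K M
  for K :: "('k, 'm) ring_scheme" and M :: "('a, 'n) monoid_scheme" +
  fixes E :: "nat \<Rightarrow> 'a set"
  assumes finite_E: "finite (E n)"
    and Union_E: "(\<Union>n. E n) = carrier M"
    and mono_E: "n \<le> m \<Longrightarrow> E n \<subseteq> E m"
    and mult_E: "a \<in> E n \<Longrightarrow> b \<in> E m \<Longrightarrow> a \<otimes>\<^bsub>M\<^esub> b \<in> E (n + m)"
    and one_E: "\<one>\<^bsub>M\<^esub> \<in> E 0"
    and gen_E: "a \<in> E n \<Longrightarrow> \<exists>as. set as \<subseteq> E 1 \<and> length as \<le> n \<and> foldr (\<otimes>\<^bsub>M\<^esub>) as \<one>\<^bsub>M\<^esub> = a"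
begin

abbreviation k where "k \<equiv> scalars K M"

definition W :: "'a set \<Rightarrow> ('a \<Rightarrow> 'k) set" where "W T = {f \<in> carrier R. supp f \<subseteq> T}"

lemma E_carrier: "E n \<subseteq> carrier M" using Union_E by blast

lemma W_carrier: "W T \<subseteq> carrier R" by (auto simp: W_def)

lemma W_mono: "T \<subseteq> T' \<Longrightarrow> W T \<subseteq> W T'" by (auto simp: W_def)

lemma W_zero: "\<zero>\<^bsub>R\<^esub> \<in> W T" using zero_closed by (auto simp: W_def supp_def zero_eq)

lemma W_add: "f \<in> W T \<Longrightarrow> g \<in> W T \<Longrightarrow> f \<oplus>\<^bsub>R\<^esub> g \<in> W T"
  using supp_add[of f g] by (auto simp: W_def add_closed)

lemma W_scalar: "c \<in> carrier K \<Longrightarrow> f \<in> W T \<Longrightarrow> mon c \<one>\<^bsub>M\<^esub> \<otimes>\<^bsub>R\<^esub> f \<in> W T"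
proof -
  assume *: "c \<in> carrier K" "f \<in> W T"
  then have "supp (mon c \<one>\<^bsub>M\<^esub> \<otimes>\<^bsub>R\<^esub> f) \<subseteq> supp f"
    by (subst scalar_mult) (auto simp: supp_def W_def)
  with * show ?thesis by (auto simp: W_def mult_closed)
qed

lemma subalgebra_W: "subalgebra k (W T) R"
proof -
  have "\<ominus>\<^bsub>R\<^esub> f \<in> W T" if "f \<in> W T" for f
  proof -
    have "supp (\<ominus>\<^bsub>R\<^esub> f) \<subseteq> supp f"
      using that by (auto simp: supp_def minus_apply W_def)
    then show ?thesis using that by (auto simp: W_def)
  qed
  then have "additive_subgroup (W T) R"
    by (intro R.additive_subgroupI W_carrier W_zero W_add)
  then show ?thesis
    by (auto simp: subalgebra_def subalgebra_axioms_def additive_subgroup_def scalars_eq W_scalar)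
qed

text \<open>The inductive notion \<open>dimension\<close> grows by \<open>line_extension\<close>;
  this identity lets it count the elements of T.\<close>

lemma W_insert:
  assumes "t \<in> carrier M"
  shows "W (insert t T) = R.line_extension k (mon \<one>\<^bsub>K\<^esub> t) (W T)"
proof (intro subset_antisym subsetI)
  fix f assume f: "f \<in> W (insert t T)"
  let ?g = "\<lambda>b. if b \<in> - {t} then f b else \<zero>\<^bsub>K\<^esub>"
  have fc: "f \<in> carrier R" using f W_carrier by blast
  have "f = mon (f t) t \<oplus>\<^bsub>R\<^esub> ?g" by (rule split_mon[OF fc])
  moreover have "mon (f t) t = mon (f t) \<one>\<^bsub>M\<^esub> \<otimes>\<^bsub>R\<^esub> mon \<one>\<^bsub>K\<^esub> t"
    using fc assms by (simp add: mon_mult)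
  moreover have "?g \<in> W T" using f restrict_supp[OF fc, of "- {t}"] by (auto simp: W_def supp_def)
  ultimately show "f \<in> R.line_extension k (mon \<one>\<^bsub>K\<^esub> t) (W T)"
    unfolding R.line_extension_mem_iff using fc by (force simp: scalars_eq)
next
  fix f assume "f \<in> R.line_extension k (mon \<one>\<^bsub>K\<^esub> t) (W T)"
  then obtain c g where f: "c \<in> carrier K" "g \<in> W T" "f = mon c \<one>\<^bsub>M\<^esub> \<otimes>\<^bsub>R\<^esub> mon \<one>\<^bsub>K\<^esub> t \<oplus>\<^bsub>R\<^esub> g"
    unfolding R.line_extension_mem_iff by (auto simp: scalars_eq)
  have "mon \<one>\<^bsub>K\<^esub> t \<in> W (insert t T)" using assms supp_mon[of "\<one>\<^bsub>K\<^esub>" t] by (auto simp: W_def)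
  then show "f \<in> W (insert t T)"
    using f W_mono[of T "insert t T"] by (auto intro!: W_add W_scalar)
qed

lemma dimension_W: "finite T \<Longrightarrow> T \<subseteq> carrier M \<Longrightarrow> R.dimension (card T) k (W T)"
proof (induction T rule: finite_induct)
  case empty
  have "W {} = {\<zero>\<^bsub>R\<^esub>}" using W_zero[of "{}"] by (auto simp: W_def supp_def zero_eq)
  then show ?case by simp
next
  case (insert t T)
  have "mon \<one>\<^bsub>K\<^esub> t t \<noteq> \<zero>\<^bsub>K\<^esub>" by (simp add: mon_def)
  then have "mon \<one>\<^bsub>K\<^esub> t \<notin> W T" using insert.hyps by (auto simp: W_def supp_def)
  then show ?case
    using insert by (simp add: W_insert R.Suc_dim)
qed

lemma in_W_E: "f \<in> carrier R \<Longrightarrow> \<exists>n. f \<in> W (E n)"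
proof (induction f rule: monoid_algebra_induct)
  case zero
  then show ?case using W_zero by blast
next
  case (mon c a)
  then obtain n where "a \<in> E n" using Union_E by blast
  then show ?case using mon supp_mon[of c a] by (auto simp: W_def)
next
  case (add f g)
  then obtain n m where "f \<in> W (E n)" "g \<in> W (E m)" by blast
  moreover have "W (E n) \<subseteq> W (E (max n m))" "W (E m) \<subseteq> W (E (max n m))"
    by (simp_all add: W_mono mono_E)
  ultimately show ?case using W_add by blast
qed

lemma mult_W_E: "f \<in> W (E n) \<Longrightarrow> g \<in> W (E m) \<Longrightarrow> f \<otimes>\<^bsub>R\<^esub> g \<in> W (E (n + m))"
  using supp_mult[of f g] mult_E by (fastforce simp: W_def mult_closed)

lemma one_W_E: "\<one>\<^bsub>R\<^esub> \<in> W (E 0)"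
  using supp_mon[of "\<one>\<^bsub>K\<^esub>" "\<one>\<^bsub>M\<^esub>"] one_E by (auto simp: W_def one_eq)

lemma pow_W_E: "f \<in> W (E n) \<Longrightarrow> f [^]\<^bsub>R\<^esub> (j :: nat) \<in> W (E (j * n))"
proof (induction j)
  case (Suc j)
  then show ?case using mult_W_E[of "f [^]\<^bsub>R\<^esub> j" "j * n" f n] by (simp add: add.commute)
qed (simp add: one_W_E)

lemma mono_W_E: "n \<le> m \<Longrightarrow> W (E n) \<subseteq> W (E m)" by (intro W_mono mono_E)

lemma finsum_R_apply:
  assumes "\<And>i. i \<in> I \<Longrightarrow> f i \<in> carrier R" "finite I"
  shows "(\<Oplus>\<^bsub>R\<^esub>i\<in>I. f i) a = (\<Oplus>\<^bsub>K\<^esub>i\<in>I. f i a)"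
  using assms(2,1)
proof (induction I rule: finite_induct)
  case (insert i I)
  have "(\<Oplus>\<^bsub>R\<^esub>i\<in>insert i I. f i) = f i \<oplus>\<^bsub>R\<^esub> (\<Oplus>\<^bsub>R\<^esub>i\<in>I. f i)"
    using insert by (intro R.finsum_insert) auto
  moreover have "(\<Oplus>\<^bsub>K\<^esub>i\<in>insert i I. f i a) = f i a \<oplus>\<^bsub>K\<^esub> (\<Oplus>\<^bsub>K\<^esub>i\<in>I. f i a)"
    using insert by (intro K.finsum_insert) auto
  ultimately show ?case using insert by (simp add: add_apply)
qed (simp add: zero_eq)

text \<open>Linear independence over K modulo P, for an indexed family, so that the size of the
  index set can be compared with a dimension even before the vectors are known to be
  distinct.\<close>

definition indep :: "('a \<Rightarrow> 'k) set \<Rightarrow> 'i set \<Rightarrow> ('i \<Rightarrow> 'a \<Rightarrow> 'k) \<Rightarrow> bool" where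
  "indep P I w \<longleftrightarrow> (\<forall>\<alpha>. (\<forall>i\<in>I. \<alpha> i \<in> carrier K) \<and>
     (\<Oplus>\<^bsub>R\<^esub>i\<in>I. mon (\<alpha> i) \<one>\<^bsub>M\<^esub> \<otimes>\<^bsub>R\<^esub> w i) \<in> P \<longrightarrow> (\<forall>i\<in>I. \<alpha> i = \<zero>\<^bsub>K\<^esub>))"

text \<open>More than \<open>card T\<close> vectors with coordinates in T satisfy a nontrivial
  linear relation, whose value is zero and hence in P.\<close>

lemma card_indep_le:
  assumes "indep P I w" "\<zero>\<^bsub>R\<^esub> \<in> P" "finite I" "finite T" "\<And>i. i \<in> I \<Longrightarrow> w i \<in> W T"
  shows "card I \<le> card T"
proof (rule ccontr)
  assume "\<not> card I \<le> card T"
  then have less: "card T < card I" by simp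
  have wc: "w i \<in> carrier R" if "i \<in> I" for i using assms(5)[OF that] W_carrier by blast
  have "\<exists>b. (\<forall>i\<in>I. b i \<in> carrier K) \<and> (\<exists>i\<in>I. b i \<notin> {\<zero>\<^bsub>K\<^esub>}) \<and>
      (\<forall>a\<in>T. (\<Oplus>\<^bsub>K\<^esub>i\<in>I. b i \<otimes>\<^bsub>K\<^esub> w i a) \<in> {\<zero>\<^bsub>K\<^esub>})"
  proof (rule K.linear_dependence_mod_prime[OF K.carrier_is_subring _ K.zeroideal _ _ assms(4,3) less])
    show "b \<otimes>\<^bsub>K\<^esub> c = c \<otimes>\<^bsub>K\<^esub> b" if "b \<in> carrier K" "c \<in> carrier K" for b c
      using that by (rule K.m_comm)
    show "b \<in> {\<zero>\<^bsub>K\<^esub>} \<or> c \<in> {\<zero>\<^bsub>K\<^esub>}"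
      if "b \<in> carrier K" "c \<in> carrier K" "b \<otimes>\<^bsub>K\<^esub> c \<in> {\<zero>\<^bsub>K\<^esub>}" for b c
      using that K.integral by blast
  qed (use wc in auto)
  then obtain b where b: "\<forall>i\<in>I. b i \<in> carrier K" "\<exists>i\<in>I. b i \<noteq> \<zero>\<^bsub>K\<^esub>"
      "\<forall>a\<in>T. (\<Oplus>\<^bsub>K\<^esub>i\<in>I. b i \<otimes>\<^bsub>K\<^esub> w i a) = \<zero>\<^bsub>K\<^esub>" by auto
  have "(\<Oplus>\<^bsub>R\<^esub>i\<in>I. mon (b i) \<one>\<^bsub>M\<^esub> \<otimes>\<^bsub>R\<^esub> w i) = \<zero>\<^bsub>R\<^esub>"
  proof
    fix a
    have "(\<Oplus>\<^bsub>R\<^esub>i\<in>I. mon (b i) \<one>\<^bsub>M\<^esub> \<otimes>\<^bsub>R\<^esub> w i) a = (\<Oplus>\<^bsub>K\<^esub>i\<in>I. (mon (b i) \<one>\<^bsub>M\<^esub> \<otimes>\<^bsub>R\<^esub> w i) a)"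
      using b(1) wc assms(3) by (intro finsum_R_apply) (auto intro: mult_closed)
    also have "\<dots> = (\<Oplus>\<^bsub>K\<^esub>i\<in>I. b i \<otimes>\<^bsub>K\<^esub> w i a)"
      using b(1) wc by (intro K.finsum_cong') (auto simp: scalar_mult)
    also have "\<dots> = \<zero>\<^bsub>K\<^esub>"
    proof (cases "a \<in> T")
      case False
      then have "w i a = \<zero>\<^bsub>K\<^esub>" if "i \<in> I" for i using assms(5)[OF that] by (auto simp: W_def supp_def)
      then show ?thesis using b(1) by (intro K.add.finprod_one_eqI) auto
    qed (use b in auto)
    finally show "(\<Oplus>\<^bsub>R\<^esub>i\<in>I. mon (b i) \<one>\<^bsub>M\<^esub> \<otimes>\<^bsub>R\<^esub> w i) a = \<zero>\<^bsub>R\<^esub> a" by (simp add: zero_eq)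
  qed
  then have "(\<Oplus>\<^bsub>R\<^esub>i\<in>I. mon (b i) \<one>\<^bsub>M\<^esub> \<otimes>\<^bsub>R\<^esub> w i) \<in> P" using assms(2) by (simp only:)
  with b(1) have "\<forall>i\<in>I. b i = \<zero>\<^bsub>K\<^esub>" using assms(1)[unfolded indep_def, rule_format, of b] by blast
  with b(2) show False by blast
qed

text \<open>The head of the index list is the exponent of z, the tail indexes the previous family.
  Iteration yields the monomials in the chosen central elements.\<close>

definition cons_family :: "('a \<Rightarrow> 'k) \<Rightarrow> (nat list \<Rightarrow> 'a \<Rightarrow> 'k) \<Rightarrow> nat list \<Rightarrow> 'a \<Rightarrow> 'k" where
  "cons_family z w l = z [^]\<^bsub>R\<^esub> hd l \<otimes>\<^bsub>R\<^esub> w (tl l)"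

text \<open>Passing to a smaller prime, the powers of a central element that becomes regular raise the
  growth exponent by one.\<close>

lemma indep_step:
  assumes "prime_over_center R B P" "ideal Q R" "P \<subseteq> Q" "z \<in> B" "z \<in> Q" "z \<notin> P"
    and w: "\<And>i. i \<in> I \<Longrightarrow> w i \<in> carrier R" "finite I" "indep Q I w"
  shows "indep P (\<Union>j\<in>{..m}. (#) j ` I) (cons_family z w)"
proof -
  interpret P: prime_over_center R B P by fact
  interpret Q: ideal Q R by fact
  have zc: "z \<in> carrier R" by (rule P.Bc) fact
  have Qz: "z [^]\<^bsub>R\<^esub> j \<otimes>\<^bsub>R\<^esub> x \<in> Q" if j: "j > 0" "x \<in> carrier R" for j :: nat and x
  proof -
    obtain i where "j = Suc i" using j(1) by (cases j) auto
    then show ?thesis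
      using zc Q.I_r_closed[OF Q.I_l_closed[OF \<open>z \<in> Q\<close>, of "z [^]\<^bsub>R\<^esub> i"] j(2)] by simp
  qed
  let ?V = "\<lambda>\<beta>. \<Oplus>\<^bsub>R\<^esub>i\<in>I. mon (\<beta> i) \<one>\<^bsub>M\<^esub> \<otimes>\<^bsub>R\<^esub> w i"
  have Vc: "?V \<beta> \<in> carrier R" if "\<forall>i\<in>I. \<beta> i \<in> carrier K" for \<beta>
    using that w by (intro R.finsum_closed) (auto intro: mult_closed)
  \<comment> \<open>Modulo Q only the term with exponent 0 survives, so independence modulo Q kills
    its coefficients. What is left is divisible by z, which is regular modulo P, and m drops by
    one.\<close>
  have key: "\<forall>j\<le>m. \<forall>i\<in>I. \<alpha> j i = \<zero>\<^bsub>K\<^esub>"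
    if "\<And>j i. j \<le> m \<Longrightarrow> i \<in> I \<Longrightarrow> \<alpha> j i \<in> carrier K"
      "(\<Oplus>\<^bsub>R\<^esub>j\<in>{..m}. z [^]\<^bsub>R\<^esub> j \<otimes>\<^bsub>R\<^esub> ?V (\<alpha> j)) \<in> P" for \<alpha> and m :: nat
    using that
  proof (induction m arbitrary: \<alpha>)
    case 0
    have "?V (\<alpha> 0) \<in> P" using 0 Vc[of "\<alpha> 0"] by (simp add: R.finsum_0)
    then show ?case using w(3) 0 \<open>P \<subseteq> Q\<close> unfolding indep_def by auto
  next
    case (Suc m)
    have V: "?V (\<alpha> j) \<in> carrier R" if "j \<le> Suc m" for j using Suc.prems(1) that by (intro Vc) auto
    have pc: "z [^]\<^bsub>R\<^esub> (j::nat) \<in> carrier R" for j using zc by simp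
    let ?T = "\<Oplus>\<^bsub>R\<^esub>j\<in>{..m}. z [^]\<^bsub>R\<^esub> Suc j \<otimes>\<^bsub>R\<^esub> ?V (\<alpha> (Suc j))"
    let ?T' = "\<Oplus>\<^bsub>R\<^esub>j\<in>{..m}. z [^]\<^bsub>R\<^esub> j \<otimes>\<^bsub>R\<^esub> ?V (\<alpha> (Suc j))"
    have T: "?T \<in> Q"
      by (rule R.finsum_in_additive_subgroup[OF Q.is_additive_subgroup], rule Qz) (use V in auto)
    have T': "?T' \<in> carrier R" using V pc by (intro R.finsum_closed) (auto intro: mult_closed)
    have sum: "(\<Oplus>\<^bsub>R\<^esub>j\<in>{..Suc m}. z [^]\<^bsub>R\<^esub> j \<otimes>\<^bsub>R\<^esub> ?V (\<alpha> j)) = ?T \<oplus>\<^bsub>R\<^esub> ?V (\<alpha> 0)"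
      using V pc by (subst R.finsum_Suc2) (auto intro: mult_closed)
    then have *: "?T \<oplus>\<^bsub>R\<^esub> ?V (\<alpha> 0) \<in> P" using Suc.prems(2) by (simp only:)
    then have "?T \<oplus>\<^bsub>R\<^esub> ?V (\<alpha> 0) \<ominus>\<^bsub>R\<^esub> ?T \<in> Q"
      using T \<open>P \<subseteq> Q\<close> by (intro R.left_idealD(5)[OF R.ideal_imp_left_ideal[OF Q.is_ideal]]) auto
    also have "?T \<oplus>\<^bsub>R\<^esub> ?V (\<alpha> 0) \<ominus>\<^bsub>R\<^esub> ?T = ?V (\<alpha> 0)"
      using V[of 0] Q.Icarr[OF T] by (simp add: R.minus_eq R.a_ac R.r_neg R.r_neg2)
    finally have "?V (\<alpha> 0) \<in> Q" .
    then have 0: "\<forall>i\<in>I. \<alpha> 0 i = \<zero>\<^bsub>K\<^esub>"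
      using w(3) Suc.prems(1) unfolding indep_def by auto
    have "?V (\<alpha> 0) = \<zero>\<^bsub>R\<^esub>"
      using w 0 by (intro R.add.finprod_one_eqI) (simp add: mon_zero zero_mult)
    then have "?T \<in> P" using * Q.Icarr[OF T] by simp
    also have "?T = (\<Oplus>\<^bsub>R\<^esub>j\<in>{..m}. z \<otimes>\<^bsub>R\<^esub> (z [^]\<^bsub>R\<^esub> j \<otimes>\<^bsub>R\<^esub> ?V (\<alpha> (Suc j))))"
    proof (rule R.finsum_cong')
      fix j assume "j \<in> {..m}"
      then show "z [^]\<^bsub>R\<^esub> Suc j \<otimes>\<^bsub>R\<^esub> ?V (\<alpha> (Suc j)) = z \<otimes>\<^bsub>R\<^esub> (z [^]\<^bsub>R\<^esub> j \<otimes>\<^bsub>R\<^esub> ?V (\<alpha> (Suc j)))"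
        unfolding R.nat_pow_Suc2[OF zc] using zc pc V[of "Suc j"] by (intro mult_assoc) auto
    qed (use V pc zc in \<open>auto intro: mult_closed\<close>)
    also have "\<dots> = z \<otimes>\<^bsub>R\<^esub> ?T'"
      using V pc zc by (intro R.finsum_rdistr[symmetric]) (auto intro: mult_closed)
    finally have "?T' \<in> P" using P.cancel \<open>z \<in> B\<close> \<open>z \<notin> P\<close> T' by blast
    then have "\<forall>j\<le>m. \<forall>i\<in>I. \<alpha> (Suc j) i = \<zero>\<^bsub>K\<^esub>"
      using Suc.prems(1) by (intro Suc.IH[of "\<lambda>j. \<alpha> (Suc j)"]) auto
    with 0 show ?case by (metis Suc_le_mono not0_implies_Suc)
  qed
  show ?thesis
    unfolding indep_def
  proof (intro allI impI, elim conjE)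
    fix \<alpha> :: "nat list \<Rightarrow> 'k"
    let ?I = "\<Union>j\<in>{..m}. (#) j ` I"
    let ?t = "\<lambda>l. mon (\<alpha> l) \<one>\<^bsub>M\<^esub> \<otimes>\<^bsub>R\<^esub> cons_family z w l"
    assume \<alpha>: "\<forall>i\<in>?I. \<alpha> i \<in> carrier K" and P: "(\<Oplus>\<^bsub>R\<^esub>l\<in>?I. ?t l) \<in> P"
    have \<alpha>': "\<alpha> (j # i) \<in> carrier K" if "j \<le> m" "i \<in> I" for j i using \<alpha> that by blast
    have pc: "z [^]\<^bsub>R\<^esub> (j::nat) \<in> carrier R" for j using zc by simp
    have tc: "?t (j # i) \<in> carrier R" if "j \<le> m" "i \<in> I" for j i
      using \<alpha>'[OF that] w(1)[OF that(2)] pc by (auto simp: cons_family_def intro!: mult_closed)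
    have "(\<Oplus>\<^bsub>R\<^esub>l\<in>?I. ?t l) = (\<Oplus>\<^bsub>R\<^esub>j\<in>{..m}. \<Oplus>\<^bsub>R\<^esub>l\<in>(#) j ` I. ?t l)"
      using tc w(2) by (intro R.add.finprod_UN_disjoint) (auto simp: pairwise_def disjnt_def)
    also have "\<dots> = (\<Oplus>\<^bsub>R\<^esub>j\<in>{..m}. z [^]\<^bsub>R\<^esub> j \<otimes>\<^bsub>R\<^esub> ?V (\<lambda>i. \<alpha> (j # i)))"
    proof (rule R.finsum_cong')
      fix j assume j: "j \<in> {..m}"
      have "(\<Oplus>\<^bsub>R\<^esub>l\<in>(#) j ` I. ?t l) = (\<Oplus>\<^bsub>R\<^esub>i\<in>I. ?t (j # i))"
        using tc j by (intro R.finsum_reindex) (auto simp: inj_on_def)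
      also have "\<dots> = (\<Oplus>\<^bsub>R\<^esub>i\<in>I. z [^]\<^bsub>R\<^esub> j \<otimes>\<^bsub>R\<^esub> (mon (\<alpha> (j # i)) \<one>\<^bsub>M\<^esub> \<otimes>\<^bsub>R\<^esub> w i))"
      proof (rule R.finsum_cong')
        fix i assume i: "i \<in> I"
        have "mon (\<alpha> (j # i)) \<one>\<^bsub>M\<^esub> \<otimes>\<^bsub>R\<^esub> z [^]\<^bsub>R\<^esub> j = z [^]\<^bsub>R\<^esub> j \<otimes>\<^bsub>R\<^esub> mon (\<alpha> (j # i)) \<one>\<^bsub>M\<^esub>"
          using i j \<alpha>' pc one_center by (intro central_mon) auto
        then show "?t (j # i) = z [^]\<^bsub>R\<^esub> j \<otimes>\<^bsub>R\<^esub> (mon (\<alpha> (j # i)) \<one>\<^bsub>M\<^esub> \<otimes>\<^bsub>R\<^esub> w i)"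
          using i j \<alpha>' pc w(1) by (simp add: cons_family_def flip: mult_assoc)
      qed (use \<alpha>' j pc w(1) in \<open>auto intro!: mult_closed\<close>)
      also have "\<dots> = z [^]\<^bsub>R\<^esub> j \<otimes>\<^bsub>R\<^esub> ?V (\<lambda>i. \<alpha> (j # i))"
        using \<alpha>' j pc w by (intro R.finsum_rdistr[symmetric]) (auto intro!: mult_closed)
      finally show "(\<Oplus>\<^bsub>R\<^esub>l\<in>(#) j ` I. ?t l) = z [^]\<^bsub>R\<^esub> j \<otimes>\<^bsub>R\<^esub> ?V (\<lambda>i. \<alpha> (j # i))" .
    qed (use \<alpha>' pc in \<open>auto intro!: mult_closed Vc\<close>)
    finally have "(\<Oplus>\<^bsub>R\<^esub>j\<in>{..m}. z [^]\<^bsub>R\<^esub> j \<otimes>\<^bsub>R\<^esub> ?V (\<lambda>i. \<alpha> (j # i))) \<in> P" using P by simp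
    from key[OF \<alpha>' this] show "\<forall>i\<in>?I. \<alpha> i = \<zero>\<^bsub>K\<^esub>" by auto
  qed
qed

text \<open>Choose a central \<open>z i\<close> in \<open>Pr (Suc i)\<close> outside
  \<open>Pr i\<close>. Descending the chain with \<open>indep_step\<close>, the (m + 1)^n monomials
  in these elements with exponents at most m are independent modulo \<open>Pr 0\<close>, and they
  live in a ball of radius proportional to m.\<close>

lemma prime_chain_growth:
  assumes B: "subring B R" "B \<subseteq> mult_center R" "finite_module_over B R"
    and chain: "\<And>i. i \<le> n \<Longrightarrow> nc_prime_ideal (Pr i) R" "\<And>i. i < n \<Longrightarrow> Pr i \<subset> Pr (Suc i)"
  shows "\<exists>L. \<forall>m. (m + 1) ^ n \<le> card (E (L * m))"
proof -
  have po: "prime_over_center R B (Pr i)" if "i \<le> n" for i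
    by (intro prime_over_center.intro prime_over_center_axioms.intro ring_R)
       (use B chain(1)[OF that] in \<open>auto simp: mult_center_def\<close>)
  have id: "ideal (Pr i) R" if "i \<le> n" for i using chain(1)[OF that] by (simp add: nc_prime_ideal_def)
  have "\<exists>z\<in>B. z \<in> Pr (Suc i) \<and> z \<notin> Pr i" if "i < n" for i
    by (rule prime_over_center.central_element_outside_prime[OF po id]) (use that chain(2) in auto)
  then obtain z where z: "\<And>i. i < n \<Longrightarrow> z i \<in> B" "\<And>i. i < n \<Longrightarrow> z i \<in> Pr (Suc i)"
      "\<And>i. i < n \<Longrightarrow> z i \<notin> Pr i" by metis
  have zc: "z i \<in> carrier R" if "i < n" for i using subringE(1)[OF B(1)] z(1)[OF that] by blast
  then have "\<forall>i. \<exists>m. i < n \<longrightarrow> z i \<in> W (E m)" using in_W_E by blast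
  from choice[OF this] obtain L0 where L0: "\<And>i. i < n \<Longrightarrow> z i \<in> W (E (L0 i))" by blast
  define L where "L = (\<Sum>i<n. L0 i)"
  have zL: "z i \<in> W (E L)" if "i < n" for i
    using L0[OF that] mono_W_E[of "L0 i" L] member_le_sum[of i "{..<n}" L0] that
    by (auto simp: L_def)
  have "(m + 1) ^ n \<le> card (E (L * n * m))" for m
  proof -
    define Il where "Il j = {l. set l \<subseteq> {..m} \<and> length l = j}" for j
    have fin: "finite (Il j)" for j unfolding Il_def by (rule finite_lists_length_eq) simp
    have Suc_Il: "Il (Suc j) = (\<Union>i\<in>{..m}. (#) i ` Il j)" for j
      by (auto simp: Il_def length_Suc_conv)
    have "\<exists>w. (\<forall>l\<in>Il j. w l \<in> W (E (L * j * m))) \<and> indep (Pr (n - j)) (Il j) w" if "j \<le> n" for j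
      using that
    proof (induction j)
      \<comment> \<open>The chain is entered at the top: 1 is independent modulo
        \<open>Pr n\<close>, because a proper ideal contains no nonzero scalar.\<close>
      case 0
      have Il0: "Il 0 = {[]}" by (auto simp: Il_def)
      have "c = \<zero>\<^bsub>K\<^esub>" if c: "c \<in> carrier K" "mon c \<one>\<^bsub>M\<^esub> \<in> Pr n" for c
      proof (rule ccontr)
        assume "c \<noteq> \<zero>\<^bsub>K\<^esub>"
        then have u: "c \<in> Units K" using c K.field_Units by simp
        then have "mon (inv\<^bsub>K\<^esub> c) \<one>\<^bsub>M\<^esub> \<otimes>\<^bsub>R\<^esub> mon c \<one>\<^bsub>M\<^esub> = \<one>\<^bsub>R\<^esub>"
          using c by (simp add: mon_mult one_eq)
        then have "\<one>\<^bsub>R\<^esub> \<in> Pr n"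
          using ideal.I_l_closed[OF id[OF le_refl] c(2), of "mon (inv\<^bsub>K\<^esub> c) \<one>\<^bsub>M\<^esub>"] u by simp
        then show False using prime_over_center.one_notin[OF po] by blast
      qed
      moreover have "(\<Oplus>\<^bsub>R\<^esub>i\<in>{[]}. mon (\<alpha> i) \<one>\<^bsub>M\<^esub> \<otimes>\<^bsub>R\<^esub> \<one>\<^bsub>R\<^esub>) = mon (\<alpha> []) \<one>\<^bsub>M\<^esub>"
        if "\<alpha> [] \<in> carrier K" for \<alpha> :: "nat list \<Rightarrow> 'k"
        using that by (simp add: R.finsum_insert)
      ultimately have "indep (Pr n) (Il 0) (\<lambda>_. \<one>\<^bsub>R\<^esub>)"
        unfolding Il0 indep_def by auto
      then show ?case using one_W_E by (intro exI[of _ "\<lambda>_. \<one>\<^bsub>R\<^esub>"]) simp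
    next
      case (Suc j)
      then obtain w where w: "\<forall>l\<in>Il j. w l \<in> W (E (L * j * m))" "indep (Pr (n - j)) (Il j) w" by auto
      define i where "i = n - Suc j"
      have i: "i < n" "n - j = Suc i" using Suc.prems by (auto simp: i_def)
      have "indep (Pr i) (\<Union>a\<in>{..m}. (#) a ` Il j) (cons_family (z i) w)"
      proof (rule indep_step[OF po id])
        show "indep (Pr (Suc i)) (Il j) w" using w(2) i by simp
        show "w l \<in> carrier R" if "l \<in> Il j" for l using w(1) W_carrier that by blast
      qed (use i z chain(2)[of i] fin in auto)
      then have "indep (Pr (n - Suc j)) (Il (Suc j)) (cons_family (z i) w)"
        unfolding Suc_Il i_def .
      moreover have "cons_family (z i) w l \<in> W (E (L * Suc j * m))" if lj: "l \<in> Il (Suc j)" for l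
      proof -
        obtain a l' where l: "l = a # l'" "a \<le> m" "l' \<in> Il j" using lj unfolding Suc_Il by auto
        have "cons_family (z i) w l \<in> W (E (a * L + L * j * m))"
          unfolding cons_family_def l(1) list.sel using w(1) l zL[OF i(1)] by (intro mult_W_E pow_W_E) auto
        moreover have "a * L + L * j * m \<le> L * Suc j * m"
          using l(2) by (simp add: algebra_simps)
        ultimately show ?thesis using mono_W_E by blast
      qed
      ultimately show ?case by blast
    qed
    from this[of n] obtain w where w: "\<forall>l\<in>Il n. w l \<in> W (E (L * n * m))" "indep (Pr 0) (Il n) w" by auto
    have "card (Il n) \<le> card (E (L * n * m))"
      by (rule card_indep_le[OF w(2) _ fin finite_E])
         (use w(1) additive_subgroup.zero_closed[OF ideal.axioms(1)[OF id]] in auto)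
    moreover have "card (Il n) = (m + 1) ^ n"
      unfolding Il_def by (subst card_lists_length_eq) simp_all
    ultimately show ?thesis by simp
  qed
  then show ?thesis by (intro exI[of _ "L * n"]) auto
qed

end

section \<open>Gelfand--Kirillov dimension and primes from faces\<close>

lemma tendsto_ln_ratio: "(\<lambda>n::nat. ereal (a / ln (real n) + b)) \<longlonglongrightarrow> ereal b"
proof -
  have "filterlim (\<lambda>n::nat. ln (real n)) at_infinity sequentially"
    by (intro filterlim_at_top_imp_at_infinity filterlim_compose[OF ln_at_top filterlim_real_sequentially])
  then have "(\<lambda>n::nat. a / ln (real n)) \<longlonglongrightarrow> 0"
    by (rule tendsto_divide_0[OF tendsto_const])
  from tendsto_add[OF this tendsto_const[of b]] show ?thesis by simp
qed

context filtered_monoid_alg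
begin

lemma subalgebra_growth_space: "V \<subseteq> carrier R \<Longrightarrow> subalgebra k (growth_space k R V n) R"
proof -
  assume V: "V \<subseteq> carrier R"
  let ?F = "{U. subalgebra k U R \<and> {foldr (\<otimes>\<^bsub>R\<^esub>) vs \<one>\<^bsub>R\<^esub> | vs. set vs \<subseteq> V \<and> length vs \<le> n} \<subseteq> U}"
  have "foldr (\<otimes>\<^bsub>R\<^esub>) vs \<one>\<^bsub>R\<^esub> \<in> carrier R" if "set vs \<subseteq> V" for vs
    using that V by (induction vs) auto
  then have "carrier R \<in> ?F"
    using R.carrier_is_subalgebra[of k] subfield.axioms(1)[OF subfield_scalars]
      subfieldE(3)[OF subfield_scalars] by auto
  moreover have "subgroup (\<Inter>?F) (add_monoid R)"
    by (rule R.add.subgroups_Inter) (use \<open>carrier R \<in> ?F\<close> in \<open>auto simp: subalgebra_def\<close>)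
  ultimately show ?thesis
    by (auto simp: growth_space_def subalgebra_def subalgebra_axioms_def)
qed

lemma foldr_W_E: "set vs \<subseteq> W (E L) \<Longrightarrow> length vs \<le> n \<Longrightarrow> foldr (\<otimes>\<^bsub>R\<^esub>) vs \<one>\<^bsub>R\<^esub> \<in> W (E (L * n))"
proof (induction vs arbitrary: n)
  case Nil
  then show ?case using one_W_E mono_W_E[of 0 "L * n"] by auto
next
  case (Cons v vs)
  then obtain n' where n: "n = Suc n'" by (cases n) auto
  then have "v \<otimes>\<^bsub>R\<^esub> foldr (\<otimes>\<^bsub>R\<^esub>) vs \<one>\<^bsub>R\<^esub> \<in> W (E (L + L * n'))"
    using Cons by (intro mult_W_E) auto
  then show ?case by (simp add: n)
qed

lemma growth_space_subset: "V \<subseteq> W (E L) \<Longrightarrow> growth_space k R V n \<subseteq> W (E (L * n))"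
  unfolding growth_space_def using foldr_W_E[of _ L n] subalgebra_W
  by (intro Inter_lower) (auto simp: subset_iff)

lemma dim_le_card:
  assumes "subalgebra k V R" "V \<subseteq> W T" "finite T" "T \<subseteq> carrier M"
  shows "R.dim k V \<le> card T"
proof -
  have d: "R.dimension (card T) k (W T)" by (rule dimension_W) fact+
  have "R.finite_dimension k V"
    by (rule R.subalbegra_incl_imp_finite_dimension[OF subfield_scalars R.finite_dimensionI[OF d] assms(1,2)])
  then have dV: "R.dimension (R.dim k V) k V"
    using R.finite_dimensionE[OF subfield_scalars] by (simp add: over_def)
  from R.exists_base[OF subfield_scalars dV] obtain Vs
    where Vs: "set Vs \<subseteq> carrier R" "R.independent k Vs" "length Vs = R.dim k V" "R.Span k Vs = V" by blast
  have "set Vs \<subseteq> V" using R.Span_base_incl[OF subfield_scalars Vs(1)] Vs(4) by simp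
  with R.independent_length_le_dimension[OF subfield_scalars d Vs(2)] assms(2) Vs(3) show ?thesis by simp
qed

lemma finite_dimension_subset_W_E:
  assumes "R.finite_dimension k V"
  shows "\<exists>L. V \<subseteq> W (E L)"
proof -
  obtain n where "R.dimension n k V" using assms by blast
  from R.exists_base[OF subfield_scalars this] obtain Vs
    where Vs: "set Vs \<subseteq> carrier R" "R.Span k Vs = V" by blast
  have "\<exists>L. set Vs \<subseteq> W (E L)"
    using Vs(1)
  proof (induction Vs)
    case (Cons v Vs)
    then obtain L where L: "set Vs \<subseteq> W (E L)" by auto
    obtain L' where L': "v \<in> W (E L')" using in_W_E Cons.prems by auto
    have "W (E L) \<subseteq> W (E (max L L'))" "W (E L') \<subseteq> W (E (max L L'))" by (simp_all add: mono_W_E)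
    then show ?case using L L' by (intro exI[of _ "max L L'"]) auto
  qed simp
  then show ?thesis using R.subalgebra_Span_incl[OF subfield_scalars subalgebra_W] Vs(2) by blast
qed

text \<open>A monomial on an element of E n is a scalar times a product of at most n monomials on
  elements of E 1, and such monomials span \<open>W (E n)\<close>.\<close>

lemma growth_space_E1: "growth_space k R (W (E 1)) n = W (E n)"
proof
  show "growth_space k R (W (E 1)) n \<subseteq> W (E n)"
    using growth_space_subset[of "W (E 1)" 1 n] by simp
  show "W (E n) \<subseteq> growth_space k R (W (E 1)) n"
    unfolding growth_space_def
  proof (intro Inter_greatest subsetI, elim CollectE conjE)
    fix U f
    assume U: "subalgebra k U R"
      "{foldr (\<otimes>\<^bsub>R\<^esub>) vs \<one>\<^bsub>R\<^esub> | vs. set vs \<subseteq> W (E 1) \<and> length vs \<le> n} \<subseteq> U" and f: "f \<in> W (E n)"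
    have Uadd: "\<And>x y. x \<in> U \<Longrightarrow> y \<in> U \<Longrightarrow> x \<oplus>\<^bsub>R\<^esub> y \<in> U" "\<zero>\<^bsub>R\<^esub> \<in> U"
      using subgroup.m_closed[OF subalgebra.axioms(1)[OF U(1)]]
        subgroup.one_closed[OF subalgebra.axioms(1)[OF U(1)]] by auto
    have "f \<in> carrier R" using f W_carrier by blast
    then show "f \<in> U"
    proof (induction f rule: monoid_algebra_induct)
      case (mon c a)
      then have "a \<in> E n" using f by (auto simp: W_def)
      then obtain as where as: "set as \<subseteq> E 1" "length as \<le> n" "foldr (\<otimes>\<^bsub>M\<^esub>) as \<one>\<^bsub>M\<^esub> = a"
        using gen_E by blast
      have "foldr (\<otimes>\<^bsub>R\<^esub>) (map (mon \<one>\<^bsub>K\<^esub>) as) \<one>\<^bsub>R\<^esub> = mon \<one>\<^bsub>K\<^esub> (foldr (\<otimes>\<^bsub>M\<^esub>) as \<one>\<^bsub>M\<^esub>) \<and>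
          foldr (\<otimes>\<^bsub>M\<^esub>) as \<one>\<^bsub>M\<^esub> \<in> carrier M"
        using as(1)
      proof (induction as)
        case (Cons a as)
        moreover have "a \<in> carrier M" using Cons.prems E_carrier by auto
        ultimately show ?case by (simp add: mon_mult)
      qed (simp add: one_eq)
      moreover have "foldr (\<otimes>\<^bsub>R\<^esub>) (map (mon \<one>\<^bsub>K\<^esub>) as) \<one>\<^bsub>R\<^esub> \<in> U"
      proof -
        have "mon \<one>\<^bsub>K\<^esub> a \<in> W (E 1)" if "a \<in> set as" for a
          using that as(1) E_carrier[of 1] supp_mon[of "\<one>\<^bsub>K\<^esub>" a] by (auto simp: W_def)
        then have "set (map (mon \<one>\<^bsub>K\<^esub>) as) \<subseteq> W (E 1)" by auto
        then have "foldr (\<otimes>\<^bsub>R\<^esub>) (map (mon \<one>\<^bsub>K\<^esub>) as) \<one>\<^bsub>R\<^esub> \<in>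
            {foldr (\<otimes>\<^bsub>R\<^esub>) vs \<one>\<^bsub>R\<^esub> | vs. set vs \<subseteq> W (E 1) \<and> length vs \<le> n}"
          using as(2) by (intro CollectI exI[of _ "map (mon \<one>\<^bsub>K\<^esub>) as"]) simp
        with U(2) show ?thesis by (rule subsetD)
      qed
      ultimately have "mon \<one>\<^bsub>K\<^esub> a \<in> U" using as(3) by simp
      then have "mon c \<one>\<^bsub>M\<^esub> \<otimes>\<^bsub>R\<^esub> mon \<one>\<^bsub>K\<^esub> a \<in> U"
        using mon by (intro subalgebra.smult_closed[OF U(1)]) (auto simp: scalars_eq)
      then show ?case using mon by (simp add: mon_mult)
    qed (use Uadd in auto)
  qed
qed

text \<open>For the upper bound every finite-dimensional V sits in some \<open>W (E l)\<close>; for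
  the lower bound V = \<open>W (E 1)\<close> is used. Constant factors disappear in the quotient of
  logarithms.\<close>

theorem GKdim_eq:
  assumes up: "\<And>n. card (E n) \<le> c * (n + 1) ^ q"
    and low: "\<And>m. (m + 1) ^ q \<le> card (E (L * m))" and "L > 0"
  shows "GKdim k R = ereal (real q)"
  unfolding GKdim_def
proof (rule antisym)
  show "(SUP V \<in> {V. subalgebra k V R \<and> R.finite_dimension k V}.
      limsup (\<lambda>n. ereal (ln (real (R.dim k (growth_space k R V n))) / ln (real n)))) \<le> ereal (real q)"
  proof (rule SUP_least, elim CollectE conjE)
    fix V assume V: "subalgebra k V R" "R.finite_dimension k V"
    obtain l where l: "V \<subseteq> W (E l)" using finite_dimension_subset_W_E V(2) by blast
    \<comment> \<open>For n \<ge> 2 one has l n + 1 \<le> 2 (l + 1) n. The added 1 makes C at least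
      1, so that the logarithm of the bound is nonnegative and also covers dimension 0.\<close>
    define C where "C = real (c * (2 * (l + 1)) ^ q + 1)"
    have C: "C \<ge> 1" by (simp add: C_def)
    have "ln (real (R.dim k (growth_space k R V n))) / ln (real n) \<le> ln C / ln (real n) + q"
      if "n \<ge> 2" for n
    proof -
      let ?d = "R.dim k (growth_space k R V n)"
      have "?d \<le> card (E (l * n))"
        using growth_space_subset[OF l] subalgebra_growth_space l W_carrier finite_E E_carrier
        by (intro dim_le_card) blast+
      also have "\<dots> \<le> c * (l * n + 1) ^ q" by (rule up)
      also have "\<dots> \<le> c * (2 * (l + 1) * n) ^ q"
        using that by (intro mult_left_mono power_mono) (auto simp: algebra_simps)
      also have "\<dots> = c * (2 * (l + 1)) ^ q * n ^ q" by (simp only: power_mult_distrib mult.assoc)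
      also have "\<dots> \<le> (c * (2 * (l + 1)) ^ q + 1) * n ^ q" by (rule mult_right_mono) simp_all
      finally have "real ?d \<le> C * real n ^ q"
        unfolding C_def by (simp only: of_nat_mult[symmetric] of_nat_power[symmetric] of_nat_le_iff)
      moreover have "C * real n ^ q \<ge> 1"
        using C that mult_mono[of 1 C 1 "real n ^ q"] by (simp add: one_le_power)
      ultimately have "ln (real ?d) \<le> ln (C * real n ^ q)"
        by (cases "?d = 0") auto
      also have "\<dots> = ln C + q * ln (real n)"
        using C that by (subst ln_mult) (auto simp: ln_realpow)
      finally show ?thesis using that by (simp add: field_simps)
    qed
    then have "limsup (\<lambda>n. ereal (ln (real (R.dim k (growth_space k R V n))) / ln (real n)))
        \<le> limsup (\<lambda>n. ereal (ln C / ln (real n) + q))"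
      by (intro Limsup_mono) (auto simp: eventually_sequentially)
    also have "\<dots> = ereal q"
      by (intro lim_imp_Limsup tendsto_ln_ratio) simp
    finally show "limsup (\<lambda>n. ereal (ln (real (R.dim k (growth_space k R V n))) / ln (real n))) \<le> ereal q" .
  qed
  have dim: "R.dim k (W (E n)) = card (E n)" for n
    using R.dimI[OF subfield_scalars dimension_W[OF finite_E E_carrier]] by (simp add: over_def)
  have "- (q * ln L) / ln (real n) + q \<le> ln (real (R.dim k (growth_space k R (W (E 1)) n))) / ln (real n)"
    if "n \<ge> 2" for n
  proof -
    \<comment> \<open>The lower bound is known only along multiples of L; rounding n down costs at
      most the constant q ln L after taking logarithms.\<close>
    have "real n \<le> real L * real (n div L + 1)"
    proof -
      have "n \<le> L * (n div L + 1)" 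
        using mult_div_mod_eq[of L n] mod_less_divisor[OF \<open>L > 0\<close>, of n]
        unfolding distrib_left mult_1_right by linarith
      then show ?thesis by (simp only: of_nat_mult[symmetric] of_nat_le_iff)
    qed
    then have "real n / L \<le> real (n div L + 1)" using \<open>L > 0\<close> by (simp add: field_simps)
    then have "(real n / L) ^ q \<le> real (n div L + 1) ^ q" by (rule power_mono) simp
    also have "\<dots> \<le> real (card (E (L * (n div L))))"
      using low[of "n div L"] by (simp only: of_nat_power[symmetric] of_nat_le_iff)
    also have "\<dots> \<le> real (card (E n))"
      using card_mono[OF finite_E mono_E[of "L * (n div L)" n]] by simp
    finally have le: "(real n / L) ^ q \<le> real (card (E n))" .
    have "0 < (real n / L) ^ q" using that \<open>L > 0\<close> by simp
    with le have "ln ((real n / L) ^ q) \<le> ln (real (card (E n)))"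
      by (subst ln_le_cancel_iff) linarith+
    moreover have "ln ((real n / L) ^ q) = q * ln (real n) - q * ln L"
      using that \<open>L > 0\<close> by (simp add: ln_realpow ln_div algebra_simps)
    ultimately have le: "q * ln (real n) - q * ln L \<le> ln (real (card (E n)))" by simp
    have pos: "ln (real n) > 0" using that by simp
    then have "- (q * ln L) / ln (real n) + q = (q * ln (real n) - q * ln L) / ln (real n)"
      by (simp add: diff_divide_distrib)
    also have "\<dots> \<le> ln (real (card (E n))) / ln (real n)"
      using le pos by (intro divide_right_mono) auto
    finally show ?thesis unfolding growth_space_E1 dim .
  qed
  then have "limsup (\<lambda>n. ereal (- (q * ln L) / ln (real n) + q))
      \<le> limsup (\<lambda>n. ereal (ln (real (R.dim k (growth_space k R (W (E 1)) n))) / ln (real n)))"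
    by (intro Limsup_mono) (auto simp: eventually_sequentially)
  moreover have "limsup (\<lambda>n. ereal (- (q * ln L) / ln (real n) + q)) = ereal q"
    by (intro lim_imp_Limsup tendsto_ln_ratio) simp
  moreover have "W (E 1) \<in> {V. subalgebra k V R \<and> R.finite_dimension k V}"
    using subalgebra_W R.finite_dimensionI[OF dimension_W[OF finite_E E_carrier]] by simp
  ultimately show "ereal (real q) \<le> (SUP V \<in> {V. subalgebra k V R \<and> R.finite_dimension k V}.
      limsup (\<lambda>n. ereal (ln (real (R.dim k (growth_space k R V n))) / ln (real n))))"
    by (intro SUP_upper2[of "W (E 1)"]) auto
qed

end

section \<open>Prime ideals from faces of the monoid\<close>

definition add_monoid_of :: "'a::monoid_add itself \<Rightarrow> 'a monoid" where
  "add_monoid_of _ = \<lparr>carrier = UNIV, monoid.mult = (+), one = 0\<rparr>"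

lemma monoid_add_monoid_of: "monoid (add_monoid_of TYPE('a::monoid_add))"
  by (rule monoidI) (auto simp: add_monoid_of_def add.assoc)

text \<open>The coefficient at the sum of the largest exponents of f and g is the product of the two
  leading coefficients: strict monotonicity of addition allows no other pair with that sum.\<close>

lemma ordered_monoid_algebra_integral:
  fixes f g :: "'b::{linordered_cancel_ab_semigroup_add, comm_monoid_add} \<Rightarrow> 'k"
  assumes "field K" and f: "f \<in> carrier (monoid_algebra K (add_monoid_of TYPE('b)))" "f \<noteq> (\<lambda>_. \<zero>\<^bsub>K\<^esub>)"
    and g: "g \<in> carrier (monoid_algebra K (add_monoid_of TYPE('b)))" "g \<noteq> (\<lambda>_. \<zero>\<^bsub>K\<^esub>)"
  shows "f \<otimes>\<^bsub>monoid_algebra K (add_monoid_of TYPE('b))\<^esub> g \<noteq> (\<lambda>_. \<zero>\<^bsub>K\<^esub>)"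
proof -
  interpret monoid_alg K "add_monoid_of TYPE('b)"
    by (intro monoid_alg.intro assms(1) monoid_add_monoid_of)
  have ne: "supp f \<noteq> {}" "supp g \<noteq> {}" using f(2) g(2) by (auto simp: supp_def)
  have fin: "finite (supp f)" "finite (supp g)" using f(1) g(1) by (auto simp: carrier_iff)
  define a b where "a = Max (supp f)" and "b = Max (supp g)"
  have ab: "a \<in> supp f" "b \<in> supp g" using fin ne by (auto simp: a_def b_def)
  have "{p \<in> supp f \<times> supp g. fst p \<otimes>\<^bsub>add_monoid_of TYPE('b)\<^esub> snd p = a + b} = {(a, b)}"
  proof -
    have "x = a \<and> y = b" if "x \<in> supp f" "y \<in> supp g" "x + y = a + b" for x y
    proof -
      have "x \<le> a" "y \<le> b" using that fin by (auto simp: a_def b_def)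
      with that(3) show ?thesis
        by (metis add_le_less_mono add_less_le_mono order.strict_iff_order order_less_irrefl)
    qed
    then show ?thesis using ab by (auto simp: add_monoid_of_def)
  qed
  then have "(f \<otimes>\<^bsub>R\<^esub> g) (a + b) = f a \<otimes>\<^bsub>K\<^esub> g b"
    using mult_apply[OF f(1) g(1) fin subset_refl subset_refl, of "a + b"] f(1) g(1) by simp
  also have "\<dots> \<noteq> \<zero>\<^bsub>K\<^esub>"
    using ab f(1) g(1) K.integral by (auto simp: supp_def)
  finally show ?thesis by auto
qed

text \<open>A face \<open>D\<close> of the monoid together with a homomorphism from \<open>D\<close> to an ordered cancellative
  monoid; elements outside \<open>D\<close> are sent to zero.\<close>

locale monoid_alg_face = monoid_alg K M
  for K :: "('k, 'm) ring_scheme" and M :: "('a, 'n) monoid_scheme" +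
  fixes D :: "'a set" and \<theta> :: "'a \<Rightarrow> 'b::{linordered_cancel_ab_semigroup_add, comm_monoid_add}"
  assumes D_mult: "a \<in> carrier M \<Longrightarrow> b \<in> carrier M \<Longrightarrow> a \<otimes>\<^bsub>M\<^esub> b \<in> D \<longleftrightarrow> a \<in> D \<and> b \<in> D"
    and D_one: "\<one>\<^bsub>M\<^esub> \<in> D"
    and \<theta>_mult: "a \<in> carrier M \<Longrightarrow> b \<in> carrier M \<Longrightarrow> a \<in> D \<Longrightarrow> b \<in> D \<Longrightarrow> \<theta> (a \<otimes>\<^bsub>M\<^esub> b) = \<theta> a + \<theta> b"
    and \<theta>_one: "\<theta> \<one>\<^bsub>M\<^esub> = 0"
begin

abbreviation N where "N \<equiv> add_monoid_of TYPE('b)"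

sublocale N: monoid_alg K N
  by (intro monoid_alg.intro K.field_axioms monoid_add_monoid_of)

definition push :: "('a \<Rightarrow> 'k) \<Rightarrow> 'b \<Rightarrow> 'k" where
  "push f v = (\<Oplus>\<^bsub>K\<^esub>a\<in>{a \<in> supp f. a \<in> D \<and> \<theta> a = v}. f a)"

lemma push_eq:
  assumes "f \<in> carrier R" "finite T" "supp f \<subseteq> T"
  shows "push f v = (\<Oplus>\<^bsub>K\<^esub>a\<in>{a \<in> T. a \<in> D \<and> \<theta> a = v}. f a)"
  unfolding push_def
  by (rule K.add.finprod_mono_neutral_cong_left) (use assms in \<open>auto simp: supp_def\<close>)

lemma push_zero: "push \<zero>\<^bsub>R\<^esub> = \<zero>\<^bsub>N.R\<^esub>"
  by (auto simp: push_def supp_def zero_eq N.zero_eq)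

lemma push_add:
  assumes f: "f \<in> carrier R" "g \<in> carrier R"
  shows "push (f \<oplus>\<^bsub>R\<^esub> g) = push f \<oplus>\<^bsub>N.R\<^esub> push g"
proof
  fix v
  let ?T = "supp f \<union> supp g"
  let ?S = "{a \<in> ?T. a \<in> D \<and> \<theta> a = v}"
  have fin: "finite ?T" using f by (auto simp: carrier_iff)
  have "push (f \<oplus>\<^bsub>R\<^esub> g) v = (\<Oplus>\<^bsub>K\<^esub>a\<in>?S. (f \<oplus>\<^bsub>R\<^esub> g) a)"
    by (rule push_eq) (use f fin supp_add add_closed in auto)
  also have "\<dots> = (\<Oplus>\<^bsub>K\<^esub>a\<in>?S. f a \<oplus>\<^bsub>K\<^esub> g a)" by (simp add: add_apply)
  also have "\<dots> = (\<Oplus>\<^bsub>K\<^esub>a\<in>?S. f a) \<oplus>\<^bsub>K\<^esub> (\<Oplus>\<^bsub>K\<^esub>a\<in>?S. g a)"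
    by (rule K.finsum_addf) (use f in auto)
  also have "(\<Oplus>\<^bsub>K\<^esub>a\<in>?S. f a) = push f v" by (rule push_eq[symmetric]) (use f fin in auto)
  also have "(\<Oplus>\<^bsub>K\<^esub>a\<in>?S. g a) = push g v" by (rule push_eq[symmetric]) (use f fin in auto)
  finally show "push (f \<oplus>\<^bsub>R\<^esub> g) v = (push f \<oplus>\<^bsub>N.R\<^esub> push g) v" by (simp add: N.add_apply)
qed

lemma push_mon:
  assumes "c \<in> carrier K" "a \<in> carrier M"
  shows "push (mon c a) = (if a \<in> D then N.mon c (\<theta> a) else \<zero>\<^bsub>N.R\<^esub>)"
proof
  fix v
  have "push (mon c a) v = (\<Oplus>\<^bsub>K\<^esub>b\<in>{b \<in> {a}. b \<in> D \<and> \<theta> b = v}. mon c a b)"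
    by (rule push_eq) (use assms supp_mon in auto)
  also have "{b \<in> {a}. b \<in> D \<and> \<theta> b = v} = (if a \<in> D \<and> \<theta> a = v then {a} else {})" by auto
  finally show "push (mon c a) v = (if a \<in> D then N.mon c (\<theta> a) else \<zero>\<^bsub>N.R\<^esub>) v"
    using assms by (auto simp: mon_def N.mon_def N.zero_eq)
qed

lemma carrier_N: "v \<in> carrier N" by (simp add: add_monoid_of_def)

lemma push_closed: "f \<in> carrier R \<Longrightarrow> push f \<in> carrier N.R"
  by (induction f rule: monoid_algebra_induct)
     (auto simp: push_zero push_mon push_add N.zero_closed N.add_closed carrier_N)

text \<open>A product leaves D as soon as one factor does, so killing the elements outside D is
  compatible with multiplication; on D the map is induced by \<theta>.\<close>

lemma push_mult:
  assumes "f \<in> carrier R" "g \<in> carrier R"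
  shows "push (f \<otimes>\<^bsub>R\<^esub> g) = push f \<otimes>\<^bsub>N.R\<^esub> push g"
  using assms(1)
proof (induction f rule: monoid_algebra_induct)
  case zero
  then show ?case using assms(2) by (simp add: zero_mult push_zero N.zero_mult push_closed)
next
  case (add f1 f2)
  then show ?case using assms(2) by (simp add: mult_l_distr push_add N.mult_l_distr push_closed mult_closed)
next
  case (mon c a)
  show ?case
    using assms(2)
  proof (induction g rule: monoid_algebra_induct)
    case zero
    then show ?case using mon by (simp add: mult_zero push_zero N.mult_zero push_closed)
  next
    case (add f1 f2)
    then show ?case using mon by (simp add: mult_r_distr push_add N.mult_r_distr push_closed mult_closed)
  next
    case mon': (mon d b)
    then show ?case
      using mon by (auto simp: mon_mult push_mon D_mult \<theta>_mult N.mon_mult carrier_N N.zero_mult N.mult_zero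
        N.zero_closed) (auto simp: add_monoid_of_def)
  qed
qed

definition push_kernel :: "('a \<Rightarrow> 'k) set" where
  "push_kernel = {f \<in> carrier R. push f = \<zero>\<^bsub>N.R\<^esub>}"

text \<open>The target is the algebra of an ordered cancellative monoid and has no zero divisors. So
  the kernel is even completely prime, and primeness for products of ideals is checked on
  elements.\<close>

lemma nc_prime_push_kernel: "nc_prime_ideal push_kernel R"
proof -
  have one: "push \<one>\<^bsub>R\<^esub> \<noteq> \<zero>\<^bsub>N.R\<^esub>"
    using push_mon[of "\<one>\<^bsub>K\<^esub>" "\<one>\<^bsub>M\<^esub>"] D_one K.one_not_zero
    by (auto simp: one_eq N.zero_eq N.mon_def fun_eq_iff)
  have ideal: "ideal push_kernel R"
  proof (rule R.two_sided_idealI[OF R.left_idealI])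
    show "\<And>x a. x \<in> carrier R \<Longrightarrow> a \<in> push_kernel \<Longrightarrow> a \<otimes>\<^bsub>R\<^esub> x \<in> push_kernel"
      by (simp add: push_kernel_def push_mult N.zero_mult push_closed)
    show "\<And>x a. x \<in> carrier R \<Longrightarrow> a \<in> push_kernel \<Longrightarrow> x \<otimes>\<^bsub>R\<^esub> a \<in> push_kernel"
      by (simp add: push_kernel_def push_mult N.mult_zero push_closed)
    show "\<And>a b. a \<in> push_kernel \<Longrightarrow> b \<in> push_kernel \<Longrightarrow> a \<oplus>\<^bsub>R\<^esub> b \<in> push_kernel"
      by (simp add: push_kernel_def push_add)
  qed (auto simp: push_kernel_def push_zero)
  have cp: "f \<in> push_kernel \<or> g \<in> push_kernel"
    if "f \<in> carrier R" "g \<in> carrier R" "f \<otimes>\<^bsub>R\<^esub> g \<in> push_kernel" for f g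
  proof (rule ccontr)
    assume "\<not> (f \<in> push_kernel \<or> g \<in> push_kernel)"
    then have "push f \<noteq> (\<lambda>_. \<zero>\<^bsub>K\<^esub>)" "push g \<noteq> (\<lambda>_. \<zero>\<^bsub>K\<^esub>)"
      using that by (auto simp: push_kernel_def N.zero_eq)
    from ordered_monoid_algebra_integral[OF K.field_axioms push_closed[OF that(1)] this(1)
        push_closed[OF that(2)] this(2)]
    show False using that by (simp add: push_kernel_def push_mult N.zero_eq)
  qed
  show ?thesis
    unfolding nc_prime_ideal_def
  proof (intro conjI allI impI ideal)
    show "push_kernel \<noteq> carrier R" using one by (auto simp: push_kernel_def)
    fix I J assume IJ: "ideal I R \<and> ideal J R \<and> I \<cdot>\<^bsub>R\<^esub> J \<subseteq> push_kernel"
    show "I \<subseteq> push_kernel \<or> J \<subseteq> push_kernel"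
    proof (rule ccontr)
      assume "\<not> (I \<subseteq> push_kernel \<or> J \<subseteq> push_kernel)"
      then obtain f g where fg: "f \<in> I" "f \<notin> push_kernel" "g \<in> J" "g \<notin> push_kernel" by blast
      then have "f \<otimes>\<^bsub>R\<^esub> g \<in> push_kernel" using IJ ideal_prod.prod[of f I g J R] by blast
      moreover have "f \<in> carrier R" "g \<in> carrier R"
        using fg(1,3) IJ ideal.Icarr[of I R f] ideal.Icarr[of J R g] by blast+
      ultimately show False using cp fg by blast
    qed
  qed
qed

lemma mon_in_push_kernel:
  "c \<in> carrier K \<Longrightarrow> c \<noteq> \<zero>\<^bsub>K\<^esub> \<Longrightarrow> a \<in> carrier M \<Longrightarrow> mon c a \<in> push_kernel \<longleftrightarrow> a \<notin> D"
  by (auto simp: push_kernel_def push_mon N.zero_eq N.mon_def fun_eq_iff)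

end

text \<open>Within D, membership in D' is decided by the value of \<theta>. So the image for D' is
  the image for D with the coefficients off Q set to zero.\<close>

lemma push_kernel_mono:
  assumes "monoid_alg_face K M D \<theta>" "monoid_alg_face K M D' \<theta>" "D' = {a \<in> D. Q (\<theta> a)}"
  shows "monoid_alg_face.push_kernel K M D \<theta> \<subseteq> monoid_alg_face.push_kernel K M D' \<theta>"
proof -
  interpret A: monoid_alg_face K M D \<theta> by fact
  interpret A': monoid_alg_face K M D' \<theta> by fact
  have "A'.push f v = (if Q v then A.push f v else \<zero>\<^bsub>K\<^esub>)" for f v
  proof -
    have "{a \<in> A.supp f. a \<in> D' \<and> \<theta> a = v} = (if Q v then {a \<in> A.supp f. a \<in> D \<and> \<theta> a = v} else {})"
      using assms(3) by auto
    then show ?thesis by (simp add: A.push_def A'.push_def)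
  qed
  then show ?thesis by (auto simp: A.push_kernel_def A'.push_kernel_def A.N.zero_eq fun_eq_iff)
qed

section \<open>Polynomial identities\<close>

context ring
begin

definition wprod :: "(nat \<Rightarrow> 'a) \<Rightarrow> nat list \<Rightarrow> 'a" where
  "wprod a w = foldr (\<otimes>) (map a w) \<one>"

lemma wprod_simps [simp]: "wprod a [] = \<one>" "wprod a (i # w) = a i \<otimes> wprod a w"
  by (simp_all add: wprod_def)

lemma wprod_closed: "(\<And>i. i \<in> set w \<Longrightarrow> a i \<in> carrier R) \<Longrightarrow> wprod a w \<in> carrier R"
  by (induction w) auto

lemma wprod_upd_other: "j \<notin> set w \<Longrightarrow> wprod (a(j := y)) w = wprod a w"
  by (induction w) auto

lemma wprod_add:
  assumes "\<And>i. i \<in> set w \<Longrightarrow> a i \<in> carrier R" "distinct w" "j \<in> set w" "x \<in> carrier R" "y \<in> carrier R"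
  shows "wprod (a(j := x \<oplus> y)) w = wprod (a(j := x)) w \<oplus> wprod (a(j := y)) w"
  using assms
proof (induction w)
  case (Cons i w)
  have c: "wprod (a(j := z)) w \<in> carrier R" if "z \<in> carrier R" for z
    using that Cons.prems(1) by (intro wprod_closed) auto
  show ?case
  proof (cases "i = j")
    case True
    then have "j \<notin> set w" using Cons.prems by auto
    then have eq: "wprod (a(j := z)) (i # w) = z \<otimes> wprod a w" for z
      using True by (simp only: wprod_simps fun_upd_same wprod_upd_other[OF \<open>j \<notin> set w\<close>])
    have "wprod a w \<in> carrier R" using Cons.prems by (intro wprod_closed) auto
    then show ?thesis unfolding eq using Cons.prems by (intro l_distr)
  next
    case False
    then have eq: "wprod (a(j := z)) (i # w) = a i \<otimes> wprod (a(j := z)) w" for z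
      by (simp only: wprod_simps fun_upd_other[OF False])
    have IH: "wprod (a(j := x \<oplus> y)) w = wprod (a(j := x)) w \<oplus> wprod (a(j := y)) w"
      by (rule Cons.IH) (use Cons.prems False in auto)
    show ?thesis unfolding eq IH using c Cons.prems by (intro r_distr) auto
  qed
qed simp

lemma wprod_scale:
  assumes "\<And>i. i \<in> set w \<Longrightarrow> a i \<in> carrier R" "distinct w" "j \<in> set w" "b \<in> carrier R" "y \<in> carrier R"
    and "\<And>x. x \<in> carrier R \<Longrightarrow> b \<otimes> x = x \<otimes> b"
  shows "wprod (a(j := b \<otimes> y)) w = b \<otimes> wprod (a(j := y)) w"
  using assms(1-5)
proof (induction w)
  case (Cons i w)
  have c: "wprod (a(j := y)) w \<in> carrier R"
    using Cons.prems by (intro wprod_closed) auto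
  show ?case
  proof (cases "i = j")
    case True
    then have "j \<notin> set w" using Cons.prems by auto
    then have eq: "wprod (a(j := z)) (i # w) = z \<otimes> wprod a w" for z
      using True by (simp only: wprod_simps fun_upd_same wprod_upd_other[OF \<open>j \<notin> set w\<close>])
    have "wprod a w \<in> carrier R" using Cons.prems by (intro wprod_closed) auto
    then show ?thesis unfolding eq using Cons.prems by (intro m_assoc)
  next
    case False
    have ai: "a i \<in> carrier R" using Cons.prems by simp
    have eq: "wprod (a(j := z)) (i # w) = a i \<otimes> wprod (a(j := z)) w" for z
      by (simp only: wprod_simps fun_upd_other[OF False])
    have IH: "wprod (a(j := b \<otimes> y)) w = b \<otimes> wprod (a(j := y)) w"
      by (rule Cons.IH) (use Cons.prems False in auto)
    have "wprod (a(j := b \<otimes> y)) (i # w) = a i \<otimes> (b \<otimes> wprod (a(j := y)) w)"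
      unfolding eq IH ..
    also have "\<dots> = (a i \<otimes> b) \<otimes> wprod (a(j := y)) w" using c ai Cons.prems by (simp add: m_assoc)
    also have "\<dots> = b \<otimes> (a i \<otimes> wprod (a(j := y)) w)"
      unfolding assms(6)[OF ai, symmetric] using c ai Cons.prems by (intro m_assoc) auto
    finally show ?thesis unfolding eq .
  qed
qed simp

section \<open>The standard identity\<close>

definition psign :: "(nat \<Rightarrow> nat) \<Rightarrow> 'a" where "psign p = (if evenperm p then \<one> else \<ominus> \<one>)"

definition standard_poly :: "nat \<Rightarrow> (nat \<Rightarrow> 'a) \<Rightarrow> 'a" where
  "standard_poly N a = (\<Oplus>p\<in>{p. p permutes {..<N}}. psign p \<otimes> wprod a (map p [0..<N]))"

lemma psign_closed [simp]: "psign p \<in> carrier R" by (simp add: psign_def)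

lemma word_permutes:
  assumes "p permutes {..<N}"
  shows "distinct (map p [0..<N])" "set (map p [0..<N]) = {..<N}"
proof -
  show "distinct (map p [0..<N])"
    by (simp add: distinct_map permutes_inj_on[OF assms])
  show "set (map p [0..<N]) = {..<N}"
    using permutes_image[OF assms] by (simp add: atLeast0LessThan)
qed

text \<open>Composing with the transposition of the two equal arguments pairs each even permutation
  with an odd one of the same product and opposite sign. Pairing, unlike a sign change of the whole
  sum, also covers characteristic 2.\<close>

lemma standard_poly_alternating:
  assumes "\<And>i. i < N \<Longrightarrow> a i \<in> carrier R" "i < N" "j < N" "i \<noteq> j" "a i = a j"
  shows "standard_poly N a = \<zero>"
proof -
  let ?P = "{p. p permutes {..<N}}"
  let ?E = "{p \<in> ?P. evenperm p}" and ?O = "{p \<in> ?P. \<not> evenperm p}"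
  let ?\<tau> = "transpose i j"
  let ?t = "\<lambda>p. psign p \<otimes> wprod a (map p [0..<N])"
  have \<tau>: "?\<tau> permutes {..<N}" using assms(2,3) by (intro permutes_swap_id) auto
  have perm: "permutation p" if "p permutes {..<N}" for p
    using that by (auto simp: permutation_permutes)
  have ev: "evenperm (?\<tau> \<circ> p) \<longleftrightarrow> \<not> evenperm p" if "p permutes {..<N}" for p
    using evenperm_comp[OF perm[OF \<tau>] perm[OF that]] assms(4) by (simp add: evenperm_swap)
  have O: "?O = (\<lambda>p. ?\<tau> \<circ> p) ` ?E"
  proof (intro subset_antisym subsetI)
    fix p assume p: "p \<in> ?O"
    then have "?\<tau> \<circ> p \<in> ?E" using ev permutes_compose[OF _ \<tau>] by auto
    moreover have "p = ?\<tau> \<circ> (?\<tau> \<circ> p)" by (simp add: fun_eq_iff)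
    ultimately show "p \<in> (\<lambda>p. ?\<tau> \<circ> p) ` ?E" by blast
  qed (use ev permutes_compose[OF _ \<tau>] in auto)
  have inj: "inj_on (\<lambda>p. ?\<tau> \<circ> p) ?E"
    by (rule inj_on_inverseI[of _ "\<lambda>p. ?\<tau> \<circ> p"]) (simp add: fun_eq_iff)
  have wc: "wprod a (map p [0..<N]) \<in> carrier R" if "p permutes {..<N}" for p
    using word_permutes(2)[OF that] assms(1) by (intro wprod_closed) auto
  have tc: "?t p \<in> carrier R" if "p permutes {..<N}" for p using wc[OF that] by simp
  have fin: "finite ?P" by (simp add: finite_permutations)
  have a\<tau>: "a (?\<tau> n) = a n" for n using assms(5) by (simp add: transpose_def)
  have "standard_poly N a = (\<Oplus>p\<in>?E \<union> ?O. ?t p)"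
    unfolding standard_poly_def by (rule arg_cong[where f = "finsum R ?t"]) blast
  also have "\<dots> = (\<Oplus>p\<in>?E. ?t p) \<oplus> (\<Oplus>p\<in>?O. ?t p)"
    using fin tc by (intro finsum_Un_disjoint) auto
  also have "(\<Oplus>p\<in>?O. ?t p) = (\<Oplus>p\<in>?E. ?t (?\<tau> \<circ> p))"
    unfolding O using tc O by (intro finsum_reindex inj) blast
  also have "(\<Oplus>p\<in>?E. ?t p) \<oplus> (\<Oplus>p\<in>?E. ?t (?\<tau> \<circ> p)) = (\<Oplus>p\<in>?E. ?t p \<oplus> ?t (?\<tau> \<circ> p))"
    using tc permutes_compose[OF _ \<tau>] by (intro finsum_addf[symmetric]) blast+
  also have "\<dots> = \<zero>"
  proof (rule add.finprod_one_eqI)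
    fix p assume p: "p \<in> ?E"
    have "map a (map (?\<tau> \<circ> p) [0..<N]) = map a (map p [0..<N])" using a\<tau> by simp
    then have "wprod a (map (?\<tau> \<circ> p) [0..<N]) = wprod a (map p [0..<N])" by (simp only: wprod_def)
    moreover have "psign p = \<one>" "psign (?\<tau> \<circ> p) = \<ominus> \<one>" using p ev[of p] by (auto simp: psign_def)
    ultimately show "?t p \<oplus> ?t (?\<tau> \<circ> p) = \<zero>"
      using wc[of p] p by (simp only: mem_Collect_eq l_minus l_one one_closed r_neg)
  qed
  finally show ?thesis .
qed

lemma standard_poly_upd_additive:
  assumes "\<And>i. i < N \<Longrightarrow> a i \<in> carrier R" "j < N" "x \<in> carrier R" "y \<in> carrier R"
  shows "standard_poly N (a(j := x \<oplus> y)) = standard_poly N (a(j := x)) \<oplus> standard_poly N (a(j := y))"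
proof -
  have wc: "wprod (a(j := z)) (map p [0..<N]) \<in> carrier R" if "p permutes {..<N}" "z \<in> carrier R" for p z
    using word_permutes(2)[OF that(1)] assms(1) that(2) by (intro wprod_closed) auto
  have "standard_poly N (a(j := x \<oplus> y)) = (\<Oplus>p\<in>{p. p permutes {..<N}}.
      psign p \<otimes> wprod (a(j := x)) (map p [0..<N]) \<oplus> psign p \<otimes> wprod (a(j := y)) (map p [0..<N]))"
    unfolding standard_poly_def
  proof (rule finsum_cong')
    fix p assume "p \<in> {p. p permutes {..<N}}"
    then have p: "p permutes {..<N}" by simp
    have "wprod (a(j := x \<oplus> y)) (map p [0..<N])
        = wprod (a(j := x)) (map p [0..<N]) \<oplus> wprod (a(j := y)) (map p [0..<N])"
      using word_permutes[OF p] assms by (intro wprod_add) auto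
    then show "psign p \<otimes> wprod (a(j := x \<oplus> y)) (map p [0..<N]) =
        psign p \<otimes> wprod (a(j := x)) (map p [0..<N]) \<oplus> psign p \<otimes> wprod (a(j := y)) (map p [0..<N])"
      using wc[OF p] assms by (simp only: r_distr psign_closed)
  qed (use wc assms in auto)
  also have "\<dots> = standard_poly N (a(j := x)) \<oplus> standard_poly N (a(j := y))"
    unfolding standard_poly_def using wc assms by (intro finsum_addf) auto
  finally show ?thesis .
qed

lemma standard_poly_upd_scale:
  assumes "\<And>i. i < N \<Longrightarrow> a i \<in> carrier R" "j < N" "b \<in> carrier R" "y \<in> carrier R"
    and central: "\<And>x. x \<in> carrier R \<Longrightarrow> b \<otimes> x = x \<otimes> b"
  shows "standard_poly N (a(j := b \<otimes> y)) = b \<otimes> standard_poly N (a(j := y))"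
proof -
  have wc: "wprod (a(j := z)) (map p [0..<N]) \<in> carrier R" if "p permutes {..<N}" "z \<in> carrier R" for p z
    using word_permutes(2)[OF that(1)] assms(1) that(2) by (intro wprod_closed) auto
  have "standard_poly N (a(j := b \<otimes> y)) = (\<Oplus>p\<in>{p. p permutes {..<N}}.
      b \<otimes> (psign p \<otimes> wprod (a(j := y)) (map p [0..<N])))"
    unfolding standard_poly_def
  proof (rule finsum_cong')
    fix p assume "p \<in> {p. p permutes {..<N}}"
    then have p: "p permutes {..<N}" by simp
    have "wprod (a(j := b \<otimes> y)) (map p [0..<N]) = b \<otimes> wprod (a(j := y)) (map p [0..<N])"
      using word_permutes[OF p] assms by (intro wprod_scale) auto
    then have "psign p \<otimes> wprod (a(j := b \<otimes> y)) (map p [0..<N])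
        = (psign p \<otimes> b) \<otimes> wprod (a(j := y)) (map p [0..<N])"
      using wc[OF p assms(4)] assms(3) by (simp only: m_assoc psign_closed)
    also have "psign p \<otimes> b = b \<otimes> psign p" using central by simp
    finally show "psign p \<otimes> wprod (a(j := b \<otimes> y)) (map p [0..<N])
        = b \<otimes> (psign p \<otimes> wprod (a(j := y)) (map p [0..<N]))"
      using wc[OF p assms(4)] assms(3) by (simp only: m_assoc psign_closed)
  qed (use wc assms in auto)
  also have "\<dots> = b \<otimes> standard_poly N (a(j := y))"
    unfolding standard_poly_def using wc assms by (intro finsum_rdistr[symmetric]) (auto simp: finite_permutations)
  finally show ?thesis .
qed

text \<open>By multilinearity over B the arguments are replaced by generators one at a time; those
  with index at least m already lie in G. Once all of them do, \<open>card G < N\<close> forces two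
  to coincide.\<close>

lemma standard_poly_eq_zero:
  assumes B: "subring B R" "\<And>b x. b \<in> B \<Longrightarrow> x \<in> carrier R \<Longrightarrow> b \<otimes> x = x \<otimes> b"
    and G: "finite G" "G \<subseteq> carrier R" "carrier R = {\<Oplus>g\<in>G. b g \<otimes> g | b. b \<in> G \<rightarrow> B}" "card G < N"
    and a: "\<And>i. i < N \<Longrightarrow> a i \<in> carrier R"
  shows "standard_poly N a = \<zero>"
proof -
  have Bc: "b \<in> carrier R" if "b \<in> B" for b using that subringE(1)[OF B(1)] by blast
  have "standard_poly N a = \<zero>"
    if "m \<le> N" "\<And>i. i < N \<Longrightarrow> a i \<in> carrier R" "\<And>i. m \<le> i \<Longrightarrow> i < N \<Longrightarrow> a i \<in> G" for m a
    using that
  proof (induction m arbitrary: a)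
    case 0
    have "\<not> inj_on a {..<N}"
      using card_inj_on_le[of a "{..<N}" G] 0 G(1,4) by auto
    then obtain i j where "i < N" "j < N" "i \<noteq> j" "a i = a j" by (auto simp: inj_on_def)
    then show ?case using standard_poly_alternating 0(2) by blast
  next
    case (Suc m)
    have m: "m < N" using Suc.prems by simp
    let ?Z = "{y \<in> carrier R. standard_poly N (a(m := y)) = \<zero>}"
    have scale: "b \<otimes> y \<in> ?Z" if "b \<in> B" "y \<in> ?Z" for b y
      using that standard_poly_upd_scale[of N a m b y] Suc.prems m B(2) Bc by simp
    have add: "x \<oplus> y \<in> ?Z" if "x \<in> ?Z" "y \<in> ?Z" for x y
      using that standard_poly_upd_additive[of N a m x y] Suc.prems m by simp
    have inG: "g \<in> ?Z" if "g \<in> G" for g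
    proof -
      have "standard_poly N (a(m := g)) = \<zero>"
        by (rule Suc.IH) (use that Suc.prems m G(2) in auto)
      then show ?thesis using that G(2) by auto
    qed
    have sumZ: "(\<Oplus>g\<in>H. b g \<otimes> g) \<in> ?Z" if "H \<subseteq> G" "b \<in> G \<rightarrow> B" "H \<noteq> {}" for H b
      using finite_subset[OF that(1) G(1)] that(3,1)
    proof (induction H rule: finite_ne_induct)
      case (singleton g)
      have "b g \<otimes> g \<in> ?Z" using singleton that(2) by (intro scale inG) auto
      moreover have "(\<Oplus>g\<in>{g}. b g \<otimes> g) = b g \<otimes> g"
        using calculation by (simp add: finsum_insert)
      ultimately show ?case by (simp only:)
    next
      case (insert g H)
      have "(\<Oplus>g\<in>insert g H. b g \<otimes> g) = b g \<otimes> g \<oplus> (\<Oplus>g\<in>H. b g \<otimes> g)"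
        using insert that(2) G(2) Bc by (intro finsum_insert) (auto simp: Pi_iff subset_iff)
      moreover have "b g \<otimes> g \<in> ?Z" using insert that(2) by (intro scale inG) auto
      moreover have "(\<Oplus>g\<in>H. b g \<otimes> g) \<in> ?Z" by (rule insert.IH) (use insert.prems in auto)
      ultimately show ?case using add by (simp only:)
    qed
    have "a m \<in> ?Z"
    \<comment> \<open>\<open>sumZ\<close> starts from a single generator and covers nonempty sums.
      If G is empty, the ring is zero.\<close>
    proof (cases "G = {}")
      case True
      then have "carrier R = {\<zero>}" using G(3) by simp
      moreover have "wprod a (map p [0..<N]) \<in> carrier R" if "p permutes {..<N}" for p
        using word_permutes(2)[OF that] Suc.prems(2) by (intro wprod_closed) auto
      then have "standard_poly N a \<in> carrier R"
        unfolding standard_poly_def by (intro finsum_closed) auto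
      ultimately have "standard_poly N a = \<zero>" by blast
      with Suc.prems(2)[OF m] show ?thesis by (simp only: mem_Collect_eq fun_upd_triv simp_thms)
    next
      case False
      have "a m \<in> {\<Oplus>g\<in>G. b g \<otimes> g | b. b \<in> G \<rightarrow> B}"
        using Suc.prems(2)[OF m] by (simp only: flip: G(3))
      then obtain b where "b \<in> G \<rightarrow> B" "a m = (\<Oplus>g\<in>G. b g \<otimes> g)" by blast
      with sumZ[OF subset_refl _ False] show ?thesis by (simp only:)
    qed
    then show ?case by (simp only: mem_Collect_eq fun_upd_triv)
  qed
  from this[of N a] a show ?thesis by simp
qed

text \<open>The identity is the standard polynomial of degree \<open>card G + 1\<close>. Distinct
  permutations give distinct words, so each coefficient is 1 or -1 and nothing cancels.\<close>

lemma pi_algebra_finite_module: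
  assumes B: "subring B R" "B \<subseteq> mult_center R" "finite_module_over B R" and k: "subring k R"
    and "\<one> \<noteq> \<zero>"
  shows "pi_algebra k R"
proof -
  obtain G where G: "finite G" "G \<subseteq> carrier R" "carrier R = {\<Oplus>g\<in>G. b g \<otimes> g | b. b \<in> G \<rightarrow> B}"
    using B(3) unfolding finite_module_over_def by blast
  define N where "N = Suc (card G)"
  let ?P = "{p. p permutes {..<N}}"
  let ?word = "\<lambda>p. map p [0..<N]"
  define c where "c w = (if w \<in> ?word ` ?P then psign (the_inv_into ?P ?word w) else \<zero>)" for w
  have inj: "inj_on ?word ?P"
  proof (rule inj_onI)
    fix p q assume pq: "p \<in> ?P" "q \<in> ?P" "?word p = ?word q"
    then have "p x = q x" if "x < N" for x using that by auto
    moreover have "p x = q x" if "\<not> x < N" for x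
      using that pq by (metis lessThan_iff mem_Collect_eq permutes_not_in)
    ultimately show "p = q" by blast
  qed
  have cw: "c (?word p) = psign p" if "p \<in> ?P" for p
    unfolding c_def the_inv_into_f_f[OF inj that] by (rule if_P[OF imageI[OF that]])
  have ne: "psign p \<noteq> \<zero>" for p
    using \<open>\<one> \<noteq> \<zero>\<close> by (auto simp: psign_def)
  have supp: "{w. c w \<noteq> \<zero>} = ?word ` ?P"
    using cw ne by (auto simp: c_def)
  have fin: "finite ?P" by (simp add: finite_permutations)
  have kc: "c w \<in> k" for w
    using subringE(2,3,5)[OF k] by (auto simp: c_def psign_def)
  have "(\<Oplus>w\<in>{w. c w \<noteq> \<zero>}. c w \<otimes> wprod a w) = \<zero>"
    if a: "\<forall>i. a i \<in> carrier R" for a :: "nat \<Rightarrow> 'a"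
  proof -
    have wc: "wprod a w \<in> carrier R" for w using a by (intro wprod_closed) auto
    have "(\<Oplus>w\<in>{w. c w \<noteq> \<zero>}. c w \<otimes> wprod a w) = (\<Oplus>p\<in>?P. c (?word p) \<otimes> wprod a (?word p))"
      unfolding supp using kc subringE(1)[OF k] wc by (intro finsum_reindex inj) auto
    also have "\<dots> = standard_poly N a"
      unfolding standard_poly_def using cw wc by (intro finsum_cong') auto
    also have "\<dots> = \<zero>"
      using a B(2) by (intro standard_poly_eq_zero[OF B(1) _ G]) (auto simp: N_def mult_center_def)
    finally show ?thesis .
  qed
  moreover have "finite {w. c w \<noteq> \<zero>}" unfolding supp using fin by simp
  moreover have "\<exists>w. c w \<noteq> \<zero>" using ne cw[of id] permutes_id by (metis mem_Collect_eq)
  ultimately show ?thesis using kc unfolding pi_algebra_def wprod_def by (intro exI[of _ c]) blast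
qed

end

section \<open>Noetherianity and central subalgebras\<close>

lemma nat_mono_subsequence:
  fixes f :: "nat \<Rightarrow> nat"
  shows "\<exists>g :: nat \<Rightarrow> nat. strict_mono g \<and> (\<forall>a b. a \<le> b \<longrightarrow> f (g a) \<le> f (g b))"
proof -
  obtain g :: "nat \<Rightarrow> nat" where g: "strict_mono g" "monoseq (\<lambda>n. f (g n))" using seq_monosub[of f] by blast
  show ?thesis
  proof (cases "\<forall>a b. a \<le> b \<longrightarrow> f (g a) \<le> f (g b)")
    case True
    with g(1) show ?thesis by blast
  next
    case False
    then have dec: "f (g b) \<le> f (g a)" if "a \<le> b" for a b
      using g(2) that by (auto simp: monoseq_def)
    \<comment> \<open>A non-increasing sequence of natural numbers is constant once it reaches its
      least value; that tail is the required subsequence.\<close>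
    define v where "v = (LEAST v. \<exists>a. f (g a) = v)"
    have "\<exists>a. f (g a) = v" unfolding v_def by (rule LeastI_ex) blast
    then obtain a where a: "f (g a) = v" by blast
    have ge: "v \<le> f (g b)" for b unfolding v_def by (rule Least_le) blast
    have "f (g (a + b)) = v" for b using dec[of a "a + b"] a ge[of "a + b"] by simp
    then have "strict_mono (\<lambda>b. g (a + b)) \<and> (\<forall>b c. b \<le> c \<longrightarrow> f (g (a + b)) \<le> f (g (a + c)))"
      using g(1) by (auto simp: strict_mono_def)
    then show ?thesis by blast
  qed
qed

lemma dickson:
  fixes f :: "nat \<Rightarrow> nat \<Rightarrow> nat"
  shows "\<exists>g :: nat \<Rightarrow> nat. strict_mono g \<and> (\<forall>i<N. \<forall>a b. a \<le> b \<longrightarrow> f (g a) i \<le> f (g b) i)"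
proof (induction N)
  case 0
  show ?case by (intro exI[of _ id]) (simp add: strict_mono_def)
next
  case (Suc N)
  then obtain g :: "nat \<Rightarrow> nat" where g: "strict_mono g" "\<And>i a b. i < N \<Longrightarrow> a \<le> b \<Longrightarrow> f (g a) i \<le> f (g b) i" by blast
  obtain h :: "nat \<Rightarrow> nat" where h: "strict_mono h" "\<And>a b. a \<le> b \<Longrightarrow> f (g (h a)) N \<le> f (g (h b)) N"
    using nat_mono_subsequence[of "\<lambda>a. f (g a) N"] by blast
  have "f (g (h a)) i \<le> f (g (h b)) i" if "i < Suc N" "a \<le> b" for i a b
    using that g(2)[of i "h a" "h b"] h(2) strict_mono_mono[OF h(1), THEN monoD] by (cases "i = N") auto
  moreover have "strict_mono (g \<circ> h)" using g(1) h(1) by (simp add: strict_mono_def)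
  ultimately show ?case by (intro exI[of _ "g \<circ> h"]) (simp add: comp_def)
qed

text \<open>Residues are controlled by adding the coordinates \<open>r\<close> and \<open>d - r\<close>: both can only be
  non-decreasing along a sequence if the residue \<open>r\<close> is constant.\<close>

lemma dickson_mod:
  fixes m :: "nat \<Rightarrow> (nat \<Rightarrow>\<^sub>0 nat)" and n d :: nat
  assumes "d > 0" "\<And>k. Poly_Mapping.keys (m k) \<subseteq> {..<n}"
  shows "\<exists>i j t. i < j \<and> m j = m i + t \<and> Poly_Mapping.keys t \<subseteq> {..<n} \<and> (\<forall>l. d dvd Poly_Mapping.lookup t l)"
proof -
  define f where "f k i = (if i < n then Poly_Mapping.lookup (m k) i
    else if i < 2 * n then Poly_Mapping.lookup (m k) (i - n) mod d
    else d - Poly_Mapping.lookup (m k) (i - 2 * n) mod d)" for k i :: nat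
  obtain g :: "nat \<Rightarrow> nat" where g: "strict_mono g" "\<And>i a b. i < 3 * n \<Longrightarrow> a \<le> b \<Longrightarrow> f (g a) i \<le> f (g b) i"
    using dickson[of "3 * n" f] by blast
  define i j where "i = g 0" and "j = g 1"
  have ij: "i < j" unfolding i_def j_def using g(1) by (simp add: strict_mono_def)
  have le: "Poly_Mapping.lookup (m i) l \<le> Poly_Mapping.lookup (m j) l" for l
  proof (cases "l < n")
    case True
    then show ?thesis using g(2)[of l 0 1] by (simp add: f_def i_def j_def)
  next
    case False
    then show ?thesis using assms(2)[of i] by (metis in_keys_iff le0 lessThan_iff subsetD)
  qed
  have md: "Poly_Mapping.lookup (m i) l mod d = Poly_Mapping.lookup (m j) l mod d" for l
  proof (cases "l < n")
    case True
    have "Poly_Mapping.lookup (m i) l mod d \<le> Poly_Mapping.lookup (m j) l mod d"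
      using g(2)[of "l + n" 0 1] True by (simp add: f_def i_def j_def)
    moreover have "d - Poly_Mapping.lookup (m i) l mod d \<le> d - Poly_Mapping.lookup (m j) l mod d"
      using g(2)[of "l + 2 * n" 0 1] True by (simp add: f_def i_def j_def)
    moreover have "Poly_Mapping.lookup (m i) l mod d < d" "Poly_Mapping.lookup (m j) l mod d < d" using assms(1) by simp_all
    ultimately show ?thesis by linarith
  next
    case False
    then have "Poly_Mapping.lookup (m i) l = 0" "Poly_Mapping.lookup (m j) l = 0"
      using assms(2)[of i] assms(2)[of j] by (metis in_keys_iff lessThan_iff subsetD)+
    then show ?thesis by simp
  qed
  define t where "t = m j - m i"
  have t: "Poly_Mapping.lookup t l = Poly_Mapping.lookup (m j) l - Poly_Mapping.lookup (m i) l" for l by (simp add: t_def lookup_minus)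
  have "m j = m i + t" by (rule poly_mapping_eqI) (simp add: lookup_add t le)
  moreover have "Poly_Mapping.keys t \<subseteq> {..<n}"
  proof
    fix l assume "l \<in> Poly_Mapping.keys t"
    then have "l \<in> Poly_Mapping.keys (m j)" by (auto simp: in_keys_iff t)
    then show "l \<in> {..<n}" using assms(2)[of j] by blast
  qed
  moreover have "d dvd Poly_Mapping.lookup t l" for l
    using mod_eq_dvd_iff_nat[OF le[of l], of d] md[of l] by (simp add: t)
  ultimately show ?thesis using ij by blast
qed

text \<open>The order compares exponents at the first index where they differ, so on keys below n it
  embeds into the lexicographic order on lists of length n. The bound on the keys matters: the unit
  vectors at 0, 1, 2, ... form an infinite descending sequence.\<close>

lemma wf_less_keys:
  fixes n :: nat
  shows "wf {(m, m' :: nat \<Rightarrow>\<^sub>0 nat). m < m' \<and> Poly_Mapping.keys m \<subseteq> {..<n} \<and> Poly_Mapping.keys m' \<subseteq> {..<n}}"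
proof (rule wf_subset)
  show "wf (inv_image (lex less_than) (\<lambda>m :: nat \<Rightarrow>\<^sub>0 nat. map (Poly_Mapping.lookup m) [0..<n]))"
    by (intro wf_inv_image wf_lex wf_less_than)
  show "{(m, m' :: nat \<Rightarrow>\<^sub>0 nat). m < m' \<and> Poly_Mapping.keys m \<subseteq> {..<n} \<and> Poly_Mapping.keys m' \<subseteq> {..<n}}
      \<subseteq> inv_image (lex less_than) (\<lambda>m :: nat \<Rightarrow>\<^sub>0 nat. map (Poly_Mapping.lookup m) [0..<n])"
  proof (clarsimp simp: lex_conv)
    fix m m' :: "nat \<Rightarrow>\<^sub>0 nat" assume *: "m < m'" "Poly_Mapping.keys m \<subseteq> {..<n}" "Poly_Mapping.keys m' \<subseteq> {..<n}"
    then obtain k where k: "Poly_Mapping.lookup m k < Poly_Mapping.lookup m' k" "\<And>l. l < k \<Longrightarrow> Poly_Mapping.lookup m l = Poly_Mapping.lookup m' l"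
      by (auto simp: less_poly_mapping.rep_eq less_fun_def)
    then have "k \<in> Poly_Mapping.keys m'" by (simp add: in_keys_iff)
    then have kn: "k < n" using * by auto
    have split: "map (Poly_Mapping.lookup x) [0..<n] = map (Poly_Mapping.lookup x) [0..<k] @ Poly_Mapping.lookup x k # map (Poly_Mapping.lookup x) [Suc k..<n]" for x :: "nat \<Rightarrow>\<^sub>0 nat"
      using kn upt_add_eq_append[of 0 k "n - k"] upt_conv_Cons[of k n] by simp
    have "map (Poly_Mapping.lookup m) [0..<k] = map (Poly_Mapping.lookup m') [0..<k]" using k(2) by simp
    then show "\<exists>xys x. (\<exists>xs'. map (Poly_Mapping.lookup m) [0..<n] = xys @ x # xs') \<and>
        (\<exists>y. (\<exists>ys'. map (Poly_Mapping.lookup m') [0..<n] = xys @ y # ys') \<and> x < y)"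
      using split[of m] split[of m'] k(1) by metis
  qed
qed

text \<open>In \<open>e_shift\<close> the central element c depends on t alone and serves all m at
  once. Shifts by multiples of d thus act like monomials in central variables, although e need not
  be injective.\<close>

locale monoid_alg_nf = monoid_alg K M
  for K :: "('k, 'm) ring_scheme" and M :: "('a, 'n) monoid_scheme" +
  fixes e :: "(nat \<Rightarrow>\<^sub>0 nat) \<Rightarrow> 'a" and n d :: nat
  assumes e_surj: "a \<in> carrier M \<Longrightarrow> \<exists>m. Poly_Mapping.keys m \<subseteq> {..<n} \<and> e m = a"
    and e_closed: "Poly_Mapping.keys m \<subseteq> {..<n} \<Longrightarrow> e m \<in> carrier M"
    and d_pos: "d > 0"
    and e_shift: "Poly_Mapping.keys t \<subseteq> {..<n} \<Longrightarrow> (\<And>i. d dvd Poly_Mapping.lookup t i) \<Longrightarrow>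
      \<exists>c\<in>mult_center M. \<forall>m. Poly_Mapping.keys m \<subseteq> {..<n} \<longrightarrow> e (m + t) = c \<otimes>\<^bsub>M\<^esub> e m"
begin

text \<open>Leading exponents as in Groebner basis theory, except that the normal forms \<open>e m\<close> may
  coincide for different exponents \<open>m\<close>.\<close>

definition below :: "(nat \<Rightarrow>\<^sub>0 nat) \<Rightarrow> 'a set" where
  "below m = e ` {m'. m' < m \<and> Poly_Mapping.keys m' \<subseteq> {..<n}}"

definition lead :: "('a \<Rightarrow> 'k) set \<Rightarrow> (nat \<Rightarrow>\<^sub>0 nat) set" where
  "lead I = {m. Poly_Mapping.keys m \<subseteq> {..<n} \<and>
     (\<exists>u\<in>carrier R. supp u \<subseteq> below m \<and> mon \<one>\<^bsub>K\<^esub> (e m) \<oplus>\<^bsub>R\<^esub> u \<in> I)}"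

text \<open>Left and right ideals are both closed under multiplication by central monomials, so one
  chain argument serves both sides.\<close>

definition central_submodule :: "('a \<Rightarrow> 'k) set \<Rightarrow> bool" where
  "central_submodule I \<longleftrightarrow> additive_subgroup I R \<and>
     (\<forall>c\<in>carrier K. \<forall>z\<in>mult_center M. \<forall>x\<in>I. mon c z \<otimes>\<^bsub>R\<^esub> x \<in> I)"

lemma keys_add_subset: "Poly_Mapping.keys m \<subseteq> A \<Longrightarrow> Poly_Mapping.keys t \<subseteq> A \<Longrightarrow> Poly_Mapping.keys (m + t) \<subseteq> A"
  for m t :: "nat \<Rightarrow>\<^sub>0 nat"
  using keys_add[of m t] by blast

text \<open>Multiply the witness by the central element that realizes the shift by t. The order on
  exponents is invariant under adding t, so the lower terms stay below.\<close>

lemma lead_shift: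
  assumes I: "central_submodule I" and m: "m \<in> lead I"
    and t: "Poly_Mapping.keys t \<subseteq> {..<n}" "\<And>i. d dvd Poly_Mapping.lookup t i"
  shows "m + t \<in> lead I"
proof -
  obtain c where c: "c \<in> mult_center M" "\<And>m. Poly_Mapping.keys m \<subseteq> {..<n} \<Longrightarrow> e (m + t) = c \<otimes>\<^bsub>M\<^esub> e m"
    using e_shift[OF t] by blast
  have cc: "c \<in> carrier M" using c(1) by (simp add: mult_center_def)
  obtain u where km: "Poly_Mapping.keys m \<subseteq> {..<n}" and u: "u \<in> carrier R" "supp u \<subseteq> below m" "mon \<one>\<^bsub>K\<^esub> (e m) \<oplus>\<^bsub>R\<^esub> u \<in> I"
    using m by (auto simp: lead_def)
  let ?u = "mon \<one>\<^bsub>K\<^esub> c \<otimes>\<^bsub>R\<^esub> u"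
  have "mon \<one>\<^bsub>K\<^esub> c \<otimes>\<^bsub>R\<^esub> (mon \<one>\<^bsub>K\<^esub> (e m) \<oplus>\<^bsub>R\<^esub> u) \<in> I"
    using I c(1) u(3) by (auto simp: central_submodule_def)
  also have "mon \<one>\<^bsub>K\<^esub> c \<otimes>\<^bsub>R\<^esub> (mon \<one>\<^bsub>K\<^esub> (e m) \<oplus>\<^bsub>R\<^esub> u) = mon \<one>\<^bsub>K\<^esub> (e (m + t)) \<oplus>\<^bsub>R\<^esub> ?u"
    using cc u(1) km e_closed[OF km] by (simp add: mult_r_distr mon_mult c(2))
  finally have "mon \<one>\<^bsub>K\<^esub> (e (m + t)) \<oplus>\<^bsub>R\<^esub> ?u \<in> I" .
  moreover have "?u \<in> carrier R" using cc u(1) by (intro mult_closed) auto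
  moreover have "supp ?u \<subseteq> below (m + t)"
  proof
    fix a assume "a \<in> supp ?u"
    then obtain b where b: "b \<in> supp u" "a = c \<otimes>\<^bsub>M\<^esub> b"
    proof -
      have "a \<in> (\<lambda>(a, b). a \<otimes>\<^bsub>M\<^esub> b) ` (supp (mon \<one>\<^bsub>K\<^esub> c) \<times> supp u)"
        using \<open>a \<in> supp ?u\<close> supp_mult[of "mon \<one>\<^bsub>K\<^esub> c" u] cc u(1) by auto
      then show ?thesis using that supp_mon[of "\<one>\<^bsub>K\<^esub>" c] by auto
    qed
    then obtain m' where m': "m' < m" "Poly_Mapping.keys m' \<subseteq> {..<n}" "b = e m'"
      using u(2) by (auto simp: below_def)
    have "m' + t < m + t" using m'(1) by (rule add_strict_right_mono)
    moreover have "a = e (m' + t)" using b m' c(2) by simp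
    ultimately show "a \<in> below (m + t)"
      using keys_add_subset[OF m'(2) t(1)] by (auto simp: below_def)
  qed
  ultimately show ?thesis using keys_add_subset[OF km t(1)] by (auto simp: lead_def)
qed

lemma lead_mono: "I \<subseteq> J \<Longrightarrow> lead I \<subseteq> lead J" by (auto simp: lead_def)

text \<open>Choose an exponent for each element of S and take the largest. The predicate P keeps the
  choice below a given exponent during the reduction.\<close>

lemma supp_subset_below_or_eq:
  assumes "finite S" "S \<noteq> {}" "\<And>a. a \<in> S \<Longrightarrow> \<exists>m. P m \<and> Poly_Mapping.keys m \<subseteq> {..<n} \<and> e m = a"
  shows "\<exists>m. P m \<and> Poly_Mapping.keys m \<subseteq> {..<n} \<and> e m \<in> S \<and> S - {e m} \<subseteq> below m"
proof -
  obtain h where h: "\<And>a. a \<in> S \<Longrightarrow> P (h a) \<and> Poly_Mapping.keys (h a) \<subseteq> {..<n} \<and> e (h a) = a"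
    using assms(3) by metis
  define m where "m = Max (h ` S)"
  have "m \<in> h ` S" unfolding m_def using assms(1,2) by (intro Max_in) auto
  then obtain a where a: "a \<in> S" "m = h a" by blast
  have "b \<in> below m" if b: "b \<in> S - {e m}" for b
  proof -
    have "h b \<le> m" unfolding m_def using b assms(1) by (intro Max_ge) auto
    moreover have "h b \<noteq> m" using b h by auto
    ultimately have "h b < m" by simp
    then show ?thesis using h[of b] b by (auto simp: below_def intro!: image_eqI[of _ _ "h b"])
  qed
  then show ?thesis using a h by (intro exI[of _ m]) auto
qed

text \<open>Elements of I with equal leading exponent successively lower the exponents of a given y
  in J. The element \<open>e m\<close> may reappear through a smaller exponent, which is harmless
  because the recursion is on exponents.\<close>

lemma submodule_eq_of_lead_eq:
  assumes I: "central_submodule I" and J: "central_submodule J" and "I \<subseteq> J" and lead: "lead J \<subseteq> lead I"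
  shows "I = J"
proof -
  have Is: "additive_subgroup I R" and Js: "additive_subgroup J R"
    using I J by (simp_all add: central_submodule_def)
  interpret I: additive_subgroup I R by fact
  interpret J: additive_subgroup J R by fact
  have Jc: "y \<in> carrier R" if "y \<in> J" for y using that by (rule J.a_Hcarr)
  have scI: "mon c \<one>\<^bsub>M\<^esub> \<otimes>\<^bsub>R\<^esub> x \<in> I" if "c \<in> carrier K" "x \<in> I" for c x
    using I that one_center by (auto simp: central_submodule_def)
  have scJ: "mon c \<one>\<^bsub>M\<^esub> \<otimes>\<^bsub>R\<^esub> x \<in> J" if "c \<in> carrier K" "x \<in> J" for c x
    using J that one_center by (auto simp: central_submodule_def)
  text \<open>One reduction step, subtracting a multiple of an element of \<open>I\<close> with leading exponent \<open>m\<close>.\<close>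
  have step: "y \<in> I"
    if y: "y \<in> J" and m: "Poly_Mapping.keys m \<subseteq> {..<n}" "e m \<in> supp y" "supp y - {e m} \<subseteq> below m"
      and IH: "\<And>y'. y' \<in> J \<Longrightarrow> supp y' \<subseteq> below m \<Longrightarrow> y' \<in> I" for y m
  proof -
    define \<alpha> where "\<alpha> = y (e m)"
    have yc: "y \<in> carrier R" by (rule Jc[OF y])
    have \<alpha>: "\<alpha> \<in> carrier K" "\<alpha> \<noteq> \<zero>\<^bsub>K\<^esub>" using yc m(2) by (auto simp: \<alpha>_def supp_def)
    then have \<alpha>u: "\<alpha> \<in> Units K" using K.field_Units by simp
    define u where "u = (\<lambda>b. if b \<in> - {e m} then y b else \<zero>\<^bsub>K\<^esub>)"
    have yu: "y = mon \<alpha> (e m) \<oplus>\<^bsub>R\<^esub> u" unfolding \<alpha>_def u_def by (rule split_mon[OF yc])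
    have u: "u \<in> carrier R" "supp u \<subseteq> below m"
      using restrict_supp[OF yc, of "- {e m}"] m(3) by (auto simp: u_def supp_def)
    have em: "e m \<in> carrier M" by (rule e_closed[OF m(1)])
    let ?i = "mon (inv\<^bsub>K\<^esub> \<alpha>) \<one>\<^bsub>M\<^esub>"
    have ic: "?i \<in> carrier R" using \<alpha>u by simp
    have "?i \<otimes>\<^bsub>R\<^esub> y = mon \<one>\<^bsub>K\<^esub> (e m) \<oplus>\<^bsub>R\<^esub> ?i \<otimes>\<^bsub>R\<^esub> u"
      using \<alpha> \<alpha>u u(1) em ic by (subst yu) (simp add: mult_r_distr mon_mult)
    moreover have "?i \<otimes>\<^bsub>R\<^esub> y \<in> J" using \<alpha>u y by (intro scJ) auto
    moreover have "supp (?i \<otimes>\<^bsub>R\<^esub> u) \<subseteq> below m"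
      using u \<alpha>u by (subst scalar_mult) (auto simp: supp_def)
    ultimately have "m \<in> lead J" using m(1) u(1) ic unfolding lead_def
      by (auto intro!: bexI[of _ "?i \<otimes>\<^bsub>R\<^esub> u"] mult_closed)
    then have "m \<in> lead I" using lead by blast
    then obtain v where v: "v \<in> carrier R" "supp v \<subseteq> below m" "mon \<one>\<^bsub>K\<^esub> (e m) \<oplus>\<^bsub>R\<^esub> v \<in> I"
      by (auto simp: lead_def)
    let ?w = "mon \<alpha> \<one>\<^bsub>M\<^esub> \<otimes>\<^bsub>R\<^esub> (mon \<one>\<^bsub>K\<^esub> (e m) \<oplus>\<^bsub>R\<^esub> v)"
    let ?\<alpha>v = "mon \<alpha> \<one>\<^bsub>M\<^esub> \<otimes>\<^bsub>R\<^esub> v"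
    have w: "?w \<in> I" using \<alpha>(1) v(3) by (rule scI)
    have weq: "?w = mon \<alpha> (e m) \<oplus>\<^bsub>R\<^esub> ?\<alpha>v" using \<alpha> v em by (simp add: mult_r_distr mon_mult)
    have vc: "?\<alpha>v \<in> carrier R" using \<alpha> v by (intro mult_closed) auto
    have mc: "mon \<alpha> (e m) \<in> carrier R" using \<alpha> em by simp
    have "y \<ominus>\<^bsub>R\<^esub> ?w = u \<oplus>\<^bsub>R\<^esub> \<ominus>\<^bsub>R\<^esub> ?\<alpha>v"
    proof -
      have "y \<ominus>\<^bsub>R\<^esub> ?w = (mon \<alpha> (e m) \<oplus>\<^bsub>R\<^esub> u) \<oplus>\<^bsub>R\<^esub> (\<ominus>\<^bsub>R\<^esub> mon \<alpha> (e m) \<oplus>\<^bsub>R\<^esub> \<ominus>\<^bsub>R\<^esub> ?\<alpha>v)"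
        unfolding weq by (subst yu) (simp add: R.minus_eq R.minus_add mc vc)
      also have "\<dots> = (u \<oplus>\<^bsub>R\<^esub> mon \<alpha> (e m)) \<oplus>\<^bsub>R\<^esub> (\<ominus>\<^bsub>R\<^esub> mon \<alpha> (e m) \<oplus>\<^bsub>R\<^esub> \<ominus>\<^bsub>R\<^esub> ?\<alpha>v)"
        using mc u(1) by (simp only: R.a_comm)
      also have "\<dots> = u \<oplus>\<^bsub>R\<^esub> \<ominus>\<^bsub>R\<^esub> ?\<alpha>v"
        using mc u(1) vc by (simp add: R.a_assoc R.r_neg2)
      finally show ?thesis .
    qed
    moreover have "supp (u \<oplus>\<^bsub>R\<^esub> \<ominus>\<^bsub>R\<^esub> ?\<alpha>v) \<subseteq> below m"
    proof -
      have "supp (\<ominus>\<^bsub>R\<^esub> ?\<alpha>v) \<subseteq> supp ?\<alpha>v" using vc by (auto simp: supp_def minus_apply)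
      also have "\<dots> \<subseteq> supp v" using v \<alpha> by (subst scalar_mult) (auto simp: supp_def)
      finally show ?thesis using u(2) v(2) supp_add[of u "\<ominus>\<^bsub>R\<^esub> ?\<alpha>v"] by blast
    qed
    moreover have "y \<ominus>\<^bsub>R\<^esub> ?w \<in> J" using y w \<open>I \<subseteq> J\<close> by (auto simp: R.minus_eq)
    ultimately have "y \<ominus>\<^bsub>R\<^esub> ?w \<in> I" using IH by simp
    then have "(y \<ominus>\<^bsub>R\<^esub> ?w) \<oplus>\<^bsub>R\<^esub> ?w \<in> I" using w by blast
    also have "(y \<ominus>\<^bsub>R\<^esub> ?w) \<oplus>\<^bsub>R\<^esub> ?w = y"
      using yc I.a_Hcarr[OF w] by (simp add: R.minus_eq R.a_assoc R.l_neg)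
    finally show ?thesis .
  qed
  have ind: "Poly_Mapping.keys m \<subseteq> {..<n} \<Longrightarrow> y \<in> J \<Longrightarrow> supp y \<subseteq> below m \<Longrightarrow> y \<in> I" for m y
  proof (induction m arbitrary: y rule: wf_induct_rule[OF wf_less_keys[of n]])
    case (1 m y)
    show ?case
    proof (cases "supp y = {}")
      case True
      then have "y = \<zero>\<^bsub>R\<^esub>" by (auto simp: supp_def zero_eq)
      then show ?thesis by simp
    next
      case False
      have "\<exists>m'. m' < m \<and> Poly_Mapping.keys m' \<subseteq> {..<n} \<and> e m' \<in> supp y \<and> supp y - {e m'} \<subseteq> below m'"
        using Jc[OF 1(3)] 1(4) False by (intro supp_subset_below_or_eq) (auto simp: carrier_iff below_def)
      then obtain m' where m': "m' < m" "Poly_Mapping.keys m' \<subseteq> {..<n}" "e m' \<in> supp y" "supp y - {e m'} \<subseteq> below m'"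
        by blast
      show ?thesis
        by (rule step[OF 1(3) m'(2-4)]) (use 1 m' in auto)
    qed
  qed
  have "y \<in> I" if y: "y \<in> J" for y
  proof (cases "supp y = {}")
    case True
    then have "y = \<zero>\<^bsub>R\<^esub>" by (auto simp: supp_def zero_eq)
    then show ?thesis by simp
  next
    case False
    have "\<exists>m. True \<and> Poly_Mapping.keys m \<subseteq> {..<n} \<and> e m \<in> supp y \<and> supp y - {e m} \<subseteq> below m"
      using Jc[OF y] False e_surj by (intro supp_subset_below_or_eq) (auto simp: carrier_iff)
    then obtain m where "Poly_Mapping.keys m \<subseteq> {..<n}" "e m \<in> supp y" "supp y - {e m} \<subseteq> below m" by blast
    then show ?thesis using step[OF y] ind by blast
  qed
  then show ?thesis using \<open>I \<subseteq> J\<close> by blast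
qed

text \<open>If the chain never stabilizes, each stage N has a later stage whose \<open>lead\<close>
  contains a new exponent \<open>mm N\<close>. Some two of these differ by a vector of multiples of
  d, and \<open>lead_shift\<close> puts the later one into a \<open>lead\<close> set that was to
  miss it.\<close>

lemma acc_central_submodule: "acc_on central_submodule"
  unfolding acc_on_def
proof (intro allI impI, elim conjE, rule ccontr)
  fix I :: "nat \<Rightarrow> ('a \<Rightarrow> 'k) set"
  assume I: "\<forall>n. central_submodule (I n)" "\<forall>n. I n \<subseteq> I (Suc n)" and no: "\<nexists>N. \<forall>n\<ge>N. I n = I N"
  have mono: "I i \<subseteq> I j" if "i \<le> j" for i j using lift_Suc_mono_le[of I i j] I(2) that by blast
  have ex: "\<exists>j m. N < j \<and> m \<in> lead (I j) \<and> m \<notin> lead (I N)" for N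
  proof -
    obtain j where j: "j \<ge> N" "I j \<noteq> I N" using no by blast
    then have "\<not> lead (I j) \<subseteq> lead (I N)"
      using submodule_eq_of_lead_eq[of "I N" "I j"] I(1) mono by blast
    moreover have "N \<noteq> j" using j by auto
    ultimately show ?thesis using j by (auto intro!: exI[of _ j])
  qed
  obtain J mm where J: "\<And>N. N < J N" "\<And>N. mm N \<in> lead (I (J N))" "\<And>N. mm N \<notin> lead (I N)"
    using ex by metis
  \<comment> \<open>Iterating J makes the indices jump far enough that \<open>mm (s i)\<close>
    already belongs to \<open>lead (I (s (Suc i)))\<close>.\<close>
  define s where "s k = (J ^^ k) 0" for k
  have s: "s (Suc k) = J (s k)" for k by (simp add: s_def)
  have sm: "strict_mono s" unfolding strict_mono_Suc_iff using J(1) by (simp add: s)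
  have km: "Poly_Mapping.keys (mm N) \<subseteq> {..<n}" for N using J(2)[of N] by (simp add: lead_def)
  obtain i j t where ij: "i < j" "mm (s j) = mm (s i) + t" "Poly_Mapping.keys t \<subseteq> {..<n}" "\<forall>l. d dvd Poly_Mapping.lookup t l"
    using dickson_mod[OF d_pos, of "\<lambda>k. mm (s k)" n] km by blast
  have "mm (s i) \<in> lead (I (s (Suc i)))" using J(2) by (simp add: s)
  moreover have "s (Suc i) \<le> s j" using strict_mono_mono[OF sm] ij(1) by (simp add: mono_def)
  ultimately have "mm (s i) \<in> lead (I (s j))" using lead_mono[OF mono] by blast
  then have "mm (s j) \<in> lead (I (s j))" unfolding ij(2) using ij I(1) by (intro lead_shift) auto
  with J(3) show False by blast
qed

theorem left_right_noetherian_R: "left_right_noetherian R"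
proof -
  have zc: "z \<in> carrier M" if "z \<in> mult_center M" for z using that by (simp add: mult_center_def)
  have l: "central_submodule I" if "left_ideal I R" for I
    using that zc by (auto simp: central_submodule_def left_ideal_def)
  have r: "central_submodule I" if "right_ideal I R" for I
    using that zc central_mon additive_subgroup.a_Hcarr[of I R]
    by (auto simp: central_submodule_def right_ideal_def)
  have "acc_on (\<lambda>I. left_ideal I R)" "acc_on (\<lambda>I. right_ideal I R)"
    using acc_central_submodule l r unfolding acc_on_def by blast+
  then show ?thesis using ring_R by (simp add: left_right_noetherian_def)
qed

end

context monoid_alg
begin

text \<open>B is generated by the scalars and the monomials on Z. A monomial on z1 ... zk f with
  coefficient c is the element c z1 ... zk of B times the module generator f.\<close>

lemma ex_affine_central_subalgebra:
  assumes Z: "finite Z" "Z \<subseteq> mult_center M" and F: "finite F" "F \<subseteq> carrier M"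
    and gen: "\<And>a. a \<in> carrier M \<Longrightarrow> \<exists>zs f. set zs \<subseteq> Z \<and> f \<in> F \<and> a = foldr (\<otimes>\<^bsub>M\<^esub>) zs \<one>\<^bsub>M\<^esub> \<otimes>\<^bsub>M\<^esub> f"
  shows "\<exists>B. affine_subalgebra (scalars K M) B R \<and> B \<subseteq> mult_center R \<and> finite_module_over B R"
proof -
  let ?S = "mon \<one>\<^bsub>K\<^esub> ` Z"
  let ?k = "scalars K M"
  define B where "B = generate_ring R (?k \<union> ?S)"
  have Zc: "Z \<subseteq> carrier M" using Z(2) by (auto simp: mult_center_def)
  have gens: "?k \<union> ?S \<subseteq> carrier R" using Zc by (auto simp: scalars_eq)
  have subB: "subring B R" unfolding B_def by (rule R.generate_ring_is_subring[OF gens])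
  have incl: "?k \<union> ?S \<subseteq> B" unfolding B_def by (auto intro: generate_ring.incl)
  have Bc: "b \<in> carrier R" if "b \<in> B" for b using subringE(1)[OF subB] that by blast
  have central: "b \<in> mult_center R" if "b \<in> B" for b
    using that unfolding B_def
  proof (induction b rule: generate_ring.induct)
    case (incl h)
    then obtain c z where "h = mon c z" "c \<in> carrier K" "z \<in> mult_center M"
      using Z(2) one_center by (auto simp: scalars_eq)
    then show ?case using central_mon by (auto simp: mult_center_def)
  next
    case (a_inv h)
    then show ?case by (auto simp: mult_center_def R.l_minus R.r_minus)
  next
    case (eng_add h1 h2)
    then show ?case by (auto simp: mult_center_def R.l_distr R.r_distr)
  next
    case (eng_mult h1 h2)
    then have h: "h1 \<in> carrier R" "h2 \<in> carrier R"
      "\<And>x. x \<in> carrier R \<Longrightarrow> h1 \<otimes>\<^bsub>R\<^esub> x = x \<otimes>\<^bsub>R\<^esub> h1" "\<And>x. x \<in> carrier R \<Longrightarrow> h2 \<otimes>\<^bsub>R\<^esub> x = x \<otimes>\<^bsub>R\<^esub> h2"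
      by (auto simp: mult_center_def)
    have "h1 \<otimes>\<^bsub>R\<^esub> h2 \<otimes>\<^bsub>R\<^esub> x = x \<otimes>\<^bsub>R\<^esub> (h1 \<otimes>\<^bsub>R\<^esub> h2)" if x: "x \<in> carrier R" for x
    proof -
      have "h1 \<otimes>\<^bsub>R\<^esub> h2 \<otimes>\<^bsub>R\<^esub> x = h1 \<otimes>\<^bsub>R\<^esub> (x \<otimes>\<^bsub>R\<^esub> h2)" using h(1,2) h(4)[OF x] x by (simp add: mult_assoc)
      also have "\<dots> = (x \<otimes>\<^bsub>R\<^esub> h1) \<otimes>\<^bsub>R\<^esub> h2" using h(1,2) h(3)[OF x] x by (simp flip: mult_assoc)
      finally show ?thesis using h(1,2) x by (simp add: mult_assoc)
    qed
    then show ?case using h(1,2) mult_closed by (auto simp: mult_center_def)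
  qed (auto simp: mult_center_def)
  let ?G = "mon \<one>\<^bsub>K\<^esub> ` F"
  let ?T = "{\<Oplus>\<^bsub>R\<^esub>g\<in>?G. b g \<otimes>\<^bsub>R\<^esub> g | b. b \<in> ?G \<rightarrow> B}"
  have G: "finite ?G" "?G \<subseteq> carrier R" using F by auto
  have term_closed: "b g \<otimes>\<^bsub>R\<^esub> g \<in> carrier R" if "b \<in> ?G \<rightarrow> B" "g \<in> ?G" for b g
    using funcset_mem[OF that(1)] that(2) G(2) Bc by (intro mult_closed) (blast, blast)
  have "f \<in> ?T" if "f \<in> carrier R" for f
    using that
  proof (induction f rule: monoid_algebra_induct)
    case zero
    have "(\<Oplus>\<^bsub>R\<^esub>g\<in>?G. \<zero>\<^bsub>R\<^esub> \<otimes>\<^bsub>R\<^esub> g) = \<zero>\<^bsub>R\<^esub>"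
      by (rule R.add.finprod_one_eqI) (use G(2) zero_mult in blast)
    then show ?case using subringE(2)[OF subB] by (intro CollectI exI[of _ "\<lambda>_. \<zero>\<^bsub>R\<^esub>"]) auto
  next
    case (add f g)
    then obtain b c where bc: "b \<in> ?G \<rightarrow> B" "c \<in> ?G \<rightarrow> B" "f = (\<Oplus>\<^bsub>R\<^esub>g\<in>?G. b g \<otimes>\<^bsub>R\<^esub> g)"
        "g = (\<Oplus>\<^bsub>R\<^esub>g\<in>?G. c g \<otimes>\<^bsub>R\<^esub> g)" by blast
    have "f \<oplus>\<^bsub>R\<^esub> g = (\<Oplus>\<^bsub>R\<^esub>g\<in>?G. b g \<otimes>\<^bsub>R\<^esub> g \<oplus>\<^bsub>R\<^esub> c g \<otimes>\<^bsub>R\<^esub> g)"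
      unfolding bc(3,4) using term_closed bc(1,2) by (intro R.finsum_addf[symmetric]) blast+
    also have "\<dots> = (\<Oplus>\<^bsub>R\<^esub>g\<in>?G. (b g \<oplus>\<^bsub>R\<^esub> c g) \<otimes>\<^bsub>R\<^esub> g)"
    proof (rule R.finsum_cong')
      fix g assume g: "g \<in> ?G"
      then have "b g \<in> carrier R" "c g \<in> carrier R" "g \<in> carrier R"
        using funcset_mem[OF bc(1)] funcset_mem[OF bc(2)] G(2) Bc by (blast, blast, blast)
      then show "b g \<otimes>\<^bsub>R\<^esub> g \<oplus>\<^bsub>R\<^esub> c g \<otimes>\<^bsub>R\<^esub> g = (b g \<oplus>\<^bsub>R\<^esub> c g) \<otimes>\<^bsub>R\<^esub> g" by (simp only: mult_l_distr)
    next
      show "(\<lambda>g. (b g \<oplus>\<^bsub>R\<^esub> c g) \<otimes>\<^bsub>R\<^esub> g) \<in> ?G \<rightarrow> carrier R"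
        using funcset_mem[OF bc(1)] funcset_mem[OF bc(2)] G(2) Bc
        by (intro funcsetI mult_closed add_closed) (blast, blast, blast)
    qed simp
    finally show ?case
      using bc(1,2) subringE(7)[OF subB] by (intro CollectI exI[of _ "\<lambda>g. b g \<oplus>\<^bsub>R\<^esub> c g"]) blast
  next
    case (mon c a)
    obtain zs f where zf: "set zs \<subseteq> Z" "f \<in> F" "a = foldr (\<otimes>\<^bsub>M\<^esub>) zs \<one>\<^bsub>M\<^esub> \<otimes>\<^bsub>M\<^esub> f"
      using gen[OF mon(3)] by blast
    have zs: "mon c (foldr (\<otimes>\<^bsub>M\<^esub>) zs \<one>\<^bsub>M\<^esub>) \<in> B \<and> foldr (\<otimes>\<^bsub>M\<^esub>) zs \<one>\<^bsub>M\<^esub> \<in> carrier M"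
      using zf(1)
    proof (induction zs)
      case Nil
      then show ?case using incl mon(1) by (auto simp: scalars_eq)
    next
      case (Cons z zs)
      then have z: "z \<in> Z" "z \<in> carrier M" using Zc by auto
      have "mon \<one>\<^bsub>K\<^esub> z \<otimes>\<^bsub>R\<^esub> mon c (foldr (\<otimes>\<^bsub>M\<^esub>) zs \<one>\<^bsub>M\<^esub>) \<in> B"
        using Cons z incl by (intro subringE(6)[OF subB]) auto
      then show ?case using Cons z mon(1) by (simp add: mon_mult)
    qed
    let ?w = "mon c (foldr (\<otimes>\<^bsub>M\<^esub>) zs \<one>\<^bsub>M\<^esub>)" and ?g = "mon \<one>\<^bsub>K\<^esub> f"
    define b where "b g = (if g = ?g then ?w else \<zero>\<^bsub>R\<^esub>)" for g
    have bB: "b \<in> ?G \<rightarrow> B" using zs subringE(2)[OF subB] by (auto simp: b_def)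
    have "(\<Oplus>\<^bsub>R\<^esub>g\<in>?G. b g \<otimes>\<^bsub>R\<^esub> g) = (\<Oplus>\<^bsub>R\<^esub>g\<in>?G. if g = ?g then b g \<otimes>\<^bsub>R\<^esub> g else \<zero>\<^bsub>R\<^esub>)"
    proof (rule R.finsum_cong')
      fix g assume "g \<in> ?G"
      then have "g \<in> carrier R" using G(2) by blast
      then show "b g \<otimes>\<^bsub>R\<^esub> g = (if g = ?g then b g \<otimes>\<^bsub>R\<^esub> g else \<zero>\<^bsub>R\<^esub>)" by (simp add: b_def zero_mult)
    qed (use term_closed bB in auto)
    also have "\<dots> = b ?g \<otimes>\<^bsub>R\<^esub> ?g"
      using zf(2) G(1) term_closed[OF bB] by (intro R.add.finprod_singleton_swap) blast+
    also have "\<dots> = mon c a" using zs zf F(2) mon(1) by (auto simp: b_def mon_mult)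
    finally show ?case using bB by (intro CollectI exI[of _ b]) simp
  qed
  moreover have "f \<in> carrier R" if "f \<in> ?T" for f
    using that term_closed by (auto intro!: R.finsum_closed)
  ultimately have "carrier R = ?T" by blast
  then have "finite_module_over B R" using G unfolding finite_module_over_def by blast
  moreover have "affine_subalgebra ?k B R"
    unfolding affine_subalgebra_def unital_subalgebra_def using subB incl Z(1) B_def by blast
  ultimately show ?thesis using central by blast
qed

end

section \<open>The structure algebra\<close>

lemma poly_mapping_of_fun:
  "\<exists>m :: nat \<Rightarrow>\<^sub>0 nat. (\<forall>i. Poly_Mapping.lookup m i = (if i < n then f i else 0)) \<and>
    Poly_Mapping.keys m \<subseteq> {..<n}"
proof -
  let ?m = "Abs_poly_mapping (\<lambda>i. if i < n then f i else 0)"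
  have "finite {i. (if i < n then f i else 0) \<noteq> 0}" by (rule finite_subset[of _ "{..<n}"]) auto
  then have l: "Poly_Mapping.lookup ?m i = (if i < n then f i else 0)" for i by (simp add: lookup_Abs_poly_mapping)
  then show ?thesis by (intro exI[of _ ?m]) (auto simp: in_keys_iff split: if_splits)
qed

lemma monoid_rank_eqI:
  assumes "\<And>n N. submonoid N M \<Longrightarrow> M\<lparr>carrier := N\<rparr> \<cong> free_abelian_monoid n \<Longrightarrow> n \<le> q"
    and "submonoid N M" "M\<lparr>carrier := N\<rparr> \<cong> free_abelian_monoid q"
  shows "monoid_rank M = enat q"
  unfolding monoid_rank_def
proof (rule antisym)
  show "Sup {enat n |n. \<exists>N. submonoid N M \<and> M\<lparr>carrier := N\<rparr> \<cong> free_abelian_monoid n} \<le> enat q"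
    using assms(1) by (intro Sup_least) auto
  show "enat q \<le> Sup {enat n |n. \<exists>N. submonoid N M \<and> M\<lparr>carrier := N\<rparr> \<cong> free_abelian_monoid n}"
    using assms(2,3) by (intro Sup_upper) blast
qed

lemma clKdim_eqI:
  assumes "\<And>n P. (\<And>i. i \<le> n \<Longrightarrow> nc_prime_ideal (P i) R) \<Longrightarrow> (\<And>i. i < n \<Longrightarrow> P i \<subset> P (Suc i)) \<Longrightarrow> n \<le> q"
    and "\<And>i. i \<le> q \<Longrightarrow> nc_prime_ideal (P i) R" "\<And>i. i < q \<Longrightarrow> P i \<subset> P (Suc i)"
  shows "clKdim R = enat q"
  unfolding clKdim_def
proof (rule antisym)
  show "Sup {enat n |n. \<exists>P. (\<forall>i\<le>n. nc_prime_ideal (P i) R) \<and> (\<forall>i<n. P i \<subset> P (Suc i))} \<le> enat q"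
  proof (rule Sup_least, clarsimp)
    fix n P assume "\<forall>i\<le>n. nc_prime_ideal (P i) R" "\<forall>i<n. P i \<subset> P (Suc i)"
    then show "n \<le> q" by (intro assms(1)[of n P]) auto
  qed
  show "enat q \<le> Sup {enat n |n. \<exists>P. (\<forall>i\<le>n. nc_prime_ideal (P i) R) \<and> (\<forall>i<n. P i \<subset> P (Suc i))}"
    using assms(2,3) by (intro Sup_upper) blast
qed

context finite_rack
begin

definition A :: "'x list set monoid" where "A = presented_monoid rels"

definition cls :: "'x list \<Rightarrow> 'x list set" where "cls w = pres_class rels w"

lemma cls_eq_iff: "cls u = cls v \<longleftrightarrow> u \<leftrightarrow> v" by (simp add: cls_def pres_class_eq_iff)

lemma A_carrier: "carrier A = range cls"
  by (simp add: A_def presented_monoid_carrier cls_def[abs_def])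

lemma cls_closed [simp]: "cls w \<in> carrier A" by (simp add: A_carrier)

lemma A_cases: "a \<in> carrier A \<Longrightarrow> \<exists>w. a = cls w" by (auto simp: A_carrier)

lemma A_mult [simp]: "cls u \<otimes>\<^bsub>A\<^esub> cls v = cls (u @ v)"
  by (simp add: A_def cls_def presented_monoid_mult)

lemma A_one: "\<one>\<^bsub>A\<^esub> = cls []" by (simp add: A_def cls_def presented_monoid_one)

lemma monoid_A: "monoid A" unfolding A_def by (rule monoid_presented_monoid)

lemma filt_eq: "filt n = cls ` {w. length w \<le> n}" by (simp add: filt_def cls_def[abs_def])

lemma cls_in_filt: "length w \<le> n \<Longrightarrow> cls w \<in> filt n" by (auto simp: filt_eq)

lemma foldr_cls: "foldr (\<otimes>\<^bsub>A\<^esub>) (map (\<lambda>x. cls (f x)) xs) \<one>\<^bsub>A\<^esub> = cls (concat (map f xs))"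
  by (induction xs) (simp_all add: A_one)

lemma filt_mult: "a \<in> filt n \<Longrightarrow> b \<in> filt m \<Longrightarrow> a \<otimes>\<^bsub>A\<^esub> b \<in> filt (n + m)"
  by (auto simp: filt_eq intro!: image_eqI)

lemma filt_mono: "n \<le> m \<Longrightarrow> filt n \<subseteq> filt m" by (auto simp: filt_eq)

lemma Union_filt: "(\<Union>n. filt n) = carrier A"
  by (auto simp: filt_eq A_carrier)

lemma filtered_monoid_alg_A: "field K \<Longrightarrow> filtered_monoid_alg K A filt"
proof (intro filtered_monoid_alg.intro filtered_monoid_alg_axioms.intro monoid_alg.intro)
  fix a n assume "a \<in> filt n"
  then obtain w where w: "a = cls w" "length w \<le> n" by (auto simp: filt_eq)
  have "set (map (\<lambda>x. cls [x]) w) \<subseteq> filt 1" by (auto simp: filt_eq)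
  moreover have "foldr (\<otimes>\<^bsub>A\<^esub>) (map (\<lambda>x. cls [x]) w) \<one>\<^bsub>A\<^esub> = a"
    by (simp add: foldr_cls[where f = "\<lambda>x. [x]"] w)
  ultimately show "\<exists>as. set as \<subseteq> filt 1 \<and> length as \<le> n \<and> foldr (\<otimes>\<^bsub>A\<^esub>) as \<one>\<^bsub>A\<^esub> = a"
    using w(2) by (intro exI[of _ "map (\<lambda>x. cls [x]) w"]) simp
qed (auto simp: monoid_A finite_filt Union_filt filt_mult A_one cls_in_filt dest: filt_mono)

lemma cls_central_word_center: "cls (central_word ms) \<in> mult_center A"
  using eqv_central by (auto simp: mult_center_def A_carrier cls_eq_iff intro: eqv_sym)

text \<open>Length bound for a sorted word whose exponents are all remainders modulo
  \<open>expo\<close>; \<open>filt bound\<close> serves as the finite set of module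
  generators.\<close>

definition bound :: nat where "bound = expo * card (UNIV :: 'x set)"

lemma decomp_cls: "\<exists>ms. \<exists>f\<in>filt bound. cls w = cls (central_word ms) \<otimes>\<^bsub>A\<^esub> f"
proof -
  obtain ms t where mt: "w \<leftrightarrow> central_word ms @ sorted_word t" "\<And>i. t i < expo" using eqv_decomp by blast
  have "length (sorted_word t) = (\<Sum>i\<leftarrow>[0..<card (UNIV :: 'x set)]. t i)"
    by (simp add: sorted_word_def length_concat comp_def)
  also have "\<dots> \<le> (\<Sum>i\<leftarrow>[0..<card (UNIV :: 'x set)]. expo)"
    using mt(2) by (intro sum_list_mono) (simp add: less_imp_le)
  also have "\<dots> = bound" by (simp add: bound_def sum_list_triv)
  finally have "cls (sorted_word t) \<in> filt bound" by (rule cls_in_filt)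
  moreover have "cls w = cls (central_word ms) \<otimes>\<^bsub>A\<^esub> cls (sorted_word t)" using mt(1) by (simp add: cls_eq_iff)
  ultimately show ?thesis by blast
qed

lemma filt_carrier: "filt n \<subseteq> carrier A" using Union_filt by blast

lemma central_by_finite_A: "central_by_finite A"
proof -
  let ?C = "range (\<lambda>ms. cls (central_word ms))"
  have "submonoid ?C A"
  proof
    show "x \<otimes>\<^bsub>A\<^esub> y \<in> ?C" if "x \<in> ?C" "y \<in> ?C" for x y
      using that by (auto intro!: image_eqI simp flip: central_word_simps)
    show "\<one>\<^bsub>A\<^esub> \<in> ?C" using central_word_simps(1) by (metis A_one rangeI)
  qed auto
  moreover have "carrier A = (\<Union>f\<in>filt bound. ?C #>\<^bsub>A\<^esub> f)"
  proof
    show "carrier A \<subseteq> (\<Union>f\<in>filt bound. ?C #>\<^bsub>A\<^esub> f)"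
    proof
      fix a assume "a \<in> carrier A"
      then obtain w where "a = cls w" using A_cases by blast
      then show "a \<in> (\<Union>f\<in>filt bound. ?C #>\<^bsub>A\<^esub> f)"
        using decomp_cls[of w] by (auto simp: r_coset_def)
    qed
    show "(\<Union>f\<in>filt bound. ?C #>\<^bsub>A\<^esub> f) \<subseteq> carrier A"
      by (auto simp: r_coset_def intro!: monoid.m_closed[OF monoid_A] dest: subsetD[OF filt_carrier])
  qed
  moreover have "?C \<subseteq> mult_center A" using cls_central_word_center by auto
  ultimately show ?thesis
    unfolding central_by_finite_def using finite_filt filt_carrier
    by (intro exI[of _ ?C] exI[of _ "filt bound"] conjI)
qed

lemma finite_module_A:
  assumes "field K"
  shows "\<exists>B. affine_subalgebra (scalars K A) B (monoid_algebra K A) \<and>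
    B \<subseteq> mult_center (monoid_algebra K A) \<and> finite_module_over B (monoid_algebra K A)"
proof -
  interpret monoid_alg K A by (intro monoid_alg.intro assms monoid_A)
  let ?z = "\<lambda>x. cls (replicate expo x)"
  show ?thesis
  proof (rule ex_affine_central_subalgebra[where Z = "range ?z" and F = "filt bound"])
    show "range ?z \<subseteq> mult_center A" using cls_central_word_center[of "[x]" for x] by auto
    fix a assume "a \<in> carrier A"
    then obtain w where "a = cls w" using A_cases by blast
    then obtain ms f where "f \<in> filt bound" "a = cls (central_word ms) \<otimes>\<^bsub>A\<^esub> f" using decomp_cls by blast
    moreover have "foldr (\<otimes>\<^bsub>A\<^esub>) (map ?z ms) \<one>\<^bsub>A\<^esub> = cls (central_word ms)"
      by (simp add: foldr_cls central_word_def)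
    moreover have "set (map ?z ms) \<subseteq> range ?z" by auto
    ultimately show "\<exists>zs f. set zs \<subseteq> range ?z \<and> f \<in> filt bound \<and>
        a = foldr (\<otimes>\<^bsub>A\<^esub>) zs \<one>\<^bsub>A\<^esub> \<otimes>\<^bsub>A\<^esub> f" by metis
  qed (use finite_filt filt_carrier in auto)
qed

text \<open>Sorted words give the required parametrization: adding multiples of \<open>expo\<close>
  to the exponents is multiplication by a central word.\<close>

lemma noetherian_A:
  assumes "field K"
  shows "left_right_noetherian (monoid_algebra K A)"
proof -
  have "monoid_alg_nf K A (\<lambda>m. cls (sorted_word (Poly_Mapping.lookup m))) (card (UNIV :: 'x set)) expo"
  proof (intro monoid_alg_nf.intro monoid_alg_nf_axioms.intro monoid_alg.intro assms monoid_A)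
    fix a assume "a \<in> carrier A"
    then obtain w where "a = cls w" using A_cases by blast
    moreover obtain f where "w \<leftrightarrow> sorted_word f" using eqv_sorted_word by blast
    moreover obtain m :: "nat \<Rightarrow>\<^sub>0 nat" where m: "\<And>i. Poly_Mapping.lookup m i = (if i < card (UNIV :: 'x set) then f i else 0)"
      "Poly_Mapping.keys m \<subseteq> {..<card (UNIV :: 'x set)}" using poly_mapping_of_fun by metis
    moreover have "sorted_word f = sorted_word (Poly_Mapping.lookup m)" by (rule sorted_word_cong) (simp add: m)
    ultimately show "\<exists>m. Poly_Mapping.keys m \<subseteq> {..<card (UNIV :: 'x set)} \<and> cls (sorted_word (Poly_Mapping.lookup m)) = a"
      by (metis cls_eq_iff)
  next
    fix t :: "nat \<Rightarrow>\<^sub>0 nat" assume dvd: "\<And>i. expo dvd Poly_Mapping.lookup t i"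
    let ?q = "\<lambda>i. Poly_Mapping.lookup t i div expo"
    have "cls (sorted_word (Poly_Mapping.lookup (m + t))) = cls (central_word (sorted_word ?q)) \<otimes>\<^bsub>A\<^esub> cls (sorted_word (Poly_Mapping.lookup m))"
      for m :: "nat \<Rightarrow>\<^sub>0 nat"
    proof -
      have "Poly_Mapping.lookup (m + t) = (\<lambda>i. Poly_Mapping.lookup m i + expo * ?q i)"
        using dvd by (simp add: lookup_add fun_eq_iff)
      then show ?thesis using eqv_sorted_word_add[of ?q "Poly_Mapping.lookup m"] by (simp add: cls_eq_iff eqv_sym)
    qed
    then show "\<exists>c\<in>mult_center A. \<forall>m. Poly_Mapping.keys m \<subseteq> {..<card (UNIV :: 'x set)} \<longrightarrow>
        cls (sorted_word (Poly_Mapping.lookup (m + t))) = c \<otimes>\<^bsub>A\<^esub> cls (sorted_word (Poly_Mapping.lookup m))"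
      using cls_central_word_center by blast
  qed (simp_all add: expo)
  then show ?thesis by (rule monoid_alg_nf.left_right_noetherian_R)
qed

definition const :: nat where "const = 2 ^ card (UNIV :: 'x set) * expo ^ card (UNIV :: 'x set)"

lemma card_filt_bound: "card (filt n) \<le> const * (n + 1) ^ rk"
  using card_filt_le[of n] by (simp only: const_def)

section \<open>Orbit counts and the lower growth bound\<close>

definition S0 :: "'x set" where "S0 = (SOME S. card (orbits S) = rk)"

definition Orb :: "nat \<Rightarrow> 'x set" where "Orb = (SOME f. bij_betw f {0..<rk} (orbits S0))"

lemma card_orbits_S0: "card (orbits S0) = rk"
  unfolding S0_def using rk_witness by (rule someI_ex) blast

lemma bij_Orb: "bij_betw Orb {..<rk} (orbits S0)"
proof -
  have "finite (orbits S0)" by (simp add: orbits_def)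
  then have "\<exists>f. bij_betw f {0..<rk} (orbits S0)"
    using ex_bij_betw_nat_finite card_orbits_S0 by metis
  from someI_ex[OF this] show ?thesis by (simp add: Orb_def atLeast0LessThan)
qed

lemma Orb_rep: "j < rk \<Longrightarrow> \<exists>y\<in>S0. Orb j = orb S0 `` {y}"
  using bij_betwE[OF bij_Orb] by (auto simp: orbits_def)

lemma Orb_closed: "j < rk \<Longrightarrow> orb S0 `` Orb j \<subseteq> Orb j"
  using Orb_rep[of j] orb_trans by blast

lemma Orb_disjoint: "i < rk \<Longrightarrow> j < rk \<Longrightarrow> x \<in> Orb i \<Longrightarrow> x \<in> Orb j \<Longrightarrow> i = j"
proof -
  assume *: "i < rk" "j < rk" "x \<in> Orb i" "x \<in> Orb j"
  obtain y z where "Orb i = orb S0 `` {y}" "Orb j = orb S0 `` {z}" using Orb_rep * by meson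
  moreover have "(y, x) \<in> orb S0" "(z, x) \<in> orb S0" using * calculation by auto
  ultimately have "Orb i = Orb j" using orb_sym orb_trans by blast
  then show "i = j" using bij_Orb * by (metis bij_betw_def inj_onD lessThan_iff)
qed

lemma Orb_subset: "j < rk \<Longrightarrow> Orb j \<subseteq> orb S0 `` S0" using Orb_rep by blast

text \<open>Meaningful only on letters in the orbits of \<open>S0\<close>; elsewhere its value is
  unspecified, so invariance of the counts is claimed only for words over these orbits.\<close>

definition orbit_index :: "'x \<Rightarrow> nat" where "orbit_index x = (THE j. j < rk \<and> x \<in> Orb j)"

lemma orbit_index_eq: "j < rk \<Longrightarrow> x \<in> Orb j \<Longrightarrow> orbit_index x = j"
  unfolding orbit_index_def using Orb_disjoint by (intro the_equality) auto

lemma Orb_cover: "x \<in> orb S0 `` S0 \<Longrightarrow> orbit_index x < rk \<and> x \<in> Orb (orbit_index x)"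
proof -
  assume "x \<in> orb S0 `` S0"
  then obtain y where y: "y \<in> S0" "(y, x) \<in> orb S0" by blast
  then have "orb S0 `` {y} \<in> orbits S0" by (simp add: orbits_def)
  then obtain j where "j < rk" "orb S0 `` {y} = Orb j"
    using bij_Orb by (metis bij_betw_def imageE lessThan_iff)
  then show ?thesis using y orbit_index_eq[of j x] by auto
qed

definition orbit_letter :: "nat \<Rightarrow> 'x" where "orbit_letter j = (SOME y. y \<in> S0 \<and> y \<in> Orb j)"

lemma orbit_letter: "j < rk \<Longrightarrow> orbit_letter j \<in> S0 \<and> orbit_letter j \<in> Orb j"
  unfolding orbit_letter_def by (rule someI_ex) (use Orb_rep orb_refl in blast)

definition letter_count :: "'x list \<Rightarrow> (nat \<Rightarrow>\<^sub>0 nat)" where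
  "letter_count w = sum_list (map (\<lambda>x. Poly_Mapping.single (orbit_index x) 1) w)"

lemma letter_count_append: "letter_count (u @ v) = letter_count u + letter_count v" by (simp add: letter_count_def)

lemma lookup_letter_count: "Poly_Mapping.lookup (letter_count w) j = length (filter (\<lambda>x. orbit_index x = j) w)"
  by (induction w) (simp_all add: letter_count_def lookup_add lookup_single when_def)

lemma letter_count_cong:
  assumes "u \<leftrightarrow> v" "set u \<subseteq> orb S0 `` S0"
  shows "letter_count u = letter_count v"
proof (rule poly_mapping_eqI)
  fix j
  have "orb S0 `` (orb S0 `` S0) \<subseteq> orb S0 `` S0" using orb_trans by blast
  then have v: "set v \<subseteq> orb S0 `` S0"
    using eqv_set_subset[OF assms(1), of "orb S0 `` S0" S0] assms(2) by blast
  show "Poly_Mapping.lookup (letter_count u) j = Poly_Mapping.lookup (letter_count v) j"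
  proof (cases "j < rk")
    case True
    have "filter (\<lambda>x. orbit_index x = j) w = filter (\<lambda>x. x \<in> Orb j) w" if "set w \<subseteq> orb S0 `` S0" for w
      using that Orb_cover orbit_index_eq[OF True] by (intro filter_cong) auto
    then show ?thesis
      using eqv_orbit_count[OF assms Orb_closed[OF True]] assms(2) v by (simp add: lookup_letter_count)
  next
    case False
    have "filter (\<lambda>x. orbit_index x = j) w = []" if "set w \<subseteq> orb S0 `` S0" for w
      using that Orb_cover False by (auto simp: filter_empty_conv)
    then show ?thesis using assms(2) v by (simp add: lookup_letter_count)
  qed
qed

text \<open>Products of central powers of one letter per orbit. They form the free abelian submonoid
  that attains the rank, and counting them gives the lower growth bound.\<close>

definition orbit_word :: "(nat \<Rightarrow> nat) \<Rightarrow> 'x list" where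
  "orbit_word f = central_word (concat (map (\<lambda>j. replicate (f j) (orbit_letter j)) [0..<rk]))"

lemma set_orbit_word: "set (orbit_word f) \<subseteq> orb S0 `` S0"
proof
  fix x assume "x \<in> set (orbit_word f)"
  then obtain j where "j < rk" "x = orbit_letter j" by (auto simp: orbit_word_def)
  then have "x \<in> S0" using orbit_letter by blast
  then show "x \<in> orb S0 `` S0" using orb_refl by blast
qed

lemma length_orbit_word: "length (orbit_word f) = expo * (\<Sum>j<rk. f j)"
  by (simp add: orbit_word_def length_concat comp_def interv_sum_list_conv_sum_set_nat atLeast0LessThan)

lemma lookup_letter_count_orbit_word:
  assumes "j < rk"
  shows "Poly_Mapping.lookup (letter_count (orbit_word f)) j = expo * f j"
proof -
  have 1: "length (filter (\<lambda>x. orbit_index x = j) (central_word w)) = expo * length (filter (\<lambda>x. orbit_index x = j) w)" for w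
    by (induction w) auto
  have "length (filter (\<lambda>x. orbit_index x = j) (concat (map (\<lambda>j. replicate (f j) (orbit_letter j)) [0..<k])))
      = (if j < k then f j else 0)" if "k \<le> rk" for k
    using that
  proof (induction k)
    case (Suc k)
    have "orbit_index (orbit_letter k) = k" using Suc.prems orbit_letter[of k] by (intro orbit_index_eq) auto
    then show ?case using Suc by (auto simp: less_Suc_eq)
  qed simp
  then show ?thesis using assms by (simp add: lookup_letter_count orbit_word_def 1)
qed

lemma orbit_word_inj: "orbit_word f \<leftrightarrow> orbit_word g \<Longrightarrow> j < rk \<Longrightarrow> f j = g j"
  using letter_count_cong[of "orbit_word f" "orbit_word g"] set_orbit_word lookup_letter_count_orbit_word[of j f] lookup_letter_count_orbit_word[of j g] expo(1) by auto

lemma orbit_word_add: "orbit_word f @ orbit_word g \<leftrightarrow> orbit_word (\<lambda>j. f j + g j)"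
proof -
  have "mset (concat (map (\<lambda>j. replicate (f j) (orbit_letter j)) [0..<k])) + mset (concat (map (\<lambda>j. replicate (g j) (orbit_letter j)) [0..<k]))
      = mset (concat (map (\<lambda>j. replicate (f j + g j) (orbit_letter j)) [0..<k]))" for k
    by (induction k) (auto simp: replicate_add)
  then have "central_word (concat (map (\<lambda>j. replicate (f j) (orbit_letter j)) [0..<rk]) @ concat (map (\<lambda>j. replicate (g j) (orbit_letter j)) [0..<rk]))
      \<leftrightarrow> central_word (concat (map (\<lambda>j. replicate (f j + g j) (orbit_letter j)) [0..<rk]))"
    by (intro eqv_central_word_mset) simp
  then show ?thesis by (simp add: orbit_word_def)
qed

text \<open>Exponent vectors with entries at most m give distinct classes, separated by
  \<open>letter_count\<close>. The radius bounds the length of the words; the summand 1 makes the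
  scale factor visibly positive, as \<open>GKdim_eq\<close> requires.\<close>

lemma card_filt_ge: "(m + 1) ^ rk \<le> card (filt ((expo * rk + 1) * m))"
proof -
  let ?F = "{..<rk} \<rightarrow>\<^sub>E {..m}"
  have inj: "inj_on (\<lambda>f. cls (orbit_word f)) ?F"
  proof (rule inj_onI)
    fix f g assume fg: "f \<in> ?F" "g \<in> ?F" "cls (orbit_word f) = cls (orbit_word g)"
    then have "f j = g j" if "j < rk" for j using that orbit_word_inj by (simp add: cls_eq_iff)
    then show "f = g" using fg(1,2) by (intro PiE_ext) auto
  qed
  have "cls (orbit_word f) \<in> filt ((expo * rk + 1) * m)" if "f \<in> ?F" for f
  proof (rule cls_in_filt)
    have "(\<Sum>j<rk. f j) \<le> (\<Sum>j<rk. m)" using that by (intro sum_mono) auto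
    then have "length (orbit_word f) \<le> expo * (rk * m)" by (simp add: length_orbit_word)
    then show "length (orbit_word f) \<le> (expo * rk + 1) * m" by (simp add: algebra_simps)
  qed
  then have "(\<lambda>f. cls (orbit_word f)) ` ?F \<subseteq> filt ((expo * rk + 1) * m)" by blast
  then have "card ?F \<le> card (filt ((expo * rk + 1) * m))"
    using card_inj_on_le[OF inj] finite_filt by blast
  then show ?thesis by (simp add: card_PiE)
qed

lemma GKdim_A:
  assumes "field K"
  shows "GKdim (scalars K A) (monoid_algebra K A) = ereal (real rk)"
proof -
  interpret filtered_monoid_alg K A filt by (rule filtered_monoid_alg_A[OF assms])
  show ?thesis by (rule GKdim_eq[OF card_filt_bound card_filt_ge]) simp
qed

text \<open>The elements of a free abelian submonoid with exponents at most m are (m + 1)^n in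
  number and lie in a ball of radius proportional to m, so the upper growth bound limits n.\<close>

lemma rank_le_rk:
  assumes N: "submonoid N A" "A\<lparr>carrier := N\<rparr> \<cong> free_abelian_monoid n"
  shows "n \<le> rk"
proof -
  obtain h where h: "h \<in> hom (A\<lparr>carrier := N\<rparr>) (free_abelian_monoid n)"
    "bij_betw h N (carrier (free_abelian_monoid n))"
    using N(2) by (auto simp: is_iso_def iso_def)
  let ?X = "{c :: nat \<Rightarrow>\<^sub>0 nat. Poly_Mapping.keys c \<subseteq> {..<n}}"
  have hb: "bij_betw h N ?X" using h(2) by (simp add: free_abelian_monoid_def)
  have hm: "h (x \<otimes>\<^bsub>A\<^esub> y) = h x + h y" if "x \<in> N" "y \<in> N" for x y
    using hom_mult[OF h(1)] that by (simp add: free_abelian_monoid_def)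
  define g where "g = the_inv_into N h"
  have gN: "g c \<in> N" and hg: "h (g c) = c" if "c \<in> ?X" for c
    using that hb bij_betwE[OF bij_betw_the_inv_into[OF hb]] by (auto simp: g_def f_the_inv_into_f_bij_betw)
  have gm: "g (c + c') = g c \<otimes>\<^bsub>A\<^esub> g c'" if "c \<in> ?X" "c' \<in> ?X" for c c'
  proof -
    have "g c \<otimes>\<^bsub>A\<^esub> g c' \<in> N" using that gN submonoid.m_closed[OF N(1)] by blast
    moreover have "h (g c \<otimes>\<^bsub>A\<^esub> g c') = c + c'" using that hm gN hg by simp
    ultimately show ?thesis unfolding g_def using hb by (intro the_inv_into_f_eq) (auto simp: bij_betw_def)
  qed
  have NA: "N \<subseteq> carrier A" using submonoid.subset[OF N(1)] .
  have g0: "g 0 = \<one>\<^bsub>A\<^esub>"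
  proof -
    have o: "\<one>\<^bsub>A\<^esub> \<in> N" using submonoid.one_closed[OF N(1)] .
    then have "h \<one>\<^bsub>A\<^esub> + h \<one>\<^bsub>A\<^esub> = h \<one>\<^bsub>A\<^esub>"
      using hm[OF o o] monoid.l_one[OF monoid_A monoid.one_closed[OF monoid_A]] by simp
    then have "h \<one>\<^bsub>A\<^esub> = 0" by simp
    then show ?thesis unfolding g_def using hb o by (intro the_inv_into_f_eq) (auto simp: bij_betw_def)
  qed
  have single: "Poly_Mapping.single i 1 \<in> ?X" if "i < n" for i
    using that by (simp add: keys_single)
  have "\<forall>i. \<exists>l. i < n \<longrightarrow> g (Poly_Mapping.single i 1) \<in> filt l"
    using gN[OF single] NA Union_filt by blast
  from choice[OF this] obtain l where l: "\<And>i. i < n \<Longrightarrow> g (Poly_Mapping.single i 1) \<in> filt (l i)" by blast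
  define L where "L = (\<Sum>i<n. l i)"
  have lL: "g (Poly_Mapping.single i 1) \<in> filt L" if "i < n" for i
    using l[OF that] filt_mono[of "l i" L] member_le_sum[of i "{..<n}" l] that by (auto simp: L_def)
  have gfilt: "g c \<in> filt (L * (\<Sum>i<n. Poly_Mapping.lookup c i))" if "c \<in> ?X" for c
    using that
  proof (induction "\<Sum>i<n. Poly_Mapping.lookup c i" arbitrary: c)
    case 0
    then have "Poly_Mapping.lookup c i = 0" for i
      by (cases "i < n") (auto simp: in_keys_iff)
    then have "c = 0" by (intro poly_mapping_eqI) simp
    then show ?case by (simp add: g0 A_one cls_in_filt)
  next
    case (Suc k)
    then obtain i where i: "i < n" "Poly_Mapping.lookup c i > 0"
      by (metis lessThan_iff neq0_conv sum.neutral nat.distinct(1))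
    define c' where "c' = c - Poly_Mapping.single i 1"
    have lc': "Poly_Mapping.lookup c j = Poly_Mapping.lookup c' j + (if j = i then 1 else 0)" for j
      using i(2) by (simp add: c'_def lookup_minus lookup_single when_def)
    have c: "c = c' + Poly_Mapping.single i 1"
      by (rule poly_mapping_eqI) (simp add: lookup_add lookup_single when_def lc')
    have c'X: "c' \<in> ?X"
    proof -
      have "Poly_Mapping.keys c' \<subseteq> Poly_Mapping.keys c" by (auto simp: in_keys_iff lc')
      then show ?thesis using Suc.prems by auto
    qed
    have sum: "(\<Sum>j<n. Poly_Mapping.lookup c j) = (\<Sum>j<n. Poly_Mapping.lookup c' j) + 1"
      using i(1) by (simp add: lc' sum.distrib)
    then have k: "k = (\<Sum>j<n. Poly_Mapping.lookup c' j)" using Suc.hyps(2) by simp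
    have "g c = g c' \<otimes>\<^bsub>A\<^esub> g (Poly_Mapping.single i 1)" by (subst c) (rule gm[OF c'X single[OF i(1)]])
    also have "\<dots> \<in> filt (L * k + L)"
      using Suc.hyps(1)[OF k c'X] lL[OF i(1)] unfolding k by (rule filt_mult)
    finally show ?case by (simp add: sum k algebra_simps)
  qed
  have "(m + 1) ^ n \<le> const * ((L * n) * m + 1) ^ rk" for m
  proof -
    let ?F = "{..<n} \<rightarrow>\<^sub>E {..m}"
    have "\<forall>f. \<exists>c :: nat \<Rightarrow>\<^sub>0 nat. c \<in> ?X \<and> (\<forall>i<n. Poly_Mapping.lookup c i = f i)"
    proof
      fix f :: "nat \<Rightarrow> nat"
      obtain c :: "nat \<Rightarrow>\<^sub>0 nat" where "\<And>i. Poly_Mapping.lookup c i = (if i < n then f i else 0)"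
        "Poly_Mapping.keys c \<subseteq> {..<n}" using poly_mapping_of_fun by metis
      then show "\<exists>c :: nat \<Rightarrow>\<^sub>0 nat. c \<in> ?X \<and> (\<forall>i<n. Poly_Mapping.lookup c i = f i)" by auto
    qed
    from choice[OF this] obtain pm :: "(nat \<Rightarrow> nat) \<Rightarrow> (nat \<Rightarrow>\<^sub>0 nat)"
      where pm: "\<And>f. pm f \<in> ?X" "\<And>f i. i < n \<Longrightarrow> Poly_Mapping.lookup (pm f) i = f i" by blast
    have inj: "inj_on (\<lambda>f. g (pm f)) ?F"
    proof (rule inj_onI)
      fix f f' assume ff: "f \<in> ?F" "f' \<in> ?F" "g (pm f) = g (pm f')"
      then have "pm f = pm f'" using hg[OF pm(1)] by metis
      then have "f i = f' i" if "i < n" for i using pm(2)[OF that] by metis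
      then show "f = f'" using ff(1,2) by (intro PiE_ext) auto
    qed
    have "g (pm f) \<in> filt ((L * n) * m)" if "f \<in> ?F" for f
    proof -
      have "(\<Sum>i<n. Poly_Mapping.lookup (pm f) i) \<le> (\<Sum>i<n. m)"
        using that pm(2) by (intro sum_mono) auto
      then have "L * (\<Sum>i<n. Poly_Mapping.lookup (pm f) i) \<le> (L * n) * m" by (simp add: mult.assoc)
      then show ?thesis using gfilt[OF pm(1)] filt_mono by blast
    qed
    then have "card ?F \<le> card (filt ((L * n) * m))"
      using card_inj_on_le[OF inj] finite_filt by blast
    then show ?thesis using card_filt_bound[of "(L * n) * m"] by (simp add: card_PiE)
  qed
  then show ?thesis by (rule degree_le_of_power_bound)
qed

text \<open>The bound is attained by the orbit words: \<open>orbit_word_add\<close> makes \<phi>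
  multiplicative and \<open>orbit_word_inj\<close> makes it injective. Its inverse is the
  isomorphism, since the rank is defined by maps from the submonoid to the free one.\<close>

lemma monoid_rank_A: "monoid_rank A = enat rk"
proof (rule monoid_rank_eqI)
  show "n \<le> rk" if "submonoid N A" "A\<lparr>carrier := N\<rparr> \<cong> free_abelian_monoid n" for n N
    using that by (rule rank_le_rk)
  let ?X = "{c :: nat \<Rightarrow>\<^sub>0 nat. Poly_Mapping.keys c \<subseteq> {..<rk}}"
  define \<phi> where "\<phi> c = cls (orbit_word (Poly_Mapping.lookup c))" for c :: "nat \<Rightarrow>\<^sub>0 nat"
  have \<phi>m: "\<phi> (c + c') = \<phi> c \<otimes>\<^bsub>A\<^esub> \<phi> c'" for c c'
    using orbit_word_add[of "Poly_Mapping.lookup c" "Poly_Mapping.lookup c'"]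
    by (simp add: \<phi>_def cls_eq_iff lookup_add[abs_def] eqv_sym plus_poly_mapping.rep_eq)
  have inj: "inj_on \<phi> ?X"
  proof (rule inj_onI)
    fix c c' assume *: "c \<in> ?X" "c' \<in> ?X" "\<phi> c = \<phi> c'"
    show "c = c'"
    proof (rule poly_mapping_eqI)
      fix j
      show "Poly_Mapping.lookup c j = Poly_Mapping.lookup c' j"
      proof (cases "j < rk")
        case True
        then show ?thesis using * orbit_word_inj by (simp add: \<phi>_def cls_eq_iff)
      next
        case False
        then have "j \<notin> Poly_Mapping.keys c" "j \<notin> Poly_Mapping.keys c'" using * by auto
        then show ?thesis by (simp add: in_keys_iff)
      qed
    qed
  qed
  have X_add: "c + c' \<in> ?X" if "c \<in> ?X" "c' \<in> ?X" for c c'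
    using that keys_add[of c c'] by auto
  let ?N = "\<phi> ` ?X"
  show "submonoid ?N A"
  proof
    show "?N \<subseteq> carrier A" by (auto simp: \<phi>_def)
    show "x \<otimes>\<^bsub>A\<^esub> y \<in> ?N" if "x \<in> ?N" "y \<in> ?N" for x y
      using that X_add by (auto simp flip: \<phi>m)
    have "concat (map (\<lambda>j. replicate (Poly_Mapping.lookup (0 :: nat \<Rightarrow>\<^sub>0 nat) j) (orbit_letter j)) [0..<rk]) = []"
      by simp
    then have "\<phi> 0 = \<one>\<^bsub>A\<^esub>" by (simp only: \<phi>_def A_one orbit_word_def central_word_simps)
    then show "\<one>\<^bsub>A\<^esub> \<in> ?N" by (metis (mono_tags, lifting) empty_subsetI imageI keys_zero mem_Collect_eq)
  qed
  let ?h = "the_inv_into ?X \<phi>"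
  have h\<phi>: "?h (\<phi> c) = c" if "c \<in> ?X" for c using inj that by (rule the_inv_into_f_f)
  have "?h \<in> iso (A\<lparr>carrier := ?N\<rparr>) (free_abelian_monoid rk)"
  proof (rule isoI)
    show "?h \<in> hom (A\<lparr>carrier := ?N\<rparr>) (free_abelian_monoid rk)"
    proof (rule homI)
      fix x assume "x \<in> carrier (A\<lparr>carrier := ?N\<rparr>)"
      then show "?h x \<in> carrier (free_abelian_monoid rk)"
        using h\<phi> by (auto simp: free_abelian_monoid_def)
    next
      fix x y assume "x \<in> carrier (A\<lparr>carrier := ?N\<rparr>)" "y \<in> carrier (A\<lparr>carrier := ?N\<rparr>)"
      then obtain c c' where c: "c \<in> ?X" "c' \<in> ?X" "x = \<phi> c" "y = \<phi> c'" by auto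
      have "?h (\<phi> c \<otimes>\<^bsub>A\<^esub> \<phi> c') = c + c'" unfolding \<phi>m[symmetric] by (rule h\<phi>[OF X_add[OF c(1,2)]])
      then show "?h (x \<otimes>\<^bsub>A\<lparr>carrier := ?N\<rparr>\<^esub> y) = ?h x \<otimes>\<^bsub>free_abelian_monoid rk\<^esub> ?h y"
        using c h\<phi> by (simp add: free_abelian_monoid_def)
    qed
    show "bij_betw ?h (carrier (A\<lparr>carrier := ?N\<rparr>)) (carrier (free_abelian_monoid rk))"
      using bij_betw_the_inv_into[OF bij_betw_imageI[OF inj HOL.refl]] by (simp add: free_abelian_monoid_def)
  qed
  then show "A\<lparr>carrier := ?N\<rparr> \<cong> free_abelian_monoid rk" by (auto simp: is_iso_def)
qed

section \<open>The chain of prime ideals\<close>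

definition orbit_tail :: "nat \<Rightarrow> 'x set" where "orbit_tail i = (\<Union>j\<in>{i..<rk}. Orb j)"

text \<open>The faces shrink as i grows, from all elements over the orbits of \<open>S0\<close> at i
  = 0 to the identity alone at i = \<open>rk\<close>; the kernels grow accordingly.\<close>

definition orbit_face :: "nat \<Rightarrow> 'x list set set" where "orbit_face i = cls ` {w. set w \<subseteq> orbit_tail i}"

text \<open>The representing word is arbitrary; on the faces \<open>letter_count\<close> is
  independent of it, by \<open>letter_count_cong\<close>.\<close>

definition count_vec :: "'x list set \<Rightarrow> (nat \<Rightarrow>\<^sub>0 nat)" where "count_vec a = letter_count (SOME w. a = cls w)"

lemma orbit_tail_subset: "orbit_tail i \<subseteq> orb S0 `` S0"
  unfolding orbit_tail_def by (rule UN_least, rule Orb_subset) simp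

lemma orbit_tail_closed: "orb S0 `` orbit_tail i \<subseteq> orbit_tail i"
  using Orb_closed by (fastforce simp: orbit_tail_def)

lemma cls_in_orbit_face: "cls w \<in> orbit_face i \<longleftrightarrow> set w \<subseteq> orbit_tail i"
proof -
  have "cls w \<in> orbit_face i \<longleftrightarrow> (\<exists>v. w \<leftrightarrow> v \<and> set v \<subseteq> orbit_tail i)"
    by (auto simp: orbit_face_def image_iff cls_eq_iff)
  then show ?thesis using eqv_set_subset[OF _ orbit_tail_subset orbit_tail_closed] eqv_refl by blast
qed

lemma count_vec_cls: "set w \<subseteq> orb S0 `` S0 \<Longrightarrow> count_vec (cls w) = letter_count w"
proof -
  assume w: "set w \<subseteq> orb S0 `` S0"
  have "cls w = cls (SOME v. cls w = cls v)" by (rule someI[of "\<lambda>v. cls w = cls v" w]) simp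
  then show ?thesis unfolding count_vec_def using letter_count_cong[OF _ w] by (metis cls_eq_iff)
qed

lemma clKdim_A:
  assumes "field K"
  shows "clKdim (monoid_algebra K A) = enat rk"
proof (rule clKdim_eqI)
  interpret filtered_monoid_alg K A filt by (rule filtered_monoid_alg_A[OF assms])
  obtain B where B: "affine_subalgebra (scalars K A) B (monoid_algebra K A)"
    "B \<subseteq> mult_center (monoid_algebra K A)" "finite_module_over B (monoid_algebra K A)"
    using finite_module_A[OF assms] by blast
  have "subring B R" using B(1) by (simp add: affine_subalgebra_def unital_subalgebra_def)
  fix n and P :: "nat \<Rightarrow> ('x list set \<Rightarrow> 'a) set"
  assume chain: "\<And>i. i \<le> n \<Longrightarrow> nc_prime_ideal (P i) R" "\<And>i. i < n \<Longrightarrow> P i \<subset> P (Suc i)"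
  obtain L where L: "\<And>m. (m + 1) ^ n \<le> card (filt (L * m))"
    using prime_chain_growth[where Pr = P and n = n, OF \<open>subring B R\<close> B(2,3) chain] by blast
  show "n \<le> rk"
    by (rule degree_le_of_power_bound[of n const L rk]) (rule order_trans[OF L card_filt_bound])
next
  have face: "monoid_alg_face K A (orbit_face i) count_vec" for i
  proof (intro monoid_alg_face.intro monoid_alg_face_axioms.intro monoid_alg.intro assms monoid_A)
    fix a b assume "a \<in> carrier A" "b \<in> carrier A"
    then obtain u v where uv: "a = cls u" "b = cls v" using A_cases by metis
    then show "a \<otimes>\<^bsub>A\<^esub> b \<in> orbit_face i \<longleftrightarrow> a \<in> orbit_face i \<and> b \<in> orbit_face i" by (simp add: cls_in_orbit_face)
    assume "a \<in> orbit_face i" "b \<in> orbit_face i"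
    then have "set u \<subseteq> orb S0 `` S0" "set v \<subseteq> orb S0 `` S0"
      using uv orbit_tail_subset[of i] by (auto simp: cls_in_orbit_face)
    then show "count_vec (a \<otimes>\<^bsub>A\<^esub> b) = count_vec a + count_vec b" using uv by (simp add: count_vec_cls letter_count_append)
  qed (auto simp: A_one cls_in_orbit_face count_vec_cls letter_count_def)
  let ?P = "\<lambda>i. monoid_alg_face.push_kernel K A (orbit_face i) count_vec"
  show "nc_prime_ideal (?P i) (monoid_algebra K A)" for i
    by (rule monoid_alg_face.nc_prime_push_kernel[OF face])
  show "?P i \<subset> ?P (Suc i)" if i: "i < rk" for i
  proof
    have "{i..<rk} = insert i {Suc i..<rk}" using i by auto
    then have Yi: "orbit_tail i = Orb i \<union> orbit_tail (Suc i)" by (simp add: orbit_tail_def)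
    \<comment> \<open>The next face is cut out by the vanishing of coordinate i of the count, the
      form that \<open>push_kernel_mono\<close> asks for.\<close>
    have "orbit_face (Suc i) = {a \<in> orbit_face i. Poly_Mapping.lookup (count_vec a) i = 0}"
    proof -
      have "set w \<subseteq> orbit_tail (Suc i) \<longleftrightarrow> set w \<subseteq> orbit_tail i \<and> Poly_Mapping.lookup (count_vec (cls w)) i = 0" for w
      proof (cases "set w \<subseteq> orbit_tail i")
        case True
        have "Poly_Mapping.lookup (count_vec (cls w)) i = 0 \<longleftrightarrow> (\<forall>x\<in>set w. orbit_index x \<noteq> i)"
          using True orbit_tail_subset[of i] by (subst count_vec_cls) (auto simp: lookup_letter_count filter_empty_conv)
        moreover have "orbit_index x \<noteq> i \<longleftrightarrow> x \<in> orbit_tail (Suc i)" if "x \<in> set w" for x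
        proof -
          have "x \<in> orbit_tail i" using that True by blast
          then obtain j where j: "i \<le> j" "j < rk" "x \<in> Orb j" by (auto simp: orbit_tail_def)
          then have "orbit_index x = j" by (intro orbit_index_eq)
          moreover have "x \<in> orbit_tail (Suc i) \<longleftrightarrow> j \<noteq> i"
          proof
            assume "x \<in> orbit_tail (Suc i)"
            then obtain l where l: "Suc i \<le> l" "l < rk" "x \<in> Orb l" by (auto simp: orbit_tail_def)
            then show "j \<noteq> i" using Orb_disjoint[OF l(2) j(2) l(3) j(3)] by simp
          next
            assume "j \<noteq> i"
            then have "j \<in> {Suc i..<rk}" using j by auto
            then show "x \<in> orbit_tail (Suc i)" using j(3) unfolding orbit_tail_def by blast
          qed
          ultimately show ?thesis by simp
        qed
        ultimately show ?thesis using True by auto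
      qed (use Yi in auto)
      then have *: "cls w \<in> orbit_face (Suc i) \<longleftrightarrow> cls w \<in> {a \<in> orbit_face i. Poly_Mapping.lookup (count_vec a) i = 0}" for w
        by (simp add: cls_in_orbit_face)
      show ?thesis
      proof (rule Set.set_eqI)
        fix a
        show "a \<in> orbit_face (Suc i) \<longleftrightarrow> a \<in> {a \<in> orbit_face i. Poly_Mapping.lookup (count_vec a) i = 0}"
        proof (cases "a \<in> range cls")
          case True
          then obtain w where "a = cls w" by blast
          then show ?thesis using * by (simp only:)
        next
          case False
          then have "a \<notin> orbit_face j" for j by (auto simp: orbit_face_def)
          then show ?thesis by simp
        qed
      qed
    qed
    then show "?P i \<subseteq> ?P (Suc i)" by (rule push_kernel_mono[OF face face])
    interpret field K by fact
    have y: "orbit_letter i \<in> Orb i" using orbit_letter[OF i] by simp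
    have "orbit_letter i \<in> orbit_tail i" using y Yi by blast
    moreover have "orbit_letter i \<notin> orbit_tail (Suc i)"
    proof
      assume "orbit_letter i \<in> orbit_tail (Suc i)"
      then obtain l where l: "Suc i \<le> l" "l < rk" "orbit_letter i \<in> Orb l" by (auto simp: orbit_tail_def)
      then show False using Orb_disjoint[OF i l(2) y l(3)] by simp
    qed
    ultimately have "cls [orbit_letter i] \<in> orbit_face i" "cls [orbit_letter i] \<notin> orbit_face (Suc i)" by (simp_all add: cls_in_orbit_face)
    \<comment> \<open>The monomial on a letter of orbit i is killed by the next map but not by the
      current one.\<close>
    then have "monoid_alg.mon K \<one>\<^bsub>K\<^esub> (cls [orbit_letter i]) \<in> ?P (Suc i)"
      "monoid_alg.mon K \<one>\<^bsub>K\<^esub> (cls [orbit_letter i]) \<notin> ?P i"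
      using monoid_alg_face.mon_in_push_kernel[OF face, of "\<one>\<^bsub>K\<^esub>" "cls [orbit_letter i]"] by simp_all
    then show "?P i \<noteq> ?P (Suc i)" by blast
  qed
qed

lemma pi_algebra_A:
  assumes "field K"
  shows "pi_algebra (scalars K A) (monoid_algebra K A)"
proof -
  interpret monoid_alg K A by (intro monoid_alg.intro assms monoid_A)
  obtain B where B: "affine_subalgebra (scalars K A) B R" "B \<subseteq> mult_center R" "finite_module_over B R"
    using finite_module_A[OF assms] by blast
  show ?thesis
  proof (rule R.pi_algebra_finite_module[OF _ B(2,3)])
    show "subring B R" using B(1) by (simp add: affine_subalgebra_def unital_subalgebra_def)
    show "subring (scalars K A) R"
      by (rule subfieldE(1)[OF subfield_scalars])
    show "\<one>\<^bsub>R\<^esub> \<noteq> \<zero>\<^bsub>R\<^esub>" by (metis K.one_not_zero mon_def one_eq zero_eq)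
  qed
qed

end

theorem theorem2p7:
  fixes r :: "'x::finite \<times> 'x \<Rightarrow> 'x \<times> 'x"
  assumes "ybe_solution r" and "bij r" and "left_nondegenerate r"
  shows "let A = derived_structure_monoid r in
    central_by_finite A \<and>
    (\<forall>K :: ('k, 'm) ring_scheme. field K \<longrightarrow>
       (let KA = monoid_algebra K A; k = scalars K A in
         (\<exists>B. affine_subalgebra k B KA \<and> B \<subseteq> mult_center KA \<and> finite_module_over B KA) \<and>
         left_right_noetherian KA \<and>
         pi_algebra k KA \<and>
         ereal_of_enat (clKdim KA) = GKdim k KA \<and>
         GKdim k KA = ereal_of_enat (monoid_rank A))) \<and>
    monoid_rank A \<le> enat (card (UNIV :: 'x set)) \<and>
    (monoid_rank A = enat (card (UNIV :: 'x set)) \<longleftrightarrow> involutive r)"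
proof -
  interpret finite_rack "sigma r"
    by unfold_locales (use assms bij_sigma sigma_sigma in auto)
  have A: "derived_structure_monoid r = A"
    by (simp add: derived_structure_monoid_def A_def rels_def)
  show ?thesis
    unfolding A Let_def
    \<comment> \<open>Both dimensions and the rank have been evaluated to \<open>rk\<close>, so the
      remaining claims reduce to \<open>rk_le\<close> and \<open>rk_eq_iff\<close>.\<close>
    by (simp add: central_by_finite_A finite_module_A noetherian_A pi_algebra_A clKdim_A GKdim_A
        monoid_rank_A rk_le rk_eq_iff involutive_iff_sigma[OF assms(3)])
qed

end
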